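(* Let $F$ be a probability distribution on the real line and let $(F_\sigma)_{0<\sigma<\infty}$, $F_\sigma(x)=F(x/\sigma)$, be the scale model induced by $F$. The following statements are equivalent: (i) $\mathcal{I}_{\rm s}(F_\sigma)<\infty$ at some $0<\sigma<\infty$. (ii) The scale model is $L_2$-differentiable at some $0<\sigma<\infty$. (iii) The scale model has the LAN property (local asymptotic normality) at some $0<\sigma<\infty$, that is, at this $\sigma$, for each $h\in\mathbb{R}$, as $n\to\infty$, $$\log\frac{dF^n_{\sigma+h/\sqrt n}}{dF^n_\sigma}=\frac{1}{\sqrt n}\sum_{i=1}^n h\,\Lambda_\sigma(x_i)-\frac12\,h^2\,\mathcal{I}_{\rm s}(F_\sigma)+o_{F^n_\sigma}(n^0),$$ with the score function $\Lambda_\sigma$ of the scale model and with $\mathcal{I}_{\rm s}(F_\sigma)$ the Fisher information of scale.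
   Context: Distributions are identified with their distribution functions, so $F_1=F$. Fisher information of scale: Let $\mathcal{C}_{\rm c1}$ denote the set of all differentiable functions $\phi\colon\mathbb{R}\to\mathbb{R}$ whose derivative $\phi'$ is continuous and of compact support. Define $$\mathcal{I}_{\rm s1}(F):=\sup_{\phi\in\mathcal{C}_{\rm c1}}\frac{\bigl(\int x\,\phi'(x)\,F(dx)\bigr)^2}{\int\phi^2(x)\,F(dx)}\in[0,\infty],$$ where by convention $0/0:=0$, and $c/0:=\infty$ for $c>0$. For the scale transforms of $F$ define $\mathcal{I}_{\rm s}(F_\sigma):=\sigma^{-2}\,\mathcal{I}_{\rm s1}(F)$, $0<\sigma<\infty$. Score function: Let $F_0:=F-F(\{0\})\,1_0$, where $1_0$ is Dirac measure at $0$, be $F$ with its mass at zero removed. When $F_0$ is absolutely continuous (with respect to Lebesgue measure) with a density $f$ such that $x\mapsto x f(x)$ is absolutely continuous, put $$\Lambda(x):=-\frac{[x f(x)]'}{f(x)}\quad(x\neq0),\qquad \Lambda(0):=0,$$ (defined a.e. $F_0$ on $x\ne 0$), and, with $f_\sigma(x)=\sigma^{-1}f(x/\sigma)$, $$\Lambda_\sigma(x):=\frac1\sigma\,\Lambda\Bigl(\frac x\sigma\Bigr)=\frac{\partial}{\partial\sigma}\log f_\sigma(x)=-\frac1\sigma\Bigl(1+\frac x\sigma\,\frac{f'(x/\sigma)}{f(x/\sigma)}\Bigr)\quad(x\neq0),\qquad\Lambda_\sigma(0)=0.$$ This is the function $\Lambda_\sigma$ in (iii). $L_2$-differentiability at $\sigma$: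 there is a function $\Delta_\sigma\in L_2(F_\sigma)$ (the $L_2$-derivative) such that $$\Bigl\Vert\sqrt{dF_{\sigma+t}}-\sqrt{dF_\sigma}\,\bigl(1+\tfrac12\,t\,\Delta_\sigma\bigr)\Bigr\Vert=o(t)\qquad\text{as }t\to0,$$ where, for any $\sigma$-finite measure $\mu$ dominating $F_{\sigma+t}$ and $F_\sigma$, with densities $p_{\sigma+t}$, $p_\sigma$, the square of the left-hand side is $\int\bigl(\sqrt{p_{\sigma+t}}-\sqrt{p_\sigma}(1+\tfrac12 t\Delta_\sigma)\bigr)^2d\mu$ (independent of the choice of $\mu$). Notation in the LAN expansion: $F_\sigma^n$ is the $n$-fold product measure of $F_\sigma$; $x_1,\dots,x_n$ are the coordinates (i.i.d. observations from $F_\sigma$); $dF^n_{\sigma+h/\sqrt n}/dF^n_\sigma$ (for $n$ so large that $\sigma+h/\sqrt n>0$) is the likelihood ratio, i.e. the density of the $F_\sigma^n$-absolutely continuous part of $F^n_{\sigma+h/\sqrt n}$, evaluated at $(x_1,\dots,x_n)$, with $\log 0:=-\infty$; and $o_{F^n_\sigma}(n^0)$ denotes a term tending to $0$ in $F^n_\sigma$-probability. *)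

theory Defs
  imports "HOL-Probability.Probability" "HOL-Library.Landau_Symbols"
begin

subsection \<open>The scale model\<close>

text \<open>The law of \<open>\<sigma> * X\<close> for \<open>X\<close> distributed according to \<open>F\<close>; its distribution function is
  computed in \<open>cdf_scale_model\<close>.\<close>

definition scale_model :: "real measure \<Rightarrow> real \<Rightarrow> real measure" where
  "scale_model F \<sigma> = distr F borel (\<lambda>x. \<sigma> * x)"

definition scale_model_pow :: "real measure \<Rightarrow> nat \<Rightarrow> real \<Rightarrow> (nat \<Rightarrow> real) measure" where
  "scale_model_pow F n \<sigma> = (\<Pi>\<^sub>M i\<in>{..<n}. scale_model F \<sigma>)"

lemma real_distribution_scale_model:
  assumes "real_distribution F"
  shows "real_distribution (scale_model F \<sigma>)"
proof -
  interpret real_distribution F by fact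
  show ?thesis
    unfolding scale_model_def by (rule real_distribution_distr) measurable
qed

lemma cdf_scale_model:
  assumes "real_distribution F" "\<sigma> > 0"
  shows "cdf (scale_model F \<sigma>) x = cdf F (x / \<sigma>)"
proof -
  interpret real_distribution F by fact
  have [measurable]: "(\<lambda>x. \<sigma> * x) \<in> borel_measurable F"
    by measurable
  have "(\<lambda>x. \<sigma> * x) -` {..x} \<inter> space F = {..x / \<sigma>}"
    using \<open>\<sigma> > 0\<close> by (auto simp: field_simps)
  then show ?thesis
    unfolding scale_model_def cdf_def by (subst measure_distr) auto
qed

subsection \<open>Fisher information of scale\<close>

definition C_c1 :: "(real \<Rightarrow> real) set" where
  "C_c1 = {\<phi>. (\<forall>x. \<phi> differentiable (at x)) \<and> continuous_on UNIV (deriv \<phi>) \<and>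
              compact (closure {x. deriv \<phi> x \<noteq> 0})}"

text \<open>Division on \<open>ennreal\<close> satisfies \<open>0 / 0 = 0\<close> and \<open>c / 0 = \<infinity>\<close> for \<open>c > 0\<close>. Both integrands are
  bounded and continuous: \<open>\<phi>\<close> itself is constant near \<open>\<plusminus>\<infinity>\<close>, but need not vanish there.\<close>

definition fisher_scale1 :: "real measure \<Rightarrow> ennreal" where
  "fisher_scale1 F =
     (SUP \<phi>\<in>C_c1. ennreal ((\<integral>x. x * deriv \<phi> x \<partial>F)\<^sup>2) / ennreal (\<integral>x. (\<phi> x)\<^sup>2 \<partial>F))"

lemma ennreal_divide_zero_conventions:
  "(0::ennreal) / 0 = 0" "(c::ennreal) > 0 \<Longrightarrow> c / 0 = \<infinity>"
  by (auto simp: ennreal_divide_eq_top_iff)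

definition fisher_scale :: "real measure \<Rightarrow> real \<Rightarrow> ennreal" where
  "fisher_scale F \<sigma> = ennreal (1 / \<sigma>\<^sup>2) * fisher_scale1 F"

subsection \<open>Score function\<close>

definition absolutely_continuous_fun :: "(real \<Rightarrow> real) \<Rightarrow> bool" where
  "absolutely_continuous_fun g \<longleftrightarrow>
     (\<forall>\<epsilon>>0. \<exists>\<delta>>0. \<forall>P. finite P \<longrightarrow> (\<forall>(a, b)\<in>P. a < b) \<longrightarrow>
        disjoint_family_on (\<lambda>(a, b). {a<..<b}) P \<longrightarrow>
        (\<Sum>(a, b)\<in>P. b - a) < \<delta> \<longrightarrow> (\<Sum>(a, b)\<in>P. \<bar>g b - g a\<bar>) < \<epsilon>)"

definition remove_zero_mass :: "real measure \<Rightarrow> real measure" where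
  "remove_zero_mass F = density F (indicator (- {0}))"

text \<open>Continuity of \<open>x f(x)\<close> makes such an \<open>f\<close> unique outside \<open>0\<close>.\<close>

definition has_scale_density :: "real measure \<Rightarrow> (real \<Rightarrow> real) \<Rightarrow> bool" where
  "has_scale_density F f \<longleftrightarrow>
     f \<in> borel_measurable borel \<and> (\<forall>x. 0 \<le> f x) \<and>
     remove_zero_mass F = density lborel (\<lambda>x. ennreal (f x)) \<and>
     absolutely_continuous_fun (\<lambda>x. x * f x)"

text \<open>The values where \<open>x f(x)\<close> is not differentiable or where \<open>f x = 0\<close> are irrelevant: for
  \<open>f\<close> as above, these points (other than \<open>0\<close>) form an \<open>F\<close>-null set.\<close>

definition scale_score1 :: "(real \<Rightarrow> real) \<Rightarrow> real \<Rightarrow> real" where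
  "scale_score1 f x = (if x = 0 then 0 else - deriv (\<lambda>y. y * f y) x / f x)"

definition scale_score :: "(real \<Rightarrow> real) \<Rightarrow> real \<Rightarrow> real \<Rightarrow> real" where
  "scale_score f \<sigma> x = 1 / \<sigma> * scale_score1 f (x / \<sigma>)"

subsection \<open>Differentiability in quadratic mean\<close>

definition dominates :: "real measure \<Rightarrow> real measure \<Rightarrow> bool" where
  "dominates \<mu> P \<longleftrightarrow> sets \<mu> = sets borel \<and> sigma_finite_measure \<mu> \<and> absolutely_continuous \<mu> P"

definition root_density :: "real measure \<Rightarrow> real measure \<Rightarrow> real \<Rightarrow> real" where
  "root_density \<mu> P x = sqrt (enn2real (RN_deriv \<mu> P x))"

definition L2_remainder ::
    "real measure \<Rightarrow> real measure \<Rightarrow> real \<Rightarrow> real \<Rightarrow> (real \<Rightarrow> real) \<Rightarrow> real" where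
  "L2_remainder \<mu> F \<sigma> t \<Delta> =
     sqrt (\<integral>x. (root_density \<mu> (scale_model F (\<sigma> + t)) x
                - root_density \<mu> (scale_model F \<sigma>) x * (1 + 1 / 2 * t * \<Delta> x))\<^sup>2 \<partial>\<mu>)"

text \<open>The dominating measure may depend on \<open>t\<close>. The remainder does not depend on its choice.\<close>

definition L2_differentiable_at :: "real measure \<Rightarrow> real \<Rightarrow> bool" where
  "L2_differentiable_at F \<sigma> \<longleftrightarrow>
     (\<exists>\<Delta>\<in>borel_measurable borel.
        integrable (scale_model F \<sigma>) (\<lambda>x. (\<Delta> x)\<^sup>2) \<and>
        (\<forall>\<mu> :: real \<Rightarrow> real measure.
           (\<forall>t. \<sigma> + t > 0 \<longrightarrow>
              dominates (\<mu> t) (scale_model F (\<sigma> + t)) \<and> dominates (\<mu> t) (scale_model F \<sigma>)) \<longrightarrow>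
           (\<lambda>t. L2_remainder (\<mu> t) F \<sigma> t \<Delta>) \<in> o[at 0](\<lambda>t. t)))"

subsection \<open>Local asymptotic normality\<close>

text \<open>Lebesgue decomposition: for an \<open>M\<close>-null set \<open>S\<close> carrying the \<open>M\<close>-singular part of \<open>N\<close>, the
  \<open>M\<close>-absolutely continuous part of \<open>N\<close> is its restriction to the complement of \<open>S\<close>. For
  \<open>\<sigma>\<close>-finite \<open>M\<close> and \<open>N\<close> on the same \<open>\<sigma>\<close>-algebra, the likelihood ratio exists and is unique
  almost everywhere with respect to \<open>M\<close>. (\<open>RN_deriv\<close> does not apply, as it is \<open>0\<close> unless \<open>N\<close>
  is absolutely continuous.)\<close>

definition likelihood_ratio :: "'a measure \<Rightarrow> 'a measure \<Rightarrow> 'a \<Rightarrow> ennreal" where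
  "likelihood_ratio N M =
     (SOME L. L \<in> borel_measurable M \<and>
        (\<exists>S\<in>null_sets M. density M L = density N (indicator (space M - S))))"

definition ln_ext :: "ennreal \<Rightarrow> ereal" where
  "ln_ext y = (if y = 0 then - \<infinity> else if y = \<infinity> then \<infinity> else ereal (ln (enn2real y)))"

text \<open>The remainder \<open>R\<close> takes extended real values, since the likelihood ratio may vanish with
  positive probability for finite \<open>n\<close>. The score function is part of the property: there has to be
  a density \<open>f\<close> for which it is defined. The information is not assumed to be finite here.\<close>

definition LAN_at :: "real measure \<Rightarrow> real \<Rightarrow> bool" where
  "LAN_at F \<sigma> \<longleftrightarrow>
     (\<exists>f. has_scale_density F f \<and>
       (\<forall>h::real. \<exists>R :: nat \<Rightarrow> (nat \<Rightarrow> real) \<Rightarrow> ereal.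
          (\<forall>n>0. \<sigma> + h / sqrt (real n) > 0 \<longrightarrow>
             R n \<in> borel_measurable (scale_model_pow F n \<sigma>) \<and>
             (AE x in scale_model_pow F n \<sigma>.
                ln_ext (likelihood_ratio (scale_model_pow F n (\<sigma> + h / sqrt (real n)))
                                         (scale_model_pow F n \<sigma>) x)
                = ereal (1 / sqrt (real n) * (\<Sum>i<n. h * scale_score f \<sigma> (x i)))
                  - ereal (1 / 2 * h\<^sup>2) * enn2ereal (fisher_scale F \<sigma>) + R n x)) \<and>
          (\<forall>\<epsilon>>0. (\<lambda>n. measure (scale_model_pow F n \<sigma>)
                      {x \<in> space (scale_model_pow F n \<sigma>). \<bar>R n x\<bar> > ereal \<epsilon>}) \<longlonglongrightarrow> 0)))"

end

theory Submission
  imports Defs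
begin

text \<open>All three properties hold for every \<open>\<sigma>\<close> or for none, because finiteness of \<open>\<I>\<^sub>s(F\<^sub>\<sigma>)\<close> depends on \<open>F\<close>
alone. Hence (ii) and (iii) are each derived at \<open>\<sigma> = 1\<close> from \<open>\<I>\<^sub>s\<^sub>1(F) < \<infinity>\<close>, and each of them at an
arbitrary \<open>\<sigma>\<close> is shown to force \<open>\<I>\<^sub>s\<^sub>1(F) < \<infinity>\<close>.

\<^emph>\<open>Finite information gives a density and a score.\<close> Finiteness says that \<open>\<phi> \<mapsto> \<integral> x \<phi>'(x) F(dx)\<close> is bounded for
the norm of \<open>L\<^sub>2(F)\<close>, so it is \<open>\<phi> \<mapsto> \<integral> \<phi> \<Lambda> dF\<close> for some \<open>\<Lambda>\<close> in \<open>L\<^sub>2(F)\<close> with \<open>\<integral> \<Lambda>\<^sup>2 dF = \<I>\<^sub>s\<^sub>1(F)\<close>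
(\<open>scale_score_representation\<close>). Fubini turns this into \<open>x F(dx) = G(x) dx\<close> with the tail
\<open>G(y) = \<integral>\<^bsub>[y,\<infinity>)\<^esub> \<Lambda> dF\<close>. So \<open>F\<close> has the density \<open>f(x) = G(x) / x\<close> away from \<open>0\<close>, and
\<open>x f(x) = G(x)\<close> is absolutely continuous with derivative \<open>- \<Lambda> f\<close> (\<open>density_regularity\<close>).

\<^emph>\<open>Scaling is a differentiable curve in \<open>L\<^sub>2\<close>.\<close> The difference quotient of \<open>s \<mapsto> \<surd>f\<^sub>s\<close> at \<open>s = 1\<close> converges
to \<open>\<Lambda> \<surd>f / 2\<close> at almost every point where \<open>f > 0\<close>, by Lebesgue's differentiation theorem. An estimate
of \<open>|\<surd>G(b) - \<surd>G(a)|\<close> by the Cauchy-Schwarz inequality and integration over the Haar measure \<open>dx / x\<close>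
of the half-line bound the norm of the quotient by a factor \<open>|ln s| / |s - 1|\<close> times the norm of the
limit. Convergence together with this bound on the norms gives convergence in \<open>L\<^sub>2\<close>
(\<open>scaling_L2_derivative\<close>); since the limit already exhausts the bound on the norms, the part of the quotient
living on \<open>{f = 0}\<close> tends to zero as well. Expressed with the likelihood ratio of \<open>F\<^sub>1\<^sub>+\<^sub>t\<close> with
respect to \<open>F\<close>, the result is the expansion \<open>scale_dqm_identity\<close>, from which (ii) follows for every
choice of dominating measures (\<open>L2_distance_by_likelihood_ratio\<close>).

\<^emph>\<open>The expansion in mean square gives LAN.\<close> The likelihood ratio of product measures is the product of
the likelihood ratios (\<open>likelihood_ratio_PiM\<close>). With \<open>Y = \<surd>L - 1\<close>, the sum of
\<open>ln L = 2 Y - Y\<^sup>2 + o(Y\<^sup>2)\<close> over the observations is controlled by variances, the weak law of large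
numbers and the smallness of \<open>max |Y|\<close> (\<open>lan_of_differentiability_in_mean\<close>).

\<^emph>\<open>Converses.\<close> Under (ii), the derivative of \<open>\<sigma> \<mapsto> \<integral> \<phi> dF\<^sub>\<sigma>\<close> is at the same time
\<open>\<integral> x \<phi>'(\<sigma> x) F(dx)\<close> and \<open>\<integral> \<phi> \<Delta> dF\<^sub>\<sigma>\<close>; the Cauchy-Schwarz inequality then bounds the information by
\<open>\<sigma>\<^sup>2 \<integral> \<Delta>\<^sup>2 dF\<^sub>\<sigma>\<close>. Under (iii) with infinite information, the right-hand side of the expansion is
\<open>-\<infinity>\<close> or \<open>\<infinity>\<close>, so the likelihood ratio of a single observation would vanish, that is, \<open>F\<^sub>\<sigma>\<close> and
\<open>F\<^bsub>\<sigma>+h\<^esub>\<close> would be mutually singular for all \<open>h > 0\<close>. This is impossible if \<open>x f(x)\<close> is continuous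
(\<open>scales_overlap\<close>).\<close>


section \<open>Lebesgue differentiation on the real line\<close>

text \<open>A Vitali covering argument: outer regularity encloses \<open>A\<close> in an open set of small \<open>M\<close>-measure, and
disjoint balls inside it whose fivefold enlargements cover the exceptional set have total length at most a
constant times that measure.\<close>

lemma excess_set_small_cover:
  fixes c e :: real and M :: "real measure"
  assumes fin: "finite_measure M"
    and borel: "sets M = sets borel" and A: "A \<in> sets borel" and null: "emeasure M A = 0"
    and c: "c > 0" and e: "e > 0"
  shows "\<exists>W\<in>sets borel. emeasure lborel W \<le> ennreal e \<and>
    {x\<in>A. \<forall>d>0. \<exists>r>0. r < d \<and> measure M (ball x r) > c * r} \<subseteq> W"
proof -
  interpret finite_measure M by fact
  note borel[measurable_cong]
  let ?E = "{x\<in>A. \<forall>d>0. \<exists>r>0. r < d \<and> measure M (ball x r) > c * r}"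
  have "(INF U\<in>{U. A \<subseteq> U \<and> open U}. emeasure M U) < ennreal (c * e / 10)"
    using outer_regular[OF borel _ A] null c e by simp
  then obtain U where U: "A \<subseteq> U" "open U" "emeasure M U < ennreal (c * e / 10)"
    unfolding INF_less_iff by auto
  have "\<exists>r>0. r < 1 \<and> ball x r \<subseteq> U \<and> measure M (ball x r) > c * r" if x: "x \<in> ?E" for x
  proof -
    obtain d where d: "d > 0" "ball x d \<subseteq> U"
      using x U(1) openE[OF U(2), of x] by blast
    have "\<forall>d>0. \<exists>r>0. r < d \<and> measure M (ball x r) > c * r"
      using x by blast
    moreover have "min 1 d > 0"
      using d by simp
    ultimately obtain r where r: "r > 0" "r < min 1 d" "measure M (ball x r) > c * r"
      by blast
    have "ball x r \<subseteq> U"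
      using r d by (auto simp: subset_eq)
    then show ?thesis
      using r by auto
  qed
  then have "\<exists>\<rho>. \<forall>x\<in>?E. \<rho> x > 0 \<and> \<rho> x < 1 \<and> ball x (\<rho> x) \<subseteq> U \<and> measure M (ball x (\<rho> x)) > c * \<rho> x"
    by (intro bchoice) blast
  then obtain \<rho> where \<rho>: "\<And>x. x \<in> ?E \<Longrightarrow> \<rho> x > 0 \<and> \<rho> x < 1 \<and> ball x (\<rho> x) \<subseteq> U \<and>
      measure M (ball x (\<rho> x)) > c * \<rho> x"
    by blast
  obtain C where C: "countable C" "C \<subseteq> ?E"
      "pairwise (\<lambda>i j. disjnt (ball i (\<rho> i)) (ball j (\<rho> j))) C"
      "?E \<subseteq> (\<Union>i\<in>C. ball i (5 * \<rho> i))"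
  proof (rule Vitali_covering_lemma_balls[of ?E "\<lambda>x. x" \<rho> ?E 1])
    show "?E \<subseteq> (\<Union>i\<in>?E. ball i (\<rho> i))"
      using \<rho> by force
    show "0 < \<rho> i \<and> \<rho> i \<le> 1" if "i \<in> ?E" for i
      using \<rho>[OF that] by auto
  qed
  define I where "I = to_nat_on C ` C"
  define x where "x n = from_nat_into C n" for n
  have xC: "x n \<in> C" if "n \<in> I" for n
    using that C(1) by (auto simp: I_def x_def)
  have xinj: "n = m" if "n \<in> I" "m \<in> I" "x n = x m" for n m
    using that C(1) by (auto simp: I_def x_def)
  have Cx: "C = x ` I"
    using C(1) by (force simp: I_def x_def image_image)
  define B where "B n = (if n \<in> I then ball (x n) (\<rho> (x n)) else {})" for n
  define W where "W n = (if n \<in> I then ball (x n) (5 * \<rho> (x n)) else {})" for n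
  have dis: "disjoint_family B"
  proof (unfold disjoint_family_on_def, intro ballI impI)
    fix m n :: nat assume "m \<noteq> n"
    show "B m \<inter> B n = {}"
    proof (cases "m \<in> I \<and> n \<in> I")
      case True
      then have "x m \<noteq> x n" "x m \<in> C" "x n \<in> C"
        using xinj[of m n] xC \<open>m \<noteq> n\<close> by auto
      then show ?thesis
        using C(3) True unfolding pairwise_def disjnt_def B_def by simp
    qed (auto simp: B_def)
  qed
  have WB: "emeasure lborel (W n) \<le> ennreal (10 / c) * emeasure M (B n)" for n
  proof (cases "n \<in> I")
    case True
    then have "x n \<in> ?E" using xC C(2) by auto
    note r = \<rho>[OF this]
    have "ball (x n) (5 * \<rho> (x n)) = {x n - 5 * \<rho> (x n) <..< x n + 5 * \<rho> (x n)}"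
      by (auto simp: dist_real_def)
    then have "emeasure lborel (W n) = ennreal (10 * \<rho> (x n))"
      using True r by (simp add: W_def)
    also have "\<dots> \<le> ennreal (10 / c * measure M (B n))"
      using r c True by (intro ennreal_leI) (auto simp: B_def field_simps)
    also have "\<dots> = ennreal (10 / c) * emeasure M (B n)"
      using c by (simp add: emeasure_eq_measure ennreal_mult'[symmetric])
    finally show ?thesis .
  qed (simp add: W_def)
  have "emeasure lborel (\<Union>n. W n) \<le> (\<Sum>n. emeasure lborel (W n))"
    by (rule emeasure_subadditive_countably) (auto simp: W_def)
  also have "\<dots> \<le> (\<Sum>n. ennreal (10 / c) * emeasure M (B n))"
    by (intro suminf_le WB) auto
  also have "\<dots> = ennreal (10 / c) * emeasure M (\<Union>n. B n)"
    using dis by (subst suminf_emeasure[symmetric]) (auto simp: B_def borel)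
  also have "\<dots> \<le> ennreal (10 / c) * emeasure M U"
  proof -
    have "(\<Union>n. B n) \<subseteq> U"
    proof (intro UN_least)
      fix n show "B n \<subseteq> U"
        using \<rho>[of "x n"] xC[of n] C(2) by (cases "n \<in> I") (auto simp: B_def)
    qed
    then show ?thesis
      using U(2) by (intro mult_left_mono emeasure_mono) (auto simp: borel)
  qed
  also have "\<dots> \<le> ennreal (10 / c) * ennreal (c * e / 10)"
    using U(3) by (intro mult_left_mono) auto
  also have "\<dots> = ennreal e"
    using c e by (simp add: ennreal_mult'[symmetric])
  finally have "emeasure lborel (\<Union>n. W n) \<le> ennreal e" .
  moreover have "?E \<subseteq> (\<Union>n. W n)"
  proof
    fix y assume "y \<in> ?E"
    then obtain i where "i \<in> I" "y \<in> ball (x i) (5 * \<rho> (x i))"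
      using C(4) unfolding Cx by blast
    then show "y \<in> (\<Union>n. W n)"
      by (auto simp: W_def)
  qed
  moreover have "(\<Union>n. W n) \<in> sets borel"
    by (auto simp: W_def)
  ultimately show ?thesis by blast
qed

text \<open>A measure has derivative zero at Lebesgue-almost every point of its null sets. Applied to the measures
\<open>(k - c)\<^sup>+ dx\<close>, which vanish on \<open>{k \<le> c}\<close>, this yields Lebesgue's differentiation theorem without
approximation by continuous functions.\<close>

lemma AE_derivative_zero_on_null_set:
  fixes M :: "real measure"
  assumes fin: "finite_measure M"
    and borel: "sets M = sets borel" and A: "A \<in> sets borel" and null: "emeasure M A = 0"
  shows "AE x in lborel. x \<in> A \<longrightarrow>
    (\<forall>c>0. \<exists>d>0. \<forall>r>0. r < d \<longrightarrow> measure M (ball x r) \<le> c * r)"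
proof -
  let ?E = "\<lambda>c. {x\<in>A. \<forall>d>0. \<exists>r>0. r < d \<and> measure M (ball x r) > c * r}"
  have "AE x in lborel. x \<notin> ?E (inverse (Suc k))" for k
  proof -
    have "\<exists>W. \<forall>n. W n \<in> sets borel \<and> emeasure lborel (W n) \<le> ennreal (inverse (Suc n)) \<and>
        ?E (inverse (Suc k)) \<subseteq> W n"
    proof (intro choice allI)
      fix n :: nat
      have "inverse (real (Suc k)) > 0" "inverse (real (Suc n)) > 0"
        by simp_all
      from excess_set_small_cover[OF fin borel A null this]
      show "\<exists>W. W \<in> sets borel \<and> emeasure lborel W \<le> ennreal (inverse (Suc n)) \<and>
        ?E (inverse (Suc k)) \<subseteq> W"
        by blast
    qed
    then obtain W where W: "\<And>n::nat. W n \<in> sets borel"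
        "\<And>n. emeasure lborel (W n) \<le> ennreal (inverse (Suc n))" "\<And>n. ?E (inverse (Suc k)) \<subseteq> W n"
      by blast
    have m: "(\<Inter>n. W n) \<in> sets borel"
      using W(1) by auto
    have "emeasure lborel (\<Inter>n. W n) \<le> ennreal (inverse (Suc n))" for n
      by (rule order_trans[OF emeasure_mono W(2)[of n]]) (use W in auto)
    moreover have "(\<lambda>n. ennreal (inverse (Suc n))) \<longlonglongrightarrow> ennreal 0"
      by (intro tendsto_ennrealI LIMSEQ_inverse_real_of_nat)
    ultimately have "emeasure lborel (\<Inter>n. W n) \<le> 0"
      by (intro LIMSEQ_le_const[where X="\<lambda>n. ennreal (inverse (Suc n))"]) auto
    then have "(\<Inter>n. W n) \<in> null_sets lborel"
      using m by auto
    then show ?thesis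
    proof (rule AE_I')
      show "{x \<in> space lborel. \<not> x \<notin> ?E (inverse (real (Suc k)))} \<subseteq> (\<Inter>n. W n)"
      proof (rule INF_greatest)
        fix n show "{x \<in> space lborel. \<not> x \<notin> ?E (inverse (real (Suc k)))} \<subseteq> W n"
          using W(3)[of n] unfolding not_not space_lborel by blast
      qed
    qed
  qed
  then have "AE x in lborel. \<forall>k. x \<notin> ?E (inverse (real (Suc k)))"
    by (simp only: AE_all_countable) auto
  then show ?thesis
  proof (rule eventually_mono, intro impI allI)
    fix x c :: real
    assume x: "\<forall>k. x \<notin> ?E (inverse (real (Suc k)))" "x \<in> A" "c > 0"
    obtain k where k: "inverse (real (Suc k)) < c"
      using reals_Archimedean[OF x(3)] by auto
    obtain d where d: "d > 0" "\<And>r. r > 0 \<Longrightarrow> r < d \<Longrightarrow> measure M (ball x r) \<le> inverse (real (Suc k)) * r"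
      using spec[OF x(1), of k] x(2) unfolding mem_Collect_eq not_less[symmetric] by blast
    have "measure M (ball x r) \<le> c * r" if "r > 0" "r < d" for r
      using d(2)[OF that] k that by (meson mult_right_mono less_imp_le order_trans)
    then show "\<exists>d>0. \<forall>r>0. r < d \<longrightarrow> measure M (ball x r) \<le> c * r"
      using d by blast
  qed
qed

text \<open>The excess of \<open>k\<close> over a rational \<open>c\<close> slightly above \<open>k x\<close> defines a measure with derivative zero at
\<open>x\<close>. It is restricted to bounded intervals because \<open>(k - c)\<^sup>+\<close> need not be integrable for \<open>c < 0\<close>.\<close>

lemma AE_interval_integral_upper:
  fixes k :: "real \<Rightarrow> real"
  assumes k: "integrable lborel k"
  shows "AE x in lborel. \<forall>e>0. \<exists>d>0. \<forall>a b. a \<le> x \<longrightarrow> x \<le> b \<longrightarrow> b - a < d \<longrightarrow>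
    (LINT y:{a..b}|lborel. k y) \<le> (k x + e) * (b - a)"
proof -
  have [measurable]: "k \<in> borel_measurable borel"
    using k by auto
  define D where "D N c = density lborel (\<lambda>y. ennreal (indicator {-real N<..<real N} y * max 0 (k y - c)))"
    for N :: nat and c :: real
  have int: "integrable lborel (\<lambda>y. indicator {-real N<..<real N} y * max 0 (k y - c))" for N and c :: real
  proof -
    have "integrable lborel (\<lambda>y. indicator {-real N<..<real N} y *\<^sub>R (max 0 (k y - c)))"
    proof (rule Bochner_Integration.integrable_bound)
      show "integrable lborel (\<lambda>y. \<bar>k y\<bar> + indicator {-real N<..<real N} y * \<bar>c\<bar>)"
        using k by (intro Bochner_Integration.integrable_add integrable_abs integrable_mult_left) auto
      show "AE y in lborel. norm (indicator {-real N<..<real N} y *\<^sub>R (max 0 (k y - c)))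
          \<le> norm (\<bar>k y\<bar> + indicator {-real N<..<real N} y * \<bar>c\<bar>)"
        by (intro AE_I2) (auto simp: indicator_def)
    qed (auto)
    then show ?thesis by simp
  qed
  have fin: "finite_measure (D N c)" for N and c :: real
    using int[of N c] by (intro finite_measureI) (auto simp: D_def emeasure_density
        real_integrable_def top_unique less_top[symmetric])
  have meas: "measure (D N c) X = (LINT y:X|lborel. indicator {-real N<..<real N} y * max 0 (k y - c))"
    if [measurable]: "X \<in> sets borel" for N c X
  proof -
    have "measure (D N c) X = enn2real (\<integral>\<^sup>+y. ennreal (indicator X y *
        (indicator {-real N<..<real N} y * max 0 (k y - c))) \<partial>lborel)"
      by (auto simp: measure_def D_def emeasure_density indicator_def intro!: arg_cong[where f=enn2real] nn_integral_cong)
    also have "\<dots> = (LINT y:X|lborel. indicator {-real N<..<real N} y * max 0 (k y - c))"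
      unfolding set_lebesgue_integral_def by (subst integral_eq_nn_integral) auto
    finally show ?thesis .
  qed
  have null: "emeasure (D N c) {y. k y \<le> c} = 0" for N and c :: real
    by (auto simp: D_def emeasure_density indicator_def nn_integral_0_iff_AE)
  have "AE x in lborel. \<forall>N c. k x \<le> real_of_rat c \<longrightarrow>
      (\<forall>e>0. \<exists>d>0. \<forall>r>0. r < d \<longrightarrow> measure (D N (real_of_rat c)) (ball x r) \<le> e * r)"
    unfolding AE_all_countable
  proof (intro allI)
    fix N c
    have "{y. k y \<le> real_of_rat c} \<in> sets borel"
      by measurable
    from AE_derivative_zero_on_null_set[OF fin _ this null]
    show "AE x in lborel. k x \<le> real_of_rat c \<longrightarrow>
      (\<forall>e>0. \<exists>d>0. \<forall>r>0. r < d \<longrightarrow> measure (D N (real_of_rat c)) (ball x r) \<le> e * r)"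
      by (simp add: D_def)
  qed
  then show ?thesis
  proof (rule eventually_mono, intro allI impI)
    fix x e :: real
    assume H: "\<forall>N c. k x \<le> real_of_rat c \<longrightarrow>
      (\<forall>e>0. \<exists>d>0. \<forall>r>0. r < d \<longrightarrow> measure (D N (real_of_rat c)) (ball x r) \<le> e * r)" and e: "e > 0"
    obtain c where c: "k x < real_of_rat c" "real_of_rat c < k x + e / 2"
      using of_rat_dense[of "k x" "k x + e / 2"] e by auto
    obtain N :: nat where N: "\<bar>x\<bar> < real N"
      using reals_Archimedean2 by blast
    obtain d where d: "d > 0" "\<And>r. r > 0 \<Longrightarrow> r < d \<Longrightarrow> measure (D N (real_of_rat c)) (ball x r) \<le> e / 4 * r"
      using H[rule_format, of c "e / 4" N] c e by auto
    interpret D: finite_measure "D N (real_of_rat c)" by (rule fin)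
    show "\<exists>d>0. \<forall>a b. a \<le> x \<longrightarrow> x \<le> b \<longrightarrow> b - a < d \<longrightarrow>
      (LINT y:{a..b}|lborel. k y) \<le> (k x + e) * (b - a)"
    proof (intro exI[of _ "min (d / 2) (real N - \<bar>x\<bar>)"] conjI allI impI)
      show "min (d / 2) (real N - \<bar>x\<bar>) > 0"
        using d N by auto
      fix a b assume ab: "a \<le> x" "x \<le> b" "b - a < min (d / 2) (real N - \<bar>x\<bar>)"
      show "(LINT y:{a..b}|lborel. k y) \<le> (k x + e) * (b - a)"
      proof (cases "a = b")
        case True
        have "(LINT y:{a..b}|lborel. k y) = 0"
          unfolding set_lebesgue_integral_def
          using True by (intro integral_eq_zero_AE eventually_mono[OF AE_lborel_singleton[of a]]) auto
        then show ?thesis using True by simp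
      next
        case False
        have ki: "set_integrable lborel {a..b} k"
          using k unfolding set_integrable_def by (rule integrable_mult_indicator[rotated]) simp
        have Di: "set_integrable lborel {a..b}
            (\<lambda>y. indicator {-real N<..<real N} y * max 0 (k y - real_of_rat c))"
          using int[of N "real_of_rat c"] unfolding set_integrable_def by (rule integrable_mult_indicator[rotated]) simp
        have ci: "set_integrable lborel {a..b} (\<lambda>y. real_of_rat c)"
          using integrable_real_indicator[of "{a..b}" lborel] ab by (simp add: set_integrable_def)
        have "(LINT y:{a..b}|lborel. k y) \<le> (LINT y:{a..b}|lborel. real_of_rat c +
            indicator {-real N<..<real N} y * max 0 (k y - real_of_rat c))"
          using ab by (intro set_integral_mono ki set_integral_add ci Di) (auto simp: indicator_def)
        also have "\<dots> = (b - a) * real_of_rat c + measure (D N (real_of_rat c)) {a..b}"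
          using ab by (subst set_integral_add(2)[OF ci Di]) (auto simp: meas set_integral_const)
        also have "measure (D N (real_of_rat c)) {a..b} \<le> measure (D N (real_of_rat c)) (ball x (2 * (b - a)))"
          using ab False by (intro D.finite_measure_mono) (auto simp: D_def dist_real_def)
        also have "\<dots> \<le> e / 4 * (2 * (b - a))"
          using ab False by (intro d) auto
        also have "(b - a) * real_of_rat c + e / 4 * (2 * (b - a)) \<le> (b - a) * (k x + e)"
        proof -
          have "(b - a) * real_of_rat c + e / 4 * (2 * (b - a)) \<le> (b - a) * (k x + e / 2) + (b - a) * (e / 2)"
            using c ab by (intro add_mono mult_left_mono) auto
          also have "\<dots> = (b - a) * (k x + e)"
            unfolding distrib_left[symmetric] by simp
          finally show ?thesis .
        qed
        finally show ?thesis by (simp add: mult.commute)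
      qed
    qed
  qed
qed

text \<open>Lebesgue's differentiation theorem: the one-sided bound on averages is applied to \<open>k\<close> and to \<open>- k\<close>.\<close>

theorem AE_has_derivative_indefinite_integral:
  fixes k G :: "real \<Rightarrow> real"
  assumes k: "integrable lborel k"
    and G: "\<And>a b. a \<le> b \<Longrightarrow> G b - G a = (LINT y:{a..b}|lborel. k y)"
  shows "AE x in lborel. (G has_real_derivative k x) (at x)"
proof -
  have "integrable lborel (\<lambda>y. - k y)"
    using k by simp
  from AE_interval_integral_upper[OF k] AE_interval_integral_upper[OF this]
  show ?thesis
  proof eventually_elim
    fix x
    assume up: "\<forall>e>0. \<exists>d>0. \<forall>a b. a \<le> x \<longrightarrow> x \<le> b \<longrightarrow> b - a < d \<longrightarrow>
          (LINT y:{a..b}|lborel. k y) \<le> (k x + e) * (b - a)"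
      and lo: "\<forall>e>0. \<exists>d>0. \<forall>a b. a \<le> x \<longrightarrow> x \<le> b \<longrightarrow> b - a < d \<longrightarrow>
          (LINT y:{a..b}|lborel. - k y) \<le> (- k x + e) * (b - a)"
    show "(G has_real_derivative k x) (at x)"
      unfolding has_field_derivative_iff LIM_eq
    proof (intro allI impI)
      fix e :: real assume "e > 0"
      then have "e / 2 > 0" by simp
      obtain d1 where d1: "d1 > 0" "\<And>a b. a \<le> x \<Longrightarrow> x \<le> b \<Longrightarrow> b - a < d1 \<Longrightarrow>
          (LINT y:{a..b}|lborel. k y) \<le> (k x + e / 2) * (b - a)"
        using up \<open>e / 2 > 0\<close> by blast
      obtain d2 where d2: "d2 > 0" "\<And>a b. a \<le> x \<Longrightarrow> x \<le> b \<Longrightarrow> b - a < d2 \<Longrightarrow>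
          (LINT y:{a..b}|lborel. - k y) \<le> (- k x + e / 2) * (b - a)"
        using lo \<open>e / 2 > 0\<close> by blast
      have *: "\<bar>G b - G a - k x * (b - a)\<bar> \<le> e / 2 * (b - a)"
        if "a \<le> x" "x \<le> b" "b - a < min d1 d2" for a b
      proof -
        have "(LINT y:{a..b}|lborel. - k y) = - (LINT y:{a..b}|lborel. k y)"
          by (simp add: set_lebesgue_integral_def)
        moreover have "(LINT y:{a..b}|lborel. k y) \<le> k x * (b - a) + e / 2 * (b - a)"
          using d1(2)[of a b] that by (simp only: distrib_right)
        moreover have "(LINT y:{a..b}|lborel. - k y) \<le> - (k x * (b - a)) + e / 2 * (b - a)"
          using d2(2)[of a b] that by (simp only: distrib_right mult_minus_left)
        moreover have "\<bar>S - p\<bar> \<le> q" if "S \<le> p + q" "- S \<le> - p + q" for S p q :: real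
          using that by linarith
        ultimately have "\<bar>(LINT y:{a..b}|lborel. k y) - k x * (b - a)\<bar> \<le> e / 2 * (b - a)"
          by metis
        then show ?thesis
          using that G[of a b] by simp
      qed
      show "\<exists>s>0. \<forall>y. y \<noteq> x \<and> norm (y - x) < s \<longrightarrow> norm ((G y - G x) / (y - x) - k x) < e"
      proof (intro exI[of _ "min d1 d2"] conjI allI impI)
        show "min d1 d2 > 0" using d1 d2 by simp
        fix y assume y: "y \<noteq> x \<and> norm (y - x) < min d1 d2"
        have "\<bar>G y - G x - k x * (y - x)\<bar> \<le> e / 2 * \<bar>y - x\<bar>"
          using *[of x y] *[of y x] y by (cases "x < y") (auto simp: abs_if algebra_simps split: if_splits)
        also have "\<dots> < e * \<bar>y - x\<bar>"
          using y \<open>e > 0\<close> by simp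
        finally have "\<bar>G y - G x - k x * (y - x)\<bar> / \<bar>y - x\<bar> < e"
          using y by (simp add: divide_less_eq)
        moreover have "(G y - G x) / (y - x) - k x = (G y - G x - k x * (y - x)) / (y - x)"
          using y by (simp add: field_simps)
        ultimately show "norm ((G y - G x) / (y - x) - k x) < e"
          by simp
      qed
    qed
  qed
qed

section \<open>Bounded functionals on spaces of square-integrable functions\<close>

lemma integrable_mult_square:
  fixes f g :: "'a \<Rightarrow> real"
  assumes [measurable]: "f \<in> borel_measurable M" "g \<in> borel_measurable M"
    and "integrable M (\<lambda>x. (f x)\<^sup>2)" "integrable M (\<lambda>x. (g x)\<^sup>2)"
  shows "integrable M (\<lambda>x. f x * g x)"
proof (rule Bochner_Integration.integrable_bound)
  show "integrable M (\<lambda>x. (f x)\<^sup>2 + (g x)\<^sup>2)"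
    using assms by auto
  show "AE x in M. norm (f x * g x) \<le> norm ((f x)\<^sup>2 + (g x)\<^sup>2)"
  proof (rule AE_I2)
    fix x
    have "0 \<le> (\<bar>f x\<bar> - \<bar>g x\<bar>)\<^sup>2" by simp
    then have "2 * (\<bar>f x\<bar> * \<bar>g x\<bar>) \<le> (f x)\<^sup>2 + (g x)\<^sup>2"
      by (simp add: power2_diff)
    moreover have "0 \<le> \<bar>f x\<bar> * \<bar>g x\<bar>" by simp
    ultimately show "norm (f x * g x) \<le> norm ((f x)\<^sup>2 + (g x)\<^sup>2)"
      unfolding real_norm_def abs_mult by linarith
  qed
qed measurable

lemma integrable_square_add_scaled:
  fixes f g :: "'a \<Rightarrow> real" and c :: real
  assumes [measurable]: "f \<in> borel_measurable M" "g \<in> borel_measurable M"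
    and i: "integrable M (\<lambda>x. (f x)\<^sup>2)" "integrable M (\<lambda>x. (g x)\<^sup>2)"
  shows "integrable M (\<lambda>x. (f x + c * g x)\<^sup>2)"
    and "(\<integral>x. (f x + c * g x)\<^sup>2 \<partial>M) = (\<integral>x. (f x)\<^sup>2 \<partial>M) + 2 * c * (\<integral>x. f x * g x \<partial>M) + c\<^sup>2 * (\<integral>x. (g x)\<^sup>2 \<partial>M)"
proof -
  note p = integrable_mult_square[OF assms]
  have eq: "(\<lambda>x. (f x + c * g x)\<^sup>2) = (\<lambda>x. (f x)\<^sup>2 + (2 * c) * (f x * g x) + c\<^sup>2 * (g x)\<^sup>2)"
    by (auto simp: power2_eq_square algebra_simps)
  show "integrable M (\<lambda>x. (f x + c * g x)\<^sup>2)"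
    unfolding eq using p i by auto
  show "(\<integral>x. (f x + c * g x)\<^sup>2 \<partial>M) = (\<integral>x. (f x)\<^sup>2 \<partial>M) + 2 * c * (\<integral>x. f x * g x \<partial>M) + c\<^sup>2 * (\<integral>x. (g x)\<^sup>2 \<partial>M)"
    unfolding eq using p i by simp
qed

text \<open>The form of the discriminant criterion behind both the Cauchy-Schwarz inequality and the variational
identification of the representing function.\<close>

lemma quadratic_nonneg_discriminant:
  fixes a b c :: real
  assumes "\<And>t. 0 \<le> a + 2 * t * b + t\<^sup>2 * c" "0 \<le> c"
  shows "b\<^sup>2 \<le> a * c"
proof (cases "c = 0")
  case True
  have "b = 0"
  proof (rule ccontr)
    assume b: "b \<noteq> 0"
    have "0 \<le> a + 2 * (- (a + 1) / (2 * b)) * b"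
      using assms(1)[of "- (a + 1) / (2 * b)"] True by simp
    then show False using b by (simp add: field_simps)
  qed
  then show ?thesis using True by simp
next
  case False
  then have c: "c > 0" using assms(2) by simp
  have "0 \<le> a + 2 * (- b / c) * b + (- b / c)\<^sup>2 * c"
    by (rule assms)
  also have "\<dots> = a - b\<^sup>2 / c"
    using c by (simp add: field_simps power2_eq_square)
  finally show ?thesis using c by (simp add: field_simps)
qed

lemma integral_Cauchy_Schwarz:
  fixes f g :: "'a \<Rightarrow> real"
  assumes "f \<in> borel_measurable M" "g \<in> borel_measurable M"
    and "integrable M (\<lambda>x. (f x)\<^sup>2)" "integrable M (\<lambda>x. (g x)\<^sup>2)"
  shows "(\<integral>x. f x * g x \<partial>M)\<^sup>2 \<le> (\<integral>x. (f x)\<^sup>2 \<partial>M) * (\<integral>x. (g x)\<^sup>2 \<partial>M)"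
proof (rule quadratic_nonneg_discriminant)
  fix t
  have "0 \<le> (\<integral>x. (f x + t * g x)\<^sup>2 \<partial>M)"
    by simp
  then show "0 \<le> (\<integral>x. (f x)\<^sup>2 \<partial>M) + 2 * t * (\<integral>x. f x * g x \<partial>M) + t\<^sup>2 * (\<integral>x. (g x)\<^sup>2 \<partial>M)"
    using integrable_square_add_scaled(2)[OF assms] by simp
qed simp


text \<open>Square summability with dyadic weights implies absolute summability, by \<open>|d| \<le> q d\<^sup>2 + 1/q\<close> with
\<open>q = 2\<^sup>n\<close>. This makes a rapidly Cauchy sequence in \<open>L\<^sub>2\<close> converge almost everywhere over any measure,
finite or not.\<close>

lemma summable_dyadic_squares_imp_convergent:
  fixes u :: "nat \<Rightarrow> real"
  assumes "summable (\<lambda>n. 2 ^ n * (u (Suc n) - u n)\<^sup>2)"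
  shows "convergent u"
proof -
  have "summable (\<lambda>n. u (Suc n) - u n)"
  proof (rule summable_comparison_test)
    show "summable (\<lambda>n. 2 ^ n * (u (Suc n) - u n)\<^sup>2 + (1 / 2) ^ n)"
      by (intro summable_add assms summable_geometric) simp
    have "\<bar>d\<bar> \<le> 2 ^ n * d\<^sup>2 + (1 / 2) ^ n" for d :: real and n :: nat
    proof -
      define q :: real where "q = 2 ^ n"
      have q: "q > 0" by (simp add: q_def)
      have "0 \<le> (q * \<bar>d\<bar> - 1)\<^sup>2" by simp
      then have "2 * (q * \<bar>d\<bar>) \<le> q\<^sup>2 * d\<^sup>2 + 1"
        by (simp add: power2_diff power_mult_distrib)
      moreover have "0 \<le> q * \<bar>d\<bar>" using q by simp
      ultimately have "q * \<bar>d\<bar> \<le> q\<^sup>2 * d\<^sup>2 + 1"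
        by linarith
      then have "q * \<bar>d\<bar> \<le> q * (q * d\<^sup>2 + 1 / q)"
        using q by (simp add: algebra_simps power2_eq_square)
      then have "\<bar>d\<bar> \<le> q * d\<^sup>2 + 1 / q"
        using q by simp
      then show ?thesis by (simp add: q_def power_one_over)
    qed
    then show "\<exists>N. \<forall>n\<ge>N. norm (u (Suc n) - u n) \<le> 2 ^ n * (u (Suc n) - u n)\<^sup>2 + (1 / 2) ^ n"
      by auto
  qed
  then have "convergent (\<lambda>n. \<Sum>i<n. u (Suc i) - u i)"
    by (simp add: summable_iff_convergent)
  moreover have "(\<Sum>i<n. u (Suc i) - u i) = u n - u 0" for n
    by (rule sum_lessThan_telescope)
  ultimately have "convergent (\<lambda>n. u n - u 0)" by simp
  then show ?thesis
    by (simp add: convergent_diff_const_right_iff)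
qed

lemma norm_le_abs_sqrt:
  fixes x y :: real
  assumes "x\<^sup>2 \<le> y"
  shows "norm x \<le> norm (sqrt y)"
  using real_sqrt_le_mono[OF assms] by simp

text \<open>Completeness of \<open>L\<^sub>2\<close> in the form needed below; Fatou's lemma passes the Cauchy estimate to the limit.\<close>

lemma fast_Cauchy_L2_limit:
  fixes f :: "nat \<Rightarrow> 'a \<Rightarrow> real"
  assumes [measurable]: "\<And>n. f n \<in> borel_measurable M"
    and int: "\<And>n. integrable M (\<lambda>x. (f n x)\<^sup>2)"
    and Cauchy: "\<And>m n. n \<le> m \<Longrightarrow> (\<integral>x. (f m x - f n x)\<^sup>2 \<partial>M) \<le> (1 / 4) ^ n"
  obtains g where "g \<in> borel_measurable M" "integrable M (\<lambda>x. (g x)\<^sup>2)"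
    "\<And>n. integrable M (\<lambda>x. (f n x - g x)\<^sup>2)" "\<And>n. (\<integral>x. (f n x - g x)\<^sup>2 \<partial>M) \<le> (1 / 4) ^ n"
proof -
  define g where "g x = lim (\<lambda>n. f n x)" for x
  have g[measurable]: "g \<in> borel_measurable M"
    unfolding g_def by measurable
  have diff: "integrable M (\<lambda>x. (f m x - f n x)\<^sup>2)" for m n
    using integrable_square_add_scaled(1)[of "f m" M "f n" "- 1"] int by simp
  have nn: "(\<integral>\<^sup>+x. ennreal ((f m x - f n x)\<^sup>2) \<partial>M) \<le> ennreal ((1 / 4) ^ n)" if "n \<le> m" for m n
    using diff Cauchy[OF that] by (subst nn_integral_eq_integral) (auto intro: ennreal_leI)
  have "(\<integral>\<^sup>+x. (\<Sum>n. ennreal (2 ^ n * (f (Suc n) x - f n x)\<^sup>2)) \<partial>M)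
      = (\<Sum>n. \<integral>\<^sup>+x. ennreal (2 ^ n * (f (Suc n) x - f n x)\<^sup>2) \<partial>M)"
    by (rule nn_integral_suminf) measurable
  also have "\<dots> \<le> (\<Sum>n. ennreal ((1 / 2) ^ n))"
  proof (intro suminf_le)
    fix n
    have "(\<integral>\<^sup>+x. ennreal (2 ^ n * (f (Suc n) x - f n x)\<^sup>2) \<partial>M)
        = ennreal (2 ^ n) * (\<integral>\<^sup>+x. ennreal ((f (Suc n) x - f n x)\<^sup>2) \<partial>M)"
      by (simp add: ennreal_mult' nn_integral_cmult)
    also have "\<dots> \<le> ennreal (2 ^ n) * ennreal ((1 / 4) ^ n)"
      by (intro mult_left_mono nn) auto
    also have "\<dots> = ennreal ((1 / 2) ^ n)"
      by (simp add: ennreal_mult'[symmetric] power_mult_distrib[symmetric])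
    finally show "(\<integral>\<^sup>+x. ennreal (2 ^ n * (f (Suc n) x - f n x)\<^sup>2) \<partial>M) \<le> ennreal ((1 / 2) ^ n)" .
  qed auto
  also have "\<dots> < \<infinity>"
    by (subst suminf_ennreal2) (auto intro: summable_geometric)
  finally have "AE x in M. (\<Sum>n. ennreal (2 ^ n * (f (Suc n) x - f n x)\<^sup>2)) \<noteq> \<infinity>"
    by (intro nn_integral_PInf_AE) auto
  then have lim: "AE x in M. (\<lambda>n. f n x) \<longlonglongrightarrow> g x"
  proof eventually_elim
    case (elim x)
    have "summable (\<lambda>n. 2 ^ n * (f (Suc n) x - f n x)\<^sup>2)"
      using elim by (intro summable_suminf_not_top) auto
    then have "convergent (\<lambda>n. f n x)"
      by (rule summable_dyadic_squares_imp_convergent)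
    then show ?case
      unfolding g_def convergent_LIMSEQ_iff .
  qed
  have fg: "(\<integral>\<^sup>+x. ennreal ((f n x - g x)\<^sup>2) \<partial>M) \<le> ennreal ((1 / 4) ^ n)" for n
  proof -
    have "(\<integral>\<^sup>+x. ennreal ((f n x - g x)\<^sup>2) \<partial>M)
        = (\<integral>\<^sup>+x. liminf (\<lambda>m. ennreal ((f m x - f n x)\<^sup>2)) \<partial>M)"
    proof (intro nn_integral_cong_AE, use lim in eventually_elim)
      case (elim x)
      then have "(\<lambda>m. ennreal ((f m x - f n x)\<^sup>2)) \<longlonglongrightarrow> ennreal ((g x - f n x)\<^sup>2)"
        by (intro tendsto_ennrealI tendsto_intros)
      then have "liminf (\<lambda>m. ennreal ((f m x - f n x)\<^sup>2)) = ennreal ((g x - f n x)\<^sup>2)"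
        by (intro lim_imp_Liminf) auto
      then show ?case by (simp add: power2_commute)
    qed
    also have "\<dots> \<le> liminf (\<lambda>m. \<integral>\<^sup>+x. ennreal ((f m x - f n x)\<^sup>2) \<partial>M)"
      by (rule nn_integral_liminf) measurable
    also have "\<dots> \<le> ennreal ((1 / 4) ^ n)"
    proof (rule Liminf_le)
      show "\<forall>\<^sub>F m in sequentially. (\<integral>\<^sup>+x. ennreal ((f m x - f n x)\<^sup>2) \<partial>M) \<le> ennreal ((1 / 4) ^ n)"
        using eventually_ge_at_top[of n] by eventually_elim (rule nn)
    qed simp
    finally show ?thesis .
  qed
  have ifg: "integrable M (\<lambda>x. (f n x - g x)\<^sup>2)" for n
    using le_less_trans[OF fg[of n]] by (intro integrableI_bounded) auto
  have ifg2: "(\<integral>x. (f n x - g x)\<^sup>2 \<partial>M) \<le> (1 / 4) ^ n" for n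
    using fg[of n] nn_integral_eq_integral[OF ifg[of n]] by simp
  have "integrable M (\<lambda>x. (f 0 x + (- 1) * (f 0 x - g x))\<^sup>2)"
    by (rule integrable_square_add_scaled(1)[OF _ _ int ifg]) measurable
  then have "integrable M (\<lambda>x. (g x)\<^sup>2)"
    by simp
  from that[OF g this ifg ifg2] show thesis .
qed

text \<open>Riesz representation on a pre-Hilbert subspace \<open>V\<close> of \<open>L\<^sub>2\<close>. The representing function is the limit of a
minimising sequence of \<open>J(f) = \<integral> f\<^sup>2 - 2 L f\<close>, which is Cauchy by the parallelogram identity. That it lies
in the closure of \<open>V\<close> is recorded because it makes its norm equal to the norm of \<open>L\<close>.\<close>

lemma L2_functional_representation:
  fixes V :: "('a \<Rightarrow> real) set" and L :: "('a \<Rightarrow> real) \<Rightarrow> real"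
  assumes V0: "V \<noteq> {}"
    and Vm: "\<And>f. f \<in> V \<Longrightarrow> f \<in> borel_measurable M"
    and Vi: "\<And>f. f \<in> V \<Longrightarrow> integrable M (\<lambda>x. (f x)\<^sup>2)"
    and Vadd: "\<And>f g c. f \<in> V \<Longrightarrow> g \<in> V \<Longrightarrow> (\<lambda>x. f x + c * g x) \<in> V"
    and Ladd: "\<And>f g c. f \<in> V \<Longrightarrow> g \<in> V \<Longrightarrow> L (\<lambda>x. f x + c * g x) = L f + c * L g"
    and bound: "\<And>f. f \<in> V \<Longrightarrow> (L f)\<^sup>2 \<le> C * (\<integral>x. (f x)\<^sup>2 \<partial>M)"
  obtains g where "g \<in> borel_measurable M" "integrable M (\<lambda>x. (g x)\<^sup>2)"
    "\<And>f. f \<in> V \<Longrightarrow> L f = (\<integral>x. f x * g x \<partial>M)"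
    "\<And>e. e > 0 \<Longrightarrow> \<exists>f\<in>V. integrable M (\<lambda>x. (f x - g x)\<^sup>2) \<and> (\<integral>x. (f x - g x)\<^sup>2 \<partial>M) \<le> e"
proof -
  define J where "J f = (\<integral>x. (f x)\<^sup>2 \<partial>M) - 2 * L f" for f
  have Jadd: "J (\<lambda>x. f x + c * g x) = J f + 2 * c * ((\<integral>x. f x * g x \<partial>M) - L g) + c\<^sup>2 * (\<integral>x. (g x)\<^sup>2 \<partial>M)"
    if "f \<in> V" "g \<in> V" for f g c
    unfolding J_def using that
    by (simp add: Ladd integrable_square_add_scaled(2)[OF Vm Vm Vi Vi] algebra_simps)
  \<comment> \<open>\<open>J\<close> is bounded below: \<open>2 L f \<le> 2 \<surd>(C N) \<le> N + C\<close> with \<open>N = \<integral> f\<^sup>2\<close>.\<close>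
  have J_bound: "- \<bar>C\<bar> \<le> J f" if "f \<in> V" for f
  proof -
    define N where "N = (\<integral>x. (f x)\<^sup>2 \<partial>M)"
    have N: "N \<ge> 0" by (simp add: N_def)
    have "(2 * L f)\<^sup>2 \<le> 4 * (\<bar>C\<bar> * N)"
      using order_trans[OF bound[OF that, folded N_def] mult_right_mono[OF abs_ge_self N]]
      by (simp add: power_mult_distrib)
    also have "\<dots> \<le> (N + \<bar>C\<bar>)\<^sup>2"
      using zero_le_power2[of "N - \<bar>C\<bar>"] by (simp add: power2_eq_square algebra_simps)
    finally have "2 * L f \<le> N + \<bar>C\<bar>"
      by (rule power2_le_imp_le) (use N in auto)
    then show ?thesis by (simp add: J_def N_def)
  qed
  define d where "d = Inf (J ` V)"
  have bdd: "bdd_below (J ` V)"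
    using J_bound by (auto intro!: bdd_belowI2)
  have d_le: "d \<le> J f" if "f \<in> V" for f
    unfolding d_def using bdd that by (intro cInf_lower) auto
  define \<epsilon> :: "nat \<Rightarrow> real" where "\<epsilon> n = (1 / 4) ^ n / 4" for n
  have "\<exists>f\<in>V. J f < d + \<epsilon> n" for n
    using cInf_lessD[of "J ` V" "d + \<epsilon> n"] V0 by (auto simp: d_def \<epsilon>_def)
  then have "\<exists>f. \<forall>n. f n \<in> V \<and> J (f n) < d + \<epsilon> n"
    by (intro choice) blast
  then obtain f where f: "\<And>n. f n \<in> V" "\<And>n. J (f n) < d + \<epsilon> n"
    by blast
  note fm = Vm[OF f(1)] and fi = Vi[OF f(1)]
  have V2: "(\<lambda>x. 0 + c * g x) \<in> V" if "g \<in> V" for g c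
    using Vadd[OF Vadd[OF that that, of "- 1"] that, of c] by (simp add: field_simps)
  have Cauchy: "(\<integral>x. (f m x - f n x)\<^sup>2 \<partial>M) \<le> (1 / 4) ^ n" if "n \<le> m" for m n
  proof -
    let ?h = "\<lambda>x. f m x + (- 1) * f n x"
    have h: "?h \<in> V" by (intro Vadd f)
    have eq: "J (\<lambda>x. f n x + (1 / 2) * ?h x) =
        J (f n) + ((\<integral>x. f n x * ?h x \<partial>M) - L ?h) + (\<integral>x. (?h x)\<^sup>2 \<partial>M) / 4"
      by (subst Jadd[OF f(1) h]) (simp add: power2_eq_square)
    have eq1: "J (\<lambda>x. f n x + 1 * ?h x) =
        J (f n) + 2 * ((\<integral>x. f n x * ?h x \<partial>M) - L ?h) + (\<integral>x. (?h x)\<^sup>2 \<partial>M)"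
      by (subst Jadd[OF f(1) h]) simp
    have e: "(\<lambda>x. f n x + 1 * ?h x) = f m" by auto
    have "d \<le> J (\<lambda>x. f n x + (1 / 2) * ?h x)"
      by (intro d_le Vadd f h)
    \<comment> \<open>The parallelogram identity, in terms of \<open>J\<close> at the two functions and at their midpoint.\<close>
    have arith: "B \<le> 2 * jm + 2 * jn - 4 * d"
      if "d \<le> jh" "jh = jn + A + B / 4" "jm = jn + 2 * A + B" for jh jn jm A B :: real
      using that by linarith
    have "(\<integral>x. (?h x)\<^sup>2 \<partial>M) \<le> 2 * J (f m) + 2 * J (f n) - 4 * d"
      by (rule arith[OF _ eq eq1[unfolded e]]) (intro d_le Vadd f h)
    also have "\<dots> \<le> 2 * \<epsilon> m + 2 * \<epsilon> n"
      using f(2)[of m] f(2)[of n] by simp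
    also have "\<dots> \<le> 4 * \<epsilon> n"
    proof -
      have "\<epsilon> m \<le> \<epsilon> n"
        unfolding \<epsilon>_def by (intro divide_right_mono power_decreasing that) auto
      then show ?thesis by simp
    qed
    finally show ?thesis by (simp add: \<epsilon>_def)
  qed
  obtain g where g: "g \<in> borel_measurable M" "integrable M (\<lambda>x. (g x)\<^sup>2)"
    "\<And>n. integrable M (\<lambda>x. (f n x - g x)\<^sup>2)" "\<And>n. (\<integral>x. (f n x - g x)\<^sup>2 \<partial>M) \<le> (1 / 4) ^ n"
    using fast_Cauchy_L2_limit[of f M, OF fm fi Cauchy] by blast
  have \<epsilon>0: "\<epsilon> \<longlonglongrightarrow> 0" and p0: "(\<lambda>n. (1 / 4 :: real) ^ n) \<longlonglongrightarrow> 0"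
    unfolding \<epsilon>_def by (auto intro!: tendsto_eq_intros LIMSEQ_power_zero)
  show thesis
  proof (rule that[OF g(1,2)])
    fix h assume h: "h \<in> V"
    let ?N = "\<integral>x. (h x)\<^sup>2 \<partial>M"
    have lim1: "(\<lambda>n. (\<integral>x. f n x * h x \<partial>M) - L h) \<longlonglongrightarrow> 0"
    proof (rule tendsto_0_le[where K=1, of "\<lambda>n. sqrt (\<epsilon> n * ?N)"])
      show "(\<lambda>n. sqrt (\<epsilon> n * ?N)) \<longlonglongrightarrow> 0"
        using \<epsilon>0 by (auto intro!: tendsto_eq_intros)
      have "((\<integral>x. f n x * h x \<partial>M) - L h)\<^sup>2 \<le> \<epsilon> n * ?N" for n
      proof (rule quadratic_nonneg_discriminant)
        fix t
        have "d \<le> J (\<lambda>x. f n x + t * h x)"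
          by (intro d_le Vadd f h)
        then show "0 \<le> \<epsilon> n + 2 * t * ((\<integral>x. f n x * h x \<partial>M) - L h) + t\<^sup>2 * ?N"
          using Jadd[OF f(1) h, of n t] f(2)[of n] by simp
      qed simp
      then show "\<forall>\<^sub>F n in sequentially. norm ((\<integral>x. f n x * h x \<partial>M) - L h) \<le> norm (sqrt (\<epsilon> n * ?N)) * 1"
        by (intro always_eventually allI) (simp only: mult_1_right norm_le_abs_sqrt)
    qed
    have lim2: "(\<lambda>n. \<integral>x. (f n x - g x) * h x \<partial>M) \<longlonglongrightarrow> 0"
    proof (rule tendsto_0_le[where K=1, of "\<lambda>n. sqrt ((1 / 4) ^ n * ?N)"])
      show "(\<lambda>n. sqrt ((1 / 4) ^ n * ?N)) \<longlonglongrightarrow> 0"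
        using p0 by (auto intro!: tendsto_eq_intros)
      have "(\<integral>x. (f n x - g x) * h x \<partial>M)\<^sup>2 \<le> (1 / 4) ^ n * ?N" for n
      proof (rule order_trans[OF integral_Cauchy_Schwarz])
        show "(\<integral>x. (f n x - g x)\<^sup>2 \<partial>M) * ?N \<le> (1 / 4) ^ n * ?N"
          by (intro mult_right_mono g) simp
      qed (use fm g Vm Vi h in auto)
      then show "\<forall>\<^sub>F n in sequentially. norm (\<integral>x. (f n x - g x) * h x \<partial>M) \<le> norm (sqrt ((1 / 4) ^ n * ?N)) * 1"
        by (intro always_eventually allI) (simp only: mult_1_right norm_le_abs_sqrt)
    qed
    have "(\<integral>x. (f n x - g x) * h x \<partial>M) = (\<integral>x. f n x * h x \<partial>M) - (\<integral>x. g x * h x \<partial>M)" for n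
      using integrable_mult_square[OF fm Vm fi Vi, OF h h] integrable_mult_square[OF g(1) Vm g(2) Vi, OF h h]
      by (simp add: left_diff_distrib)
    then have "(\<lambda>n. L h - (\<integral>x. g x * h x \<partial>M)) \<longlonglongrightarrow> 0"
      using tendsto_diff[OF lim2 lim1] by simp
    then show "L h = (\<integral>x. h x * g x \<partial>M)"
      by (simp add: LIMSEQ_const_iff mult.commute)
  next
    fix e :: real assume "e > 0"
    then obtain n where "(1 / 4 :: real) ^ n < e"
      using real_arch_pow_inv[of e "1 / 4"] by auto
    then show "\<exists>f\<in>V. integrable M (\<lambda>x. (f x - g x)\<^sup>2) \<and> (\<integral>x. (f x - g x)\<^sup>2 \<partial>M) \<le> e"
      using g(4)[of n] by (intro bexI[OF _ f(1)[of n]] conjI g(3)) simp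
  qed
qed

section \<open>Sums of independent observations\<close>

text \<open>The measure may change along the sequence, as the sample space of \<open>n\<close> observations does.\<close>

definition vanishes_in_prob :: "(nat \<Rightarrow> 'a measure) \<Rightarrow> (nat \<Rightarrow> 'a \<Rightarrow> real) \<Rightarrow> bool" where
  "vanishes_in_prob P Z \<longleftrightarrow>
     (\<forall>\<epsilon>>0. (\<lambda>n. measure (P n) {x \<in> space (P n). \<bar>Z n x\<bar> > \<epsilon>}) \<longlonglongrightarrow> 0)"

lemma vanishes_in_probD:
  "vanishes_in_prob P Z \<Longrightarrow> \<epsilon> > 0 \<Longrightarrow> (\<lambda>n. measure (P n) {x \<in> space (P n). \<bar>Z n x\<bar> > \<epsilon>}) \<longlonglongrightarrow> 0"
  by (simp add: vanishes_in_prob_def)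

lemma vanishes_in_prob_add:
  assumes P: "\<And>n. prob_space (P n)"
    and [measurable]: "\<And>n. Z n \<in> borel_measurable (P n)" "\<And>n. Z' n \<in> borel_measurable (P n)"
    and Z: "vanishes_in_prob P Z" "vanishes_in_prob P Z'"
  shows "vanishes_in_prob P (\<lambda>n x. Z n x + Z' n x)"
  unfolding vanishes_in_prob_def
proof (intro allI impI)
  fix \<epsilon> :: real assume \<epsilon>: "\<epsilon> > 0"
  let ?E = "\<lambda>Z n \<epsilon>. {x \<in> space (P n). \<bar>Z n x\<bar> > \<epsilon>}"
  show "(\<lambda>n. measure (P n) (?E (\<lambda>n x. Z n x + Z' n x) n \<epsilon>)) \<longlonglongrightarrow> 0"
  proof (rule tendsto_sandwich[OF _ _ tendsto_const])
    show "(\<lambda>n. measure (P n) (?E Z n (\<epsilon> / 2)) + measure (P n) (?E Z' n (\<epsilon> / 2))) \<longlonglongrightarrow> 0"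
      using \<epsilon> by (intro tendsto_add_zero vanishes_in_probD Z) auto
    show "\<forall>\<^sub>F n in sequentially. measure (P n) (?E (\<lambda>n x. Z n x + Z' n x) n \<epsilon>)
        \<le> measure (P n) (?E Z n (\<epsilon> / 2)) + measure (P n) (?E Z' n (\<epsilon> / 2))"
    proof (intro always_eventually allI)
      fix n
      interpret prob_space "P n" by (rule P)
      have "measure (P n) (?E (\<lambda>n x. Z n x + Z' n x) n \<epsilon>) \<le> measure (P n) (?E Z n (\<epsilon> / 2) \<union> ?E Z' n (\<epsilon> / 2))"
        by (intro finite_measure_mono) auto
      also have "\<dots> \<le> measure (P n) (?E Z n (\<epsilon> / 2)) + measure (P n) (?E Z' n (\<epsilon> / 2))"
        by (intro measure_Un_le) auto
      finally show "measure (P n) (?E (\<lambda>n x. Z n x + Z' n x) n \<epsilon>)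
        \<le> measure (P n) (?E Z n (\<epsilon> / 2)) + measure (P n) (?E Z' n (\<epsilon> / 2))" .
    qed
  qed auto
qed

lemma vanishes_in_prob_cmult:
  assumes "vanishes_in_prob P Z"
  shows "vanishes_in_prob P (\<lambda>n x. c * Z n x)"
proof (cases "c = 0")
  case False
  have "{x \<in> space (P n). \<bar>c * Z n x\<bar> > \<epsilon>} = {x \<in> space (P n). \<bar>Z n x\<bar> > \<epsilon> / \<bar>c\<bar>}" for n \<epsilon>
    using False by (auto simp: abs_mult field_simps)
  then show ?thesis
    using assms False unfolding vanishes_in_prob_def by simp
qed (simp add: vanishes_in_prob_def)

lemma vanishes_in_prob_const:
  assumes "a \<longlonglongrightarrow> 0"
  shows "vanishes_in_prob P (\<lambda>n x. a n)"
  unfolding vanishes_in_prob_def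
proof (intro allI impI)
  fix \<epsilon> :: real assume "\<epsilon> > 0"
  then have "\<forall>\<^sub>F n in sequentially. \<bar>a n\<bar> < \<epsilon>"
    using assms by (auto simp: tendsto_iff dist_real_def)
  then show "(\<lambda>n. measure (P n) {x \<in> space (P n). \<bar>a n\<bar> > \<epsilon>}) \<longlonglongrightarrow> 0"
    by (intro tendsto_eventually) (auto elim: eventually_mono)
qed

lemma (in prob_space) Markov_real:
  assumes "integrable M f" "\<epsilon> > 0"
  shows "measure M {x\<in>space M. \<bar>f x\<bar> > \<epsilon>} \<le> (\<integral>x. \<bar>f x\<bar> \<partial>M) / (\<epsilon> :: real)"
proof -
  have [measurable]: "f \<in> borel_measurable M" using assms by auto
  have "measure M {x\<in>space M. \<bar>f x\<bar> > \<epsilon>} \<le> measure M {x\<in>space M. \<bar>f x\<bar> \<ge> \<epsilon>}"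
    by (intro finite_measure_mono) auto
  also have "\<dots> \<le> (\<integral>x. \<bar>f x\<bar> \<partial>M) / \<epsilon>"
    using assms by (intro integral_Markov_inequality_measure[where A="{}"]) auto
  finally show ?thesis .
qed

lemma vanishes_in_prob_L1:
  assumes P: "\<And>n. prob_space (P n)"
    and int: "\<And>n. integrable (P n) (Z n)"
    and lim: "(\<lambda>n. \<integral>x. \<bar>Z n x\<bar> \<partial>P n) \<longlonglongrightarrow> 0"
  shows "vanishes_in_prob P Z"
  unfolding vanishes_in_prob_def
proof (intro allI impI)
  fix \<epsilon> :: real assume \<epsilon>: "\<epsilon> > 0"
  show "(\<lambda>n. measure (P n) {x \<in> space (P n). \<bar>Z n x\<bar> > \<epsilon>}) \<longlonglongrightarrow> 0"
  proof (rule tendsto_sandwich[OF _ _ tendsto_const])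
    show "(\<lambda>n. (\<integral>x. \<bar>Z n x\<bar> \<partial>P n) / \<epsilon>) \<longlonglongrightarrow> 0"
      using lim \<epsilon> by (auto intro!: tendsto_eq_intros)
  qed (use prob_space.Markov_real[OF P int \<epsilon>] in auto)
qed

lemma vanishes_in_prob_L2:
  assumes P: "\<And>n. prob_space (P n)"
    and int: "\<And>n. integrable (P n) (\<lambda>x. (Z n x)\<^sup>2)"
    and lim: "(\<lambda>n. \<integral>x. (Z n x)\<^sup>2 \<partial>P n) \<longlonglongrightarrow> 0"
  shows "vanishes_in_prob P Z"
proof -
  have "vanishes_in_prob P (\<lambda>n x. (Z n x)\<^sup>2)"
    using lim by (intro vanishes_in_prob_L1 P int) simp
  then have "\<forall>\<epsilon>>0. (\<lambda>n. measure (P n) {x \<in> space (P n). \<bar>(Z n x)\<^sup>2\<bar> > \<epsilon>\<^sup>2}) \<longlonglongrightarrow> 0"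
    unfolding vanishes_in_prob_def by simp
  moreover have "\<epsilon>\<^sup>2 < \<bar>(Z n x)\<^sup>2\<bar> \<longleftrightarrow> \<epsilon> < \<bar>Z n x\<bar>" if "\<epsilon> > 0" for \<epsilon> n x
    using that abs_le_square_iff[of "Z n x" \<epsilon>] by (auto simp: not_le[symmetric])
  ultimately show ?thesis
    unfolding vanishes_in_prob_def by simp
qed

text \<open>Truncation device: it suffices to approximate the sequence in mean, up to arbitrarily small errors, by
sequences that vanish in probability.\<close>

lemma vanishes_in_prob_approx:
  assumes P: "\<And>n. prob_space (P n)"
    and int: "\<And>n. integrable (P n) (Z n)"
    and approx: "\<And>\<eta>. \<eta> > 0 \<Longrightarrow> \<exists>Z'. vanishes_in_prob P Z' \<and> (\<forall>n. integrable (P n) (Z' n)) \<and>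
      (\<forall>\<^sub>F n in sequentially. (\<integral>x. \<bar>Z n x - Z' n x\<bar> \<partial>P n) \<le> \<eta>)"
  shows "vanishes_in_prob P Z"
  unfolding vanishes_in_prob_def
proof (intro allI impI)
  fix \<epsilon> :: real assume \<epsilon>: "\<epsilon> > 0"
  let ?E = "\<lambda>Z n \<epsilon>. {x \<in> space (P n). \<bar>Z n x\<bar> > \<epsilon>}"
  show "(\<lambda>n. measure (P n) (?E Z n \<epsilon>)) \<longlonglongrightarrow> 0"
    unfolding tendsto_iff
  proof (intro allI impI)
    fix e :: real assume e: "e > 0"
    then obtain Z' where Z': "vanishes_in_prob P Z'" "\<And>n. integrable (P n) (Z' n)"
      "\<forall>\<^sub>F n in sequentially. (\<integral>x. \<bar>Z n x - Z' n x\<bar> \<partial>P n) \<le> e * \<epsilon> / 4"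
      using approx[of "e * \<epsilon> / 4"] \<epsilon> by auto
    have "(\<lambda>n. measure (P n) (?E Z' n (\<epsilon> / 2))) \<longlonglongrightarrow> 0"
      using \<epsilon> by (intro vanishes_in_probD Z'(1)) auto
    then have "\<forall>\<^sub>F n in sequentially. measure (P n) (?E Z' n (\<epsilon> / 2)) < e / 2"
      using e by (intro order_tendstoD) auto
    with Z'(3) show "\<forall>\<^sub>F n in sequentially. dist (measure (P n) (?E Z n \<epsilon>)) 0 < e"
    proof eventually_elim
      case (elim n)
      interpret prob_space "P n" by (rule P)
      have [measurable]: "Z n \<in> borel_measurable (P n)" "Z' n \<in> borel_measurable (P n)"
        using int Z'(2) by auto
      have "measure (P n) (?E Z n \<epsilon>) \<le> measure (P n) (?E (\<lambda>n x. Z n x - Z' n x) n (\<epsilon> / 2) \<union> ?E Z' n (\<epsilon> / 2))"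
      proof (intro finite_measure_mono subsetI)
        fix x assume "x \<in> ?E Z n \<epsilon>"
        then show "x \<in> ?E (\<lambda>n x. Z n x - Z' n x) n (\<epsilon> / 2) \<union> ?E Z' n (\<epsilon> / 2)"
          using abs_triangle_ineq[of "Z n x - Z' n x" "Z' n x"] by auto
      qed measurable
      also have "\<dots> \<le> measure (P n) (?E (\<lambda>n x. Z n x - Z' n x) n (\<epsilon> / 2)) + measure (P n) (?E Z' n (\<epsilon> / 2))"
        by (intro measure_Un_le) auto
      also have "measure (P n) (?E (\<lambda>n x. Z n x - Z' n x) n (\<epsilon> / 2)) \<le> (\<integral>x. \<bar>Z n x - Z' n x\<bar> \<partial>P n) / (\<epsilon> / 2)"
        using int Z'(2) \<epsilon> by (intro Markov_real) auto
      also have "\<dots> \<le> e / 2"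
        using elim(1) \<epsilon> by (simp add: field_simps)
      finally show ?case
        using elim(2) by simp
    qed
  qed
qed

context prob_space
begin

abbreviation iid :: "nat \<Rightarrow> (nat \<Rightarrow> 'a) measure" where
  "iid n \<equiv> PiM {..<n} (\<lambda>_. M)"

lemma prob_space_iid: "prob_space (iid n)"
  by (intro prob_space_PiM) unfold_locales

lemma distr_iid_component: "i < n \<Longrightarrow> distr (iid n) M (\<lambda>x. x i) = M"
  by (rule distr_PiM_component) (auto intro: prob_space_axioms)

lemma iid_component_integral:
  fixes f :: "'a \<Rightarrow> real"
  assumes "integrable M f" "i < n"
  shows "integrable (iid n) (\<lambda>x. f (x i))" "(\<integral>x. f (x i) \<partial>iid n) = (\<integral>x. f x \<partial>M)"
proof -
  have f: "f \<in> borel_measurable M" using assms by auto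
  have c: "(\<lambda>x. x i) \<in> measurable (iid n) M"
    using assms(2) by (intro measurable_component_singleton) auto
  have "integrable (distr (iid n) M (\<lambda>x. x i)) f"
    using assms distr_iid_component by simp
  then show "integrable (iid n) (\<lambda>x. f (x i))"
    using integrable_distr_eq[OF c f] by simp
  show "(\<integral>x. f (x i) \<partial>iid n) = (\<integral>x. f x \<partial>M)"
    using integral_distr[OF c f] distr_iid_component[OF assms(2)] by simp
qed

lemma iid_sum_integral:
  fixes f :: "'a \<Rightarrow> real"
  assumes "integrable M f"
  shows "integrable (iid n) (\<lambda>x. \<Sum>i<n. f (x i))" "(\<integral>x. (\<Sum>i<n. f (x i)) \<partial>iid n) = n * (\<integral>x. f x \<partial>M)"
  using iid_component_integral[OF assms] by (auto simp: Bochner_Integration.integral_sum)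

lemma iid_sum_abs_integral_le:
  fixes f :: "'a \<Rightarrow> real"
  assumes "integrable M f"
  shows "(\<integral>x. \<bar>\<Sum>i<n. f (x i)\<bar> \<partial>iid n) \<le> n * (\<integral>x. \<bar>f x\<bar> \<partial>M)"
proof -
  have "(\<integral>x. \<bar>\<Sum>i<n. f (x i)\<bar> \<partial>iid n) \<le> (\<integral>x. (\<Sum>i<n. \<bar>f (x i)\<bar>) \<partial>iid n)"
    using assms by (intro integral_mono integrable_abs iid_sum_integral(1)) auto
  then show ?thesis
    using iid_sum_integral(2)[of "\<lambda>x. \<bar>f x\<bar>" n] assms by simp
qed

text \<open>The orthogonality of centred functions of distinct coordinates, in the form needed for variances.\<close>

lemma iid_product_integral:
  fixes f :: "'a \<Rightarrow> real"
  assumes f: "integrable M f" and ij: "i < n" "j < n" "i \<noteq> j"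
  shows "integrable (iid n) (\<lambda>x. f (x i) * f (x j))"
    "(\<integral>x. f (x i) * f (x j) \<partial>iid n) = (\<integral>x. f x \<partial>M)\<^sup>2"
proof -
  interpret product_sigma_finite "\<lambda>_::nat. M" by unfold_locales
  define g where "g k = (if k = i \<or> k = j then f else (\<lambda>_. 1))" for k
  have g: "integrable M (g k)" for k
    using f by (auto simp: g_def)
  have eq: "(\<Prod>k<n. g k (x k)) = f (x i) * f (x j)" for x
  proof -
    have "(\<Prod>k<n. g k (x k)) = (\<Prod>k\<in>{i,j}. g k (x k))"
      using ij by (intro prod.mono_neutral_right) (auto simp: g_def)
    then show ?thesis using ij by (simp add: g_def)
  qed
  have eq': "(\<Prod>k<n. integral\<^sup>L M (g k)) = (\<integral>x. f x \<partial>M)\<^sup>2"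
  proof -
    have "(\<Prod>k<n. integral\<^sup>L M (g k)) = (\<Prod>k\<in>{i,j}. integral\<^sup>L M (g k))"
      using ij by (intro prod.mono_neutral_right) (auto simp: g_def prob_space)
    then show ?thesis using ij by (simp add: g_def power2_eq_square)
  qed
  show "integrable (iid n) (\<lambda>x. f (x i) * f (x j))"
    using product_integrable_prod[of "{..<n}" g] g by (simp add: eq)
  show "(\<integral>x. f (x i) * f (x j) \<partial>iid n) = (\<integral>x. f x \<partial>M)\<^sup>2"
    using product_integral_prod[of "{..<n}" g] g by (simp add: eq eq')
qed

lemma iid_sum_square_integral:
  fixes f :: "'a \<Rightarrow> real"
  assumes f: "integrable M f" "integrable M (\<lambda>x. (f x)\<^sup>2)" and "(\<integral>x. f x \<partial>M) = 0"
  shows "integrable (iid n) (\<lambda>x. (\<Sum>i<n. f (x i))\<^sup>2)"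
    "(\<integral>x. (\<Sum>i<n. f (x i))\<^sup>2 \<partial>iid n) = n * (\<integral>x. (f x)\<^sup>2 \<partial>M)"
proof -
  have p: "integrable (iid n) (\<lambda>x. f (x i) * f (x j)) \<and>
      (\<integral>x. f (x i) * f (x j) \<partial>iid n) = (if i = j then \<integral>x. (f x)\<^sup>2 \<partial>M else 0)" if "i < n" "j < n" for i j
    using that iid_product_integral[OF f(1), of i n j] iid_component_integral[OF f(2), of i n] assms(3)
    by (auto simp: power2_eq_square)
  have eq: "(\<Sum>i<n. f (x i))\<^sup>2 = (\<Sum>i<n. \<Sum>j<n. f (x i) * f (x j))" for x
    by (simp add: power2_eq_square sum_product)
  show "integrable (iid n) (\<lambda>x. (\<Sum>i<n. f (x i))\<^sup>2)"
    unfolding eq using p by (intro Bochner_Integration.integrable_sum) auto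
  show "(\<integral>x. (\<Sum>i<n. f (x i))\<^sup>2 \<partial>iid n) = n * (\<integral>x. (f x)\<^sup>2 \<partial>M)"
  proof -
    have "(\<integral>x. (\<Sum>i<n. \<Sum>j<n. f (x i) * f (x j)) \<partial>iid n) = (\<Sum>i<n. \<Sum>j<n. \<integral>x. f (x i) * f (x j) \<partial>iid n)"
      using p by (subst Bochner_Integration.integral_sum, (intro Bochner_Integration.integrable_sum, auto)[1])
        (intro sum.cong refl Bochner_Integration.integral_sum, auto)
    also have "\<dots> = (\<Sum>i<n. \<Sum>j<n. if i = j then \<integral>x. (f x)\<^sup>2 \<partial>M else 0)"
      using p by (intro sum.cong refl) auto
    also have "\<dots> = n * (\<integral>x. (f x)\<^sup>2 \<partial>M)"
      by simp
    finally show ?thesis unfolding eq .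
  qed
qed

lemma integrable_of_square:
  fixes f :: "'a \<Rightarrow> real"
  assumes "f \<in> borel_measurable M" "integrable M (\<lambda>x. (f x)\<^sup>2)"
  shows "integrable M f"
  using integrable_mult_square[of f M "\<lambda>_. 1"] assms by simp

lemma integrable_square_diff:
  fixes f g :: "'a \<Rightarrow> real"
  assumes "f \<in> borel_measurable M" "integrable M (\<lambda>x. (f x)\<^sup>2)" 
     "g \<in> borel_measurable M" "integrable M (\<lambda>x. (g x)\<^sup>2)"
  shows "integrable M (\<lambda>x. (f x - g x)\<^sup>2)"
  using integrable_square_add_scaled(1)[of f M g "-1"] assms by simp

text \<open>The variance of the sum is at most \<open>n \<integral> f\<^sub>n\<^sup>2\<close>.\<close>

lemma iid_centred_sum_vanishes:
  fixes f :: "nat \<Rightarrow> 'a \<Rightarrow> real"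
  assumes m: "\<And>n. f n \<in> borel_measurable M" and i: "\<And>n. integrable M (\<lambda>x. (f n x)\<^sup>2)"
    and lim: "(\<lambda>n. real n * (\<integral>x. (f n x)\<^sup>2 \<partial>M)) \<longlonglongrightarrow> 0"
  shows "vanishes_in_prob iid (\<lambda>n x. (\<Sum>i<n. f n (x i)) - n * (\<integral>x. f n x \<partial>M))"
proof -
  define a where "a n = (\<integral>x. f n x \<partial>M)" for n
  define g where "g n x = f n x - a n" for n x
  note fi = integrable_of_square[OF m i]
  have g: "integrable M (g n)" "integrable M (\<lambda>x. (g n x)\<^sup>2)" "(\<integral>x. g n x \<partial>M) = 0" for n
    unfolding g_def using fi[of n] m[of n] i[of n]
    by (auto intro!: integrable_square_diff simp: a_def prob_space)
  have le: "(\<integral>x. (g n x)\<^sup>2 \<partial>M) \<le> (\<integral>x. (f n x)\<^sup>2 \<partial>M)" for n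
  proof -
    have "(\<lambda>x. (g n x)\<^sup>2) = (\<lambda>x. (f n x)\<^sup>2 - 2 * a n * f n x + (a n)\<^sup>2)"
      by (auto simp: g_def power2_eq_square algebra_simps)
    then have "(\<integral>x. (g n x)\<^sup>2 \<partial>M) = (\<integral>x. (f n x)\<^sup>2 \<partial>M) - (a n)\<^sup>2"
      using fi[of n] i[of n] by (simp add: a_def[symmetric] prob_space power2_eq_square)
    then show ?thesis by simp
  qed
  have "vanishes_in_prob iid (\<lambda>n x. \<Sum>i<n. g n (x i))"
  proof (rule vanishes_in_prob_L2[OF prob_space_iid iid_sum_square_integral(1)[OF g]])
    show "(\<lambda>n. \<integral>x. (\<Sum>i<n. g n (x i))\<^sup>2 \<partial>iid n) \<longlonglongrightarrow> 0"
      unfolding iid_sum_square_integral(2)[OF g]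
      by (rule tendsto_sandwich[OF _ _ tendsto_const lim])
        (auto intro!: always_eventually mult_left_mono le)
  qed
  then show ?thesis
    by (simp add: g_def a_def sum_subtractf)
qed

text \<open>Only a first moment is available for the squares of the score, so the summands are truncated at a fixed
level: the truncated means obey the variance bound, and the truncation error is small in mean uniformly in
the number of observations.\<close>

theorem weak_law_of_large_numbers:
  fixes f :: "'a \<Rightarrow> real"
  assumes f: "integrable M f"
  shows "vanishes_in_prob iid (\<lambda>n x. (\<Sum>i<n. f (x i)) / n - (\<integral>x. f x \<partial>M))"
proof (rule vanishes_in_prob_approx[OF prob_space_iid])
  have [measurable]: "f \<in> borel_measurable M" using f by auto
  show "integrable (iid n) (\<lambda>x. (\<Sum>i<n. f (x i)) / n - (\<integral>x. f x \<partial>M))" for n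
  proof -
    interpret n: prob_space "iid n" by (rule prob_space_iid)
    show ?thesis using iid_sum_integral(1)[OF f] by simp
  qed
  fix \<eta> :: real assume \<eta>: "\<eta> > 0"
  define t where "t K x = max (- real K) (min (real K) (f x))" for K :: nat and x
  have tb: "\<bar>t K x\<bar> \<le> real K" "\<bar>t K x\<bar> \<le> \<bar>f x\<bar>" for K x
    by (auto simp: t_def)
  have [measurable]: "t K \<in> borel_measurable M" for K
    unfolding t_def by measurable
  have ti: "integrable M (t K)" for K
    by (rule Bochner_Integration.integrable_bound[OF f]) (use tb in auto)
  have t2: "integrable M (\<lambda>x. (t K x)\<^sup>2)" for K
    using tb(1)[of K] by (intro integrable_const_bound[where B="(real K)\<^sup>2"]) (auto intro!: AE_I2 simp: abs_le_square_iff[symmetric])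
  have "(\<lambda>K. \<integral>x. \<bar>f x - t K x\<bar> \<partial>M) \<longlonglongrightarrow> (\<integral>x. 0 \<partial>M)"
  proof (rule integral_dominated_convergence)
    show "integrable M (\<lambda>x. 2 * \<bar>f x\<bar>)" using f by auto
    have "\<bar>f x - t K x\<bar> \<le> 2 * \<bar>f x\<bar>" for K x
      using abs_triangle_ineq4[of "f x" "t K x"] tb(2)[of K x] by linarith
    then show "AE x in M. norm \<bar>f x - t K x\<bar> \<le> 2 * \<bar>f x\<bar>" for K
      by (intro AE_I2) simp
    show "AE x in M. (\<lambda>K. \<bar>f x - t K x\<bar>) \<longlonglongrightarrow> 0"
    proof (intro AE_I2 tendsto_eventually)
      fix x
      obtain K0 :: nat where "\<bar>f x\<bar> \<le> real K0" using real_arch_simple by blast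
      then show "\<forall>\<^sub>F K in sequentially. \<bar>f x - t K x\<bar> = 0"
        by (intro eventually_sequentiallyI[of K0]) (auto simp: t_def)
    qed
  qed auto
  then have "\<forall>\<^sub>F K in sequentially. (\<integral>x. \<bar>f x - t K x\<bar> \<partial>M) < \<eta> / 2"
    using \<eta> by (intro order_tendstoD) auto
  then obtain K where K: "(\<integral>x. \<bar>f x - t K x\<bar> \<partial>M) < \<eta> / 2"
    by (auto simp: eventually_sequentially)
  let ?a = "\<integral>x. t K x \<partial>M"
  show "\<exists>Z'. vanishes_in_prob iid Z' \<and> (\<forall>n. integrable (iid n) (Z' n)) \<and>
      (\<forall>\<^sub>F n in sequentially. (\<integral>x. \<bar>(\<Sum>i<n. f (x i)) / n - (\<integral>x. f x \<partial>M) - Z' n x\<bar> \<partial>iid n) \<le> \<eta>)"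
  proof (intro exI conjI allI)
    have "vanishes_in_prob iid (\<lambda>n x. (\<Sum>i<n. t K (x i) / n) - n * (\<integral>x. t K x / n \<partial>M))"
    proof (rule iid_centred_sum_vanishes)
      show "(\<lambda>n. real n * (\<integral>x. (t K x / n)\<^sup>2 \<partial>M)) \<longlonglongrightarrow> 0"
      proof (rule Lim_transform_eventually)
        show "(\<lambda>n. (\<integral>x. (t K x)\<^sup>2 \<partial>M) / real n) \<longlonglongrightarrow> 0"
          by (rule lim_const_over_n)
        show "\<forall>\<^sub>F n in sequentially. (\<integral>x. (t K x)\<^sup>2 \<partial>M) / real n = real n * (\<integral>x. (t K x / n)\<^sup>2 \<partial>M)"
          by (auto simp: power_divide power2_eq_square)
      qed
    qed (use t2[of K] in \<open>auto simp: power_divide\<close>)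
    moreover have "(\<lambda>n x. (\<Sum>i<n. t K (x i) / real n) - real n * (\<integral>x. t K x / real n \<partial>M)) =
        (\<lambda>n x. if n = 0 then 0 else (\<Sum>i<n. t K (x i)) / real n - ?a)"
      by (auto simp: sum_divide_distrib fun_eq_iff)
    ultimately show "vanishes_in_prob iid (\<lambda>n x. if n = 0 then 0 else (\<Sum>i<n. t K (x i)) / n - ?a)"
      by (simp only:)
    show "integrable (iid n) (\<lambda>x. if n = 0 then 0 else (\<Sum>i<n. t K (x i)) / n - ?a)" for n
    proof -
      interpret n: prob_space "iid n" by (rule prob_space_iid)
      show ?thesis using iid_sum_integral(1)[OF ti] by (cases "n = 0") auto
    qed
    show "\<forall>\<^sub>F n in sequentially. (\<integral>x. \<bar>(\<Sum>i<n. f (x i)) / n - (\<integral>x. f x \<partial>M)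
        - (if n = 0 then 0 else (\<Sum>i<n. t K (x i)) / n - ?a)\<bar> \<partial>iid n) \<le> \<eta>"
    proof (rule eventually_mono[OF eventually_gt_at_top[of 0]])
      fix n :: nat assume n: "n > 0"
      interpret n: prob_space "iid n" by (rule prob_space_iid)
      let ?h = "\<lambda>x. f x - t K x"
      have h: "integrable M ?h" using f ti by auto
      have "(\<integral>x. \<bar>(\<Sum>i<n. f (x i)) / n - (\<integral>x. f x \<partial>M)
          - (if n = 0 then 0 else (\<Sum>i<n. t K (x i)) / n - ?a)\<bar> \<partial>iid n)
        = (\<integral>x. \<bar>(\<Sum>i<n. ?h (x i)) / n - (\<integral>x. ?h x \<partial>M)\<bar> \<partial>iid n)"
        using n f ti by (intro Bochner_Integration.integral_cong) (auto simp: sum_subtractf diff_divide_distrib algebra_simps)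
      also have "\<dots> \<le> (\<integral>x. \<bar>\<Sum>i<n. ?h (x i)\<bar> / n + \<bar>\<integral>x. ?h x \<partial>M\<bar> \<partial>iid n)"
        using iid_sum_integral(1)[OF h, of n]
        by (intro integral_mono) (auto intro!: order_trans[OF abs_triangle_ineq4] simp: abs_divide)
      also have "\<dots> = (\<integral>x. \<bar>\<Sum>i<n. ?h (x i)\<bar> \<partial>iid n) / n + \<bar>\<integral>x. ?h x \<partial>M\<bar>"
        using iid_sum_integral(1)[OF h, of n] by (simp add: n.prob_space)
      also have "\<dots> \<le> (n * (\<integral>x. \<bar>?h x\<bar> \<partial>M)) / n + (\<integral>x. \<bar>?h x\<bar> \<partial>M)"
        using iid_sum_abs_integral_le[OF h, of n] by (intro add_mono divide_right_mono integral_abs_bound) auto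
      also have "\<dots> = (\<integral>x. \<bar>?h x\<bar> \<partial>M) + (\<integral>x. \<bar>?h x\<bar> \<partial>M)"
        using n by simp
      also have "\<dots> \<le> \<eta>" using K by simp
      finally show "(\<integral>x. \<bar>(\<Sum>i<n. f (x i)) / n - (\<integral>x. f x \<partial>M)
        - (if n = 0 then 0 else (\<Sum>i<n. t K (x i)) / n - ?a)\<bar> \<partial>iid n) \<le> \<eta>" .
    qed
  qed
qed

end


lemma ln_1_plus_quadratic_bound:
  fixes y :: real
  assumes "\<bar>y\<bar> \<le> 1 / 2"
  shows "\<bar>ln (1 + y) - (y - y\<^sup>2 / 2)\<bar> \<le> 2 * \<bar>y\<bar> * y\<^sup>2"
proof -
  define f where "f z = ln (1 + z) - (z - z\<^sup>2 / 2)" for z :: real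
  have "norm (f y - f 0) \<le> (2 * y\<^sup>2) * norm (y - 0)"
  proof (rule field_differentiable_bound[where S="{-\<bar>y\<bar>..\<bar>y\<bar>}" and f'="\<lambda>z. z\<^sup>2 / (1 + z)"])
    fix z assume z: "z \<in> {-\<bar>y\<bar>..\<bar>y\<bar>}"
    then have z1: "1 + z \<ge> 1 / 2" "\<bar>z\<bar> \<le> \<bar>y\<bar>"
      using assms by auto
    show "(f has_field_derivative z\<^sup>2 / (1 + z)) (at z within {-\<bar>y\<bar>..\<bar>y\<bar>})"
      unfolding f_def using z1
      by (auto intro!: derivative_eq_intros simp: field_simps power2_eq_square)
    have "z\<^sup>2 / (1 + z) \<le> z\<^sup>2 / (1 / 2)"
      using z1 by (intro divide_left_mono) auto
    also have "\<dots> \<le> 2 * y\<^sup>2"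
      using z1(2) by (simp add: abs_le_square_iff)
    finally show "norm (z\<^sup>2 / (1 + z)) \<le> 2 * y\<^sup>2"
      using z1 by simp
  qed auto
  then show ?thesis
    by (simp add: f_def algebra_simps)
qed

context prob_space
begin

text \<open>With \<open>B = Y - l / \<surd>n\<close>, the difference of squares is \<open>B\<^sup>2 + 2 B l / \<surd>n\<close>; its second part is
handled by the Cauchy-Schwarz inequality.\<close>

lemma triangular_array_squares:
  fixes Y :: "nat \<Rightarrow> 'a \<Rightarrow> real" and l :: "'a \<Rightarrow> real"
  assumes Ym: "\<And>n. Y n \<in> borel_measurable M" and Yi: "\<And>n. integrable M (\<lambda>x. (Y n x)\<^sup>2)"
    and lm: "l \<in> borel_measurable M" and li: "integrable M (\<lambda>x. (l x)\<^sup>2)"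
    and lim: "(\<lambda>n. real n * (\<integral>x. (Y n x - l x / sqrt n)\<^sup>2 \<partial>M)) \<longlonglongrightarrow> 0"
  shows "(\<lambda>n. real n * (\<integral>x. \<bar>(Y n x)\<^sup>2 - (l x)\<^sup>2 / n\<bar> \<partial>M)) \<longlonglongrightarrow> 0"
proof -
  define B where "B n x = Y n x - l x / sqrt n" for n x
  have li': "integrable M (\<lambda>x. (l x / sqrt (real n))\<^sup>2)" for n
    using li by (simp add: power_divide)
  have Bm: "B n \<in> borel_measurable M" for n
    unfolding B_def using Ym lm by measurable
  have Bi: "integrable M (\<lambda>x. (B n x)\<^sup>2)" for n
    unfolding B_def by (intro integrable_square_diff Ym Yi li') (use lm in measurable)
  let ?b = "\<lambda>n. real n * (\<integral>x. (B n x)\<^sup>2 \<partial>M)"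
  let ?m = "\<integral>x. (l x)\<^sup>2 \<partial>M"
  have Bl: "integrable M (\<lambda>x. \<bar>B n x\<bar> * \<bar>l x\<bar>)" for n
    using integrable_mult_square[OF Bm lm Bi li, of n] by (auto simp: abs_mult[symmetric])
  have CS: "sqrt n * (\<integral>x. \<bar>B n x\<bar> * \<bar>l x\<bar> \<partial>M) \<le> sqrt (?b n * ?m)" for n
  proof -
    have "(\<integral>x. \<bar>B n x\<bar> * \<bar>l x\<bar> \<partial>M)\<^sup>2 \<le> (\<integral>x. (B n x)\<^sup>2 \<partial>M) * ?m"
      using integral_Cauchy_Schwarz[of "\<lambda>x. \<bar>B n x\<bar>" M "\<lambda>x. \<bar>l x\<bar>"] Bm lm Bi li by simp
    then have "(\<integral>x. \<bar>B n x\<bar> * \<bar>l x\<bar> \<partial>M) \<le> sqrt ((\<integral>x. (B n x)\<^sup>2 \<partial>M) * ?m)"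
      by (rule real_le_rsqrt)
    then have "sqrt n * (\<integral>x. \<bar>B n x\<bar> * \<bar>l x\<bar> \<partial>M) \<le> sqrt n * sqrt ((\<integral>x. (B n x)\<^sup>2 \<partial>M) * ?m)"
      by (intro mult_left_mono) auto
    then show ?thesis
      by (simp add: real_sqrt_mult[symmetric] mult.assoc)
  qed
  show ?thesis
  proof (rule tendsto_sandwich[OF _ _ tendsto_const])
    have "(\<lambda>n. ?b n + 2 * sqrt (?b n * ?m)) \<longlonglongrightarrow> 0 + 2 * sqrt (0 * ?m)"
      by (intro tendsto_intros lim[folded B_def])
    then show "(\<lambda>n. ?b n + 2 * sqrt (?b n * ?m)) \<longlonglongrightarrow> 0"
      by simp
    show "\<forall>\<^sub>F n in sequentially. real n * (\<integral>x. \<bar>(Y n x)\<^sup>2 - (l x)\<^sup>2 / n\<bar> \<partial>M) \<le> ?b n + 2 * sqrt (?b n * ?m)"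
    proof (rule eventually_mono[OF eventually_gt_at_top[of 0]])
      fix n :: nat assume n: "n > 0"
      have "\<bar>(Y n x)\<^sup>2 - (l x)\<^sup>2 / n\<bar> \<le> (B n x)\<^sup>2 + 2 / sqrt n * (\<bar>B n x\<bar> * \<bar>l x\<bar>)" for x
      proof -
        have "(Y n x)\<^sup>2 - (l x)\<^sup>2 / n = (B n x)\<^sup>2 + 2 * (B n x * (l x / sqrt n))"
          unfolding B_def by (simp add: power2_eq_square algebra_simps)
        also have "\<bar>\<dots>\<bar> \<le> (B n x)\<^sup>2 + 2 * \<bar>B n x * (l x / sqrt n)\<bar>"
          by (intro order_trans[OF abs_triangle_ineq]) (simp add: abs_mult)
        finally show ?thesis
          by (simp add: abs_mult)
      qed
      then have "(\<integral>x. \<bar>(Y n x)\<^sup>2 - (l x)\<^sup>2 / n\<bar> \<partial>M) \<le> (\<integral>x. (B n x)\<^sup>2 + 2 / sqrt n * (\<bar>B n x\<bar> * \<bar>l x\<bar>) \<partial>M)"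
        using Yi li Bi Bl by (intro integral_mono) auto
      also have "\<dots> = (\<integral>x. (B n x)\<^sup>2 \<partial>M) + 2 / sqrt n * (\<integral>x. \<bar>B n x\<bar> * \<bar>l x\<bar> \<partial>M)"
        using Bi Bl by simp
      finally have "real n * (\<integral>x. \<bar>(Y n x)\<^sup>2 - (l x)\<^sup>2 / n\<bar> \<partial>M)
          \<le> real n * ((\<integral>x. (B n x)\<^sup>2 \<partial>M) + 2 / sqrt n * (\<integral>x. \<bar>B n x\<bar> * \<bar>l x\<bar> \<partial>M))"
        by (intro mult_left_mono) auto
      also have "\<dots> = ?b n + 2 * (real n / sqrt n) * (\<integral>x. \<bar>B n x\<bar> * \<bar>l x\<bar> \<partial>M)"
        by (simp add: algebra_simps)
      also have "real n / sqrt n = sqrt n"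
        by (rule real_div_sqrt) simp
      also have "?b n + 2 * sqrt n * (\<integral>x. \<bar>B n x\<bar> * \<bar>l x\<bar> \<partial>M) \<le> ?b n + 2 * sqrt (?b n * ?m)"
        using CS[of n] by simp
      finally show "real n * (\<integral>x. \<bar>(Y n x)\<^sup>2 - (l x)\<^sup>2 / n\<bar> \<partial>M) \<le> ?b n + 2 * sqrt (?b n * ?m)" .
    qed
  qed auto
qed

text \<open>No single summand matters. If \<open>|Y| > \<delta>\<close> then either \<open>|Y - l / \<surd>n| > \<delta>/2\<close> or \<open>|l| > \<surd>n \<delta>/2\<close>;
the second event has probability \<open>o(1/n)\<close> because \<open>l\<^sup>2\<close> is integrable, by dominated convergence applied
to the truncated second moment \<open>T\<close>.\<close>

lemma triangular_array_maximum:
  fixes Y :: "nat \<Rightarrow> 'a \<Rightarrow> real" and l :: "'a \<Rightarrow> real" and \<delta> :: real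
  assumes Ym[measurable]: "\<And>n. Y n \<in> borel_measurable M" and Yi: "\<And>n. integrable M (\<lambda>x. (Y n x)\<^sup>2)"
    and lm[measurable]: "l \<in> borel_measurable M" and li: "integrable M (\<lambda>x. (l x)\<^sup>2)"
    and lim: "(\<lambda>n. real n * (\<integral>x. (Y n x - l x / sqrt n)\<^sup>2 \<partial>M)) \<longlonglongrightarrow> 0"
    and \<delta>: "\<delta> > 0"
  shows "(\<lambda>n. measure (iid n) {x\<in>space (iid n). \<exists>i<n. \<bar>Y n (x i)\<bar> > \<delta>}) \<longlonglongrightarrow> 0"
proof -
  define B where "B n x = Y n x - l x / sqrt n" for n x
  have [measurable]: "B n \<in> borel_measurable M" for n
    unfolding B_def by measurable
  have li': "integrable M (\<lambda>x. (l x / sqrt (real n))\<^sup>2)" for n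
    using li by (simp add: power_divide)
  have Bi: "integrable M (\<lambda>x. (B n x)\<^sup>2)" for n
    unfolding B_def by (intro integrable_square_diff Ym Yi li') measurable
  define T where "T n x = (if \<bar>l x\<bar> > sqrt n * \<delta> / 2 then (l x)\<^sup>2 else 0)" for n :: nat and x
  have [measurable]: "T n \<in> borel_measurable M" for n
    unfolding T_def by measurable
  have Ti: "integrable M (T n)" for n
    by (rule Bochner_Integration.integrable_bound[OF li]) (auto simp: T_def)
  have T0: "(\<lambda>n. \<integral>x. T n x \<partial>M) \<longlonglongrightarrow> (\<integral>x. 0 \<partial>M)"
  proof (rule integral_dominated_convergence[OF _ _ li])
    show "AE x in M. (\<lambda>n. T n x) \<longlonglongrightarrow> 0"
    proof (intro AE_I2 tendsto_eventually)
      fix x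
      have "filterlim (\<lambda>n. sqrt (real n) * (\<delta> / 2)) at_top sequentially"
        using \<delta> by (intro filterlim_at_top_mult_tendsto_pos[OF tendsto_const]
            filterlim_compose[OF sqrt_at_top] filterlim_real_sequentially) auto
      then have "\<forall>\<^sub>F n in sequentially. \<bar>l x\<bar> \<le> sqrt (real n) * (\<delta> / 2)"
        unfolding filterlim_at_top by blast
      then show "\<forall>\<^sub>F n in sequentially. T n x = 0"
        by eventually_elim (simp add: T_def)
    qed
  qed (auto simp: T_def)
  show ?thesis
  proof (rule tendsto_sandwich[OF _ _ tendsto_const])
    have "(\<lambda>n. 4 / \<delta>\<^sup>2 * (real n * (\<integral>x. (B n x)\<^sup>2 \<partial>M)) + 4 / \<delta>\<^sup>2 * (\<integral>x. T n x \<partial>M))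
        \<longlonglongrightarrow> 4 / \<delta>\<^sup>2 * 0 + 4 / \<delta>\<^sup>2 * (\<integral>x. 0 \<partial>M)"
      by (intro tendsto_add tendsto_mult_left lim[folded B_def] T0)
    then show "(\<lambda>n. 4 / \<delta>\<^sup>2 * (real n * (\<integral>x. (B n x)\<^sup>2 \<partial>M)) + 4 / \<delta>\<^sup>2 * (\<integral>x. T n x \<partial>M)) \<longlonglongrightarrow> 0"
      by simp
    show "\<forall>\<^sub>F n in sequentially. measure (iid n) {x\<in>space (iid n). \<exists>i<n. \<bar>Y n (x i)\<bar> > \<delta>}
        \<le> 4 / \<delta>\<^sup>2 * (real n * (\<integral>x. (B n x)\<^sup>2 \<partial>M)) + 4 / \<delta>\<^sup>2 * (\<integral>x. T n x \<partial>M)"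
    proof (rule eventually_mono[OF eventually_gt_at_top[of 0]])
      fix n :: nat assume n: "n > 0"
      interpret n: prob_space "iid n" by (rule prob_space_iid)
      let ?g = "\<lambda>y. 4 / \<delta>\<^sup>2 * ((B n y)\<^sup>2 + T n y / n)"
      have g0: "0 \<le> ?g y" for y by (auto simp: T_def)
      have gi: "integrable M ?g"
        using Bi Ti by auto
      have ge1: "1 \<le> ?g y" if y: "\<bar>Y n y\<bar> > \<delta>" for y
      proof (cases "\<bar>B n y\<bar> > \<delta> / 2")
        case True
        then have "(\<delta> / 2)\<^sup>2 \<le> (B n y)\<^sup>2"
          using \<delta> by (simp add: abs_le_square_iff[symmetric])
        also have "\<dots> \<le> (B n y)\<^sup>2 + T n y / n" by (simp add: T_def)
        finally show ?thesis using \<delta> by (simp add: field_simps power2_eq_square)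
      next
        case False
        have "\<bar>Y n y\<bar> \<le> \<bar>B n y\<bar> + \<bar>l y / sqrt n\<bar>"
          unfolding B_def using abs_triangle_ineq[of "Y n y - l y / sqrt n" "l y / sqrt n"] by simp
        then have "\<bar>l y / sqrt n\<bar> > \<delta> / 2"
          using y False by linarith
        then have l: "\<bar>l y\<bar> > sqrt n * \<delta> / 2"
          using n by (simp add: field_simps)
        have "(sqrt n * \<delta> / 2)\<^sup>2 \<le> (l y)\<^sup>2"
          using l \<delta> by (subst abs_le_square_iff[symmetric]) auto
        then have "\<delta>\<^sup>2 / 4 \<le> (l y)\<^sup>2 / n"
          using n by (simp add: field_simps power_mult_distrib)
        also have "\<dots> \<le> (B n y)\<^sup>2 + T n y / n"
          using l by (simp add: T_def)
        finally show ?thesis using \<delta> by (simp add: field_simps)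
      qed
      have "measure (iid n) {x\<in>space (iid n). \<exists>i<n. \<bar>Y n (x i)\<bar> > \<delta>}
          \<le> measure (iid n) {x\<in>space (iid n). (\<Sum>i<n. ?g (x i)) \<ge> 1}"
      proof (intro n.finite_measure_mono)
        show "{x\<in>space (iid n). \<exists>i<n. \<bar>Y n (x i)\<bar> > \<delta>} \<subseteq> {x\<in>space (iid n). (\<Sum>i<n. ?g (x i)) \<ge> 1}"
        proof safe
          fix x i assume i: "i < n" "\<bar>Y n (x i)\<bar> > \<delta>"
          have "1 \<le> ?g (x i)" by (rule ge1[OF i(2)])
          also have "\<dots> \<le> (\<Sum>i<n. ?g (x i))"
            using i g0 by (intro member_le_sum) auto
          finally show "1 \<le> (\<Sum>i<n. ?g (x i))" .
        qed
      qed measurable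
      also have "\<dots> \<le> (\<integral>x. (\<Sum>i<n. ?g (x i)) \<partial>iid n) / 1"
      proof (intro integral_Markov_inequality_measure[where A="{}"] iid_sum_integral(1)[OF gi])
        show "AE x in iid n. 0 \<le> (\<Sum>i<n. ?g (x i))"
          by (intro AE_I2 sum_nonneg g0)
      qed auto
      also have "\<dots> = real n * (\<integral>x. ?g x \<partial>M)"
        by (simp only: iid_sum_integral(2)[OF gi] div_by_1)
      also have "(\<integral>x. ?g x \<partial>M) = 4 / \<delta>\<^sup>2 * ((\<integral>x. (B n x)\<^sup>2 \<partial>M) + (\<integral>x. T n x \<partial>M) / n)"
        using Bi Ti by simp
      also have "real n * \<dots> = 4 / \<delta>\<^sup>2 * (real n * (\<integral>x. (B n x)\<^sup>2 \<partial>M)) + 4 / \<delta>\<^sup>2 * (\<integral>x. T n x \<partial>M)"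
        using n by (simp add: algebra_simps)
      finally show "measure (iid n) {x\<in>space (iid n). \<exists>i<n. \<bar>Y n (x i)\<bar> > \<delta>}
        \<le> 4 / \<delta>\<^sup>2 * (real n * (\<integral>x. (B n x)\<^sup>2 \<partial>M)) + 4 / \<delta>\<^sup>2 * (\<integral>x. T n x \<partial>M)" .
    qed
  qed auto
qed


text \<open>Le Cam's expansion of the log likelihood. For \<open>Y = \<surd>L - 1\<close> the sum of \<open>Y\<close> is, up to its mean, the
normalised sum of \<open>l\<close>; its mean tends to \<open>- \<integral> l\<^sup>2 / 2\<close> because \<open>2 \<integral> Y = \<integral> L - 1 - \<integral> Y\<^sup>2\<close> and
\<open>n (1 - \<integral> L)\<close>, the singular mass, is negligible. The sum of \<open>Y\<^sup>2\<close> tends to \<open>\<integral> l\<^sup>2\<close>. The second order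
expansion of \<open>2 ln (1 + Y)\<close> then produces the constant \<open>- 2 \<integral> l\<^sup>2\<close>. The set where some factor vanishes is
included in the exceptional event, so that logarithms are only taken of positive numbers outside of it.\<close>

theorem lan_of_differentiability_in_mean:
  fixes L :: "nat \<Rightarrow> 'a \<Rightarrow> real" and l :: "'a \<Rightarrow> real"
  assumes Lm[measurable]: "\<And>n. L n \<in> borel_measurable M" and L0: "\<And>n x. 0 \<le> L n x"
    and Li: "\<And>n. integrable M (L n)"
    and lm[measurable]: "l \<in> borel_measurable M" and li: "integrable M (\<lambda>x. (l x)\<^sup>2)"
    and l0: "(\<integral>x. l x \<partial>M) = 0"
    and dqm: "(\<lambda>n. real n * (\<integral>x. (sqrt (L n x) - 1 - l x / sqrt n)\<^sup>2 \<partial>M)) \<longlonglongrightarrow> 0"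
    and mass: "(\<lambda>n. real n * (1 - (\<integral>x. L n x \<partial>M))) \<longlonglongrightarrow> 0"
    and \<epsilon>: "\<epsilon> > 0"
  shows "(\<lambda>n. measure (iid n) {x\<in>space (iid n). (\<exists>i<n. L n (x i) = 0) \<or>
      \<bar>(\<Sum>i<n. ln (L n (x i))) - 2 / sqrt n * (\<Sum>i<n. l (x i)) + 2 * (\<integral>x. (l x)\<^sup>2 \<partial>M)\<bar> > \<epsilon>}) \<longlonglongrightarrow> 0"
proof -
  define Y where "Y n x = sqrt (L n x) - 1" for n x
  have Ym[measurable]: "Y n \<in> borel_measurable M" for n
    unfolding Y_def by measurable
  have sqi: "integrable M (\<lambda>x. sqrt (L n x))" for n
    using integrable_of_square[of "\<lambda>x. sqrt (L n x)"] L0 Li by simp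
  have Yi: "integrable M (\<lambda>x. (Y n x)\<^sup>2)" for n
    unfolding Y_def using L0 Li by (intro integrable_square_diff) auto
  define \<mu> where "\<mu> = (\<integral>x. (l x)\<^sup>2 \<partial>M)"
  define B where "B n x = Y n x - l x / sqrt n" for n x
  have dqm': "(\<lambda>n. real n * (\<integral>x. (Y n x - l x / sqrt n)\<^sup>2 \<partial>M)) \<longlonglongrightarrow> 0"
    using dqm by (simp add: Y_def)
  note li1 = integrable_of_square[OF lm li]
  have li': "integrable M (\<lambda>x. (l x / sqrt (real n))\<^sup>2)" for n
    using li by (simp add: power_divide)
  have [measurable]: "B n \<in> borel_measurable M" for n
    unfolding B_def by measurable
  have Bi: "integrable M (\<lambda>x. (B n x)\<^sup>2)" for n
    unfolding B_def by (intro integrable_square_diff Ym Yi li') measurable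
  have Yi1: "integrable M (Y n)" for n
    by (rule integrable_of_square[OF Ym Yi])
  have EB: "(\<integral>x. B n x \<partial>M) = (\<integral>x. Y n x \<partial>M)" for n
    unfolding B_def using Yi1 li1 l0 by simp
  note sq = triangular_array_squares[OF Ym Yi lm li dqm']
  have D2i: "integrable M (\<lambda>x. (Y n x)\<^sup>2 - (l x)\<^sup>2 / n)" for n
    using Yi li by auto
  have EY2: "(\<lambda>n. real n * (\<integral>x. (Y n x)\<^sup>2 \<partial>M)) \<longlonglongrightarrow> \<mu>"
  proof (rule LIM_zero_cancel, rule Lim_null_comparison[OF _ sq])
    show "\<forall>\<^sub>F n in sequentially. norm (real n * (\<integral>x. (Y n x)\<^sup>2 \<partial>M) - \<mu>)
        \<le> real n * (\<integral>x. \<bar>(Y n x)\<^sup>2 - (l x)\<^sup>2 / n\<bar> \<partial>M)"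
    proof (rule eventually_mono[OF eventually_gt_at_top[of 0]])
      fix n :: nat assume n: "n > 0"
      have "real n * (\<integral>x. (Y n x)\<^sup>2 \<partial>M) - \<mu> = real n * (\<integral>x. (Y n x)\<^sup>2 - (l x)\<^sup>2 / n \<partial>M)"
        using n Yi li by (simp add: \<mu>_def algebra_simps)
      then show "norm (real n * (\<integral>x. (Y n x)\<^sup>2 \<partial>M) - \<mu>)
        \<le> real n * (\<integral>x. \<bar>(Y n x)\<^sup>2 - (l x)\<^sup>2 / n\<bar> \<partial>M)"
        using integral_abs_bound[of M "\<lambda>x. (Y n x)\<^sup>2 - (l x)\<^sup>2 / n"]
        by (simp add: abs_mult mult_left_mono)
    qed
  qed
  have EY: "(\<lambda>n. real n * (\<integral>x. Y n x \<partial>M) + \<mu> / 2) \<longlonglongrightarrow> 0"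
  proof -
    have "2 * (\<integral>x. Y n x \<partial>M) = - (1 - (\<integral>x. L n x \<partial>M)) - (\<integral>x. (Y n x)\<^sup>2 \<partial>M)" for n
    proof -
      have "(\<lambda>x. (Y n x)\<^sup>2) = (\<lambda>x. L n x - 1 - 2 * Y n x)"
        unfolding Y_def using L0 by (auto simp: power2_eq_square algebra_simps fun_eq_iff)
      then have "(\<integral>x. (Y n x)\<^sup>2 \<partial>M) = (\<integral>x. L n x \<partial>M) - 1 - 2 * (\<integral>x. Y n x \<partial>M)"
        using Li Yi1 by (simp add: prob_space)
      then show ?thesis by simp
    qed
    then have "real n * (\<integral>x. Y n x \<partial>M) + \<mu> / 2 =
        - (real n * (1 - (\<integral>x. L n x \<partial>M))) / 2 - (real n * (\<integral>x. (Y n x)\<^sup>2 \<partial>M)) / 2 + \<mu> / 2" for n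
    proof -
      have "(\<integral>x. Y n x \<partial>M) = - (1 - (\<integral>x. L n x \<partial>M)) / 2 - (\<integral>x. (Y n x)\<^sup>2 \<partial>M) / 2"
      proof -
        have "y = - (1 - a) / 2 - b / 2" if "2 * y = - (1 - a) - b" for y a b :: real
          using that by (simp add: field_simps)
        then show ?thesis
          using \<open>\<And>n. 2 * (\<integral>x. Y n x \<partial>M) = - (1 - (\<integral>x. L n x \<partial>M)) - (\<integral>x. (Y n x)\<^sup>2 \<partial>M)\<close>[of n] by blast
      qed
      then show ?thesis by (simp only:) (simp add: algebra_simps)
    qed
    moreover have "(\<lambda>n. - (real n * (1 - (\<integral>x. L n x \<partial>M))) / 2 - (real n * (\<integral>x. (Y n x)\<^sup>2 \<partial>M)) / 2 + \<mu> / 2)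
        \<longlonglongrightarrow> - 0 / 2 - \<mu> / 2 + \<mu> / 2"
      by (intro tendsto_intros mass EY2) auto
    ultimately show ?thesis by simp
  qed
  define S1 where "S1 n x = (\<Sum>i<n. Y n (x i)) - 1 / sqrt n * (\<Sum>i<n. l (x i)) + \<mu> / 2" for n x
  define S2 where "S2 n x = (\<Sum>i<n. (Y n (x i))\<^sup>2) - (if n = 0 then 0 else \<mu>)" for n x
  have S1m[measurable]: "S1 n \<in> borel_measurable (iid n)" for n
    unfolding S1_def by measurable
  have S2m[measurable]: "S2 n \<in> borel_measurable (iid n)" for n
    unfolding S2_def by measurable
  have S1: "vanishes_in_prob iid S1"
  proof -
    have "vanishes_in_prob iid (\<lambda>n x. (\<Sum>i<n. B n (x i)) - n * (\<integral>x. B n x \<partial>M))"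
      by (rule iid_centred_sum_vanishes) (use Bi dqm'[folded B_def] in auto)
    then have "vanishes_in_prob iid (\<lambda>n x. ((\<Sum>i<n. B n (x i)) - n * (\<integral>x. B n x \<partial>M)) +
        (real n * (\<integral>x. Y n x \<partial>M) + \<mu> / 2))"
      by (intro vanishes_in_prob_add vanishes_in_prob_const[OF EY] prob_space_iid) measurable
    moreover have "((\<Sum>i<n. B n (x i)) - n * (\<integral>x. B n x \<partial>M)) + (real n * (\<integral>x. Y n x \<partial>M) + \<mu> / 2) = S1 n x" for n x
      unfolding EB S1_def by (simp add: B_def sum_subtractf sum_divide_distrib)
    ultimately show ?thesis by (simp only:)
  qed
  have S2: "vanishes_in_prob iid S2"
  proof -
    have "vanishes_in_prob iid (\<lambda>n x. \<Sum>i<n. (Y n (x i))\<^sup>2 - (l (x i))\<^sup>2 / n)"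
    proof (rule vanishes_in_prob_L1[OF prob_space_iid iid_sum_integral(1)[OF D2i]])
      show "(\<lambda>n. \<integral>x. \<bar>\<Sum>i<n. (Y n (x i))\<^sup>2 - (l (x i))\<^sup>2 / n\<bar> \<partial>iid n) \<longlonglongrightarrow> 0"
        by (rule tendsto_sandwich[OF _ _ tendsto_const sq])
          (auto intro!: always_eventually iid_sum_abs_integral_le[OF D2i])
    qed
    moreover have "vanishes_in_prob iid (\<lambda>n x. (\<Sum>i<n. (l (x i))\<^sup>2) / n - (if n = 0 then 0 else \<mu>))"
    proof -
      have "vanishes_in_prob iid (\<lambda>n x. ((\<Sum>i<n. (l (x i))\<^sup>2) / n - \<mu>) + (if n = 0 then \<mu> else 0))"
        unfolding \<mu>_def
        by (intro vanishes_in_prob_add weak_law_of_large_numbers li prob_space_iid vanishes_in_prob_const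
             tendsto_eventually eventually_mono[OF eventually_gt_at_top[of 0]]) auto
      moreover have "((\<Sum>i<n. (l (x i))\<^sup>2) / n - \<mu>) + (if n = 0 then \<mu> else 0) =
          (\<Sum>i<n. (l (x i))\<^sup>2) / n - (if n = 0 then 0 else \<mu>)" for n :: nat and x
        by simp
      ultimately show ?thesis by (simp only:)
    qed
    ultimately have "vanishes_in_prob iid (\<lambda>n x. (\<Sum>i<n. (Y n (x i))\<^sup>2 - (l (x i))\<^sup>2 / n) +
        ((\<Sum>i<n. (l (x i))\<^sup>2) / n - (if n = 0 then 0 else \<mu>)))"
      by (intro vanishes_in_prob_add prob_space_iid) measurable
    moreover have "(\<Sum>i<n. (Y n (x i))\<^sup>2 - (l (x i))\<^sup>2 / n) + ((\<Sum>i<n. (l (x i))\<^sup>2) / n - (if n = 0 then 0 else \<mu>)) = S2 n x" for n x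
      unfolding S2_def by (simp add: sum_subtractf sum_divide_distrib)
    ultimately show ?thesis by (simp only:)
  qed
  define S where "S n x = 2 * S1 n x + (- 1) * S2 n x" for n x
  have Sm[measurable]: "S n \<in> borel_measurable (iid n)" for n
    unfolding S_def by measurable
  have SV: "vanishes_in_prob iid S"
    unfolding S_def by (intro vanishes_in_prob_add vanishes_in_prob_cmult S1 S2 prob_space_iid) measurable
  have \<mu>0: "\<mu> \<ge> 0" by (simp add: \<mu>_def)
  \<comment> \<open>Chosen so that the cubic remainder \<open>4 \<delta> \<Sum> Y\<^sup>2\<close> stays below \<open>\<epsilon> / 2\<close> whenever \<open>\<Sum> Y\<^sup>2 \<le> \<mu> + 1\<close>.\<close>
  define \<delta> where "\<delta> = min (1 / 2) (\<epsilon> / (8 * (\<mu> + 1)))"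
  have \<delta>: "\<delta> > 0" "\<delta> \<le> 1 / 2" "\<delta> * (8 * (\<mu> + 1)) \<le> \<epsilon>"
  proof -
    have p: "8 * (\<mu> + 1) > 0" using \<mu>0 by simp
    then show "\<delta> > 0"
      using \<epsilon> by (simp add: \<delta>_def)
    show "\<delta> \<le> 1 / 2"
      unfolding \<delta>_def by (rule min.cobounded1)
    have "\<delta> \<le> \<epsilon> / (8 * (\<mu> + 1))"
      unfolding \<delta>_def by (rule min.cobounded2)
    then show "\<delta> * (8 * (\<mu> + 1)) \<le> \<epsilon>"
      using p by (simp only: pos_le_divide_eq)
  qed
  let ?A = "\<lambda>n. {x\<in>space (iid n). \<exists>i<n. \<bar>Y n (x i)\<bar> > \<delta>}"
  let ?B = "\<lambda>n. {x\<in>space (iid n). \<bar>S n x\<bar> > \<epsilon> / 2}"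
  let ?C = "\<lambda>n. {x\<in>space (iid n). \<bar>S2 n x\<bar> > 1}"
  let ?R = "\<lambda>n x. (\<Sum>i<n. ln (L n (x i))) - 2 / sqrt n * (\<Sum>i<n. l (x i)) + 2 * \<mu>"
  let ?E = "\<lambda>n. {x\<in>space (iid n). (\<exists>i<n. L n (x i) = 0) \<or> \<bar>?R n x\<bar> > \<epsilon>}"
  have sub: "?E n \<subseteq> ?A n \<union> ?B n \<union> ?C n" if n: "n > 0" for n
  proof (rule ccontr)
    assume "\<not> ?E n \<subseteq> ?A n \<union> ?B n \<union> ?C n"
    then obtain x where xE: "x \<in> ?E n" and xn: "x \<notin> ?A n" "x \<notin> ?B n" "x \<notin> ?C n"
      by blast
    have "x \<in> space (iid n)"
      using xE by blast
    with xn have x: "x \<in> ?E n" "\<And>i. i < n \<Longrightarrow> \<bar>Y n (x i)\<bar> \<le> \<delta>" "\<bar>S n x\<bar> \<le> \<epsilon> / 2" "\<bar>S2 n x\<bar> \<le> 1"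
      using xE unfolding mem_Collect_eq not_less[symmetric] by blast+
    have Y1: "\<bar>Y n (x i)\<bar> \<le> 1 / 2" if "i < n" for i
      using x(2)[OF that] \<delta>(2) by simp
    have pos: "1 + Y n (x i) > 0" if "i < n" for i
      using Y1[OF that] by (simp add: abs_le_iff)
    have Leq: "L n (x i) = (1 + Y n (x i))\<^sup>2" for i
      using L0 by (simp add: Y_def)
    have lnL: "ln (L n (x i)) = 2 * ln (1 + Y n (x i))" if "i < n" for i
      unfolding Leq using pos[OF that] by (simp add: ln_realpow)
    define e where "e i = ln (1 + Y n (x i)) - (Y n (x i) - (Y n (x i))\<^sup>2 / 2)" for i
    have e: "\<bar>e i\<bar> \<le> 2 * \<delta> * (Y n (x i))\<^sup>2" if "i < n" for i
    proof -
      have "\<bar>e i\<bar> \<le> 2 * \<bar>Y n (x i)\<bar> * (Y n (x i))\<^sup>2"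
        unfolding e_def by (rule ln_1_plus_quadratic_bound[OF Y1[OF that]])
      also have "\<dots> \<le> 2 * \<delta> * (Y n (x i))\<^sup>2"
        using x(2)[OF that] by (intro mult_right_mono) auto
      finally show ?thesis .
    qed
    have "(\<Sum>i<n. ln (L n (x i))) = (\<Sum>i<n. 2 * Y n (x i) - (Y n (x i))\<^sup>2 + 2 * e i)"
      by (intro sum.cong refl) (simp add: lnL e_def)
    also have "\<dots> = 2 * (\<Sum>i<n. Y n (x i)) - (\<Sum>i<n. (Y n (x i))\<^sup>2) + 2 * (\<Sum>i<n. e i)"
      by (simp add: sum.distrib sum_subtractf sum_distrib_left)
    finally have R: "?R n x = S n x + 2 * (\<Sum>i<n. e i)"
      using n by (simp add: S_def S1_def S2_def)
    have "\<bar>\<Sum>i<n. e i\<bar> \<le> (\<Sum>i<n. \<bar>e i\<bar>)"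
      by (rule sum_abs)
    also have "\<dots> \<le> (\<Sum>i<n. 2 * \<delta> * (Y n (x i))\<^sup>2)"
      by (intro sum_mono e) simp
    also have "\<dots> = 2 * \<delta> * (\<Sum>i<n. (Y n (x i))\<^sup>2)"
      by (simp add: sum_distrib_left)
    also have "\<dots> \<le> 2 * \<delta> * (\<mu> + 1)"
      using x(4) n \<delta>(1) by (intro mult_left_mono) (auto simp: S2_def abs_le_iff)
    finally have "\<bar>2 * (\<Sum>i<n. e i)\<bar> \<le> 2 * (2 * \<delta> * (\<mu> + 1))"
      unfolding abs_mult by simp
    also have "\<dots> = \<delta> * (8 * (\<mu> + 1)) / 2"
      by simp
    finally have "\<bar>2 * (\<Sum>i<n. e i)\<bar> \<le> \<delta> * (8 * (\<mu> + 1)) / 2" .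
    then have "\<bar>?R n x\<bar> \<le> \<epsilon>"
      unfolding R using x(3) \<delta>(3) by linarith
    moreover have "L n (x i) \<noteq> 0" if "i < n" for i
      unfolding Leq using pos[OF that] by simp
    ultimately show False
      using x(1) by auto
  qed
  show ?thesis
    unfolding \<mu>_def[symmetric]
  proof (rule tendsto_sandwich[OF _ _ tendsto_const])
    have A: "(\<lambda>n. measure (iid n) (?A n)) \<longlonglongrightarrow> 0"
      by (rule triangular_array_maximum[OF Ym Yi lm li dqm' \<delta>(1)])
    have "(\<lambda>n. measure (iid n) (?A n) + measure (iid n) (?B n) + measure (iid n) (?C n)) \<longlonglongrightarrow> 0 + 0 + 0"
      using \<epsilon> by (intro tendsto_add A vanishes_in_probD[OF SV] vanishes_in_probD[OF S2]) auto
    then show "(\<lambda>n. measure (iid n) (?A n) + measure (iid n) (?B n) + measure (iid n) (?C n)) \<longlonglongrightarrow> 0"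
      by simp
    show "\<forall>\<^sub>F n in sequentially. measure (iid n) (?E n)
        \<le> measure (iid n) (?A n) + measure (iid n) (?B n) + measure (iid n) (?C n)"
    proof (rule eventually_mono[OF eventually_gt_at_top[of 0]])
      fix n :: nat assume n: "n > 0"
      interpret n: prob_space "iid n" by (rule prob_space_iid)
      have ms: "?A n \<in> sets (iid n)" "?B n \<in> sets (iid n)" "?C n \<in> sets (iid n)"
        by measurable
      have "measure (iid n) (?E n) \<le> measure (iid n) (?A n \<union> ?B n \<union> ?C n)"
        using ms by (intro n.finite_measure_mono sub n) auto
      also have "\<dots> \<le> measure (iid n) (?A n \<union> ?B n) + measure (iid n) (?C n)"
        using ms by (intro measure_Un_le) auto
      also have "measure (iid n) (?A n \<union> ?B n) \<le> measure (iid n) (?A n) + measure (iid n) (?B n)"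
        using ms by (intro measure_Un_le) auto
      finally show "measure (iid n) (?E n)
        \<le> measure (iid n) (?A n) + measure (iid n) (?B n) + measure (iid n) (?C n)"
        by simp
    qed
  qed auto
qed

end

section \<open>Scaling as a differentiable curve of root densities\<close>

text \<open>Convergence of norms together with convergence almost everywhere gives convergence in \<open>L\<^sub>2\<close>: Fatou's lemma
bounds \<open>\<integral> (a\<^sub>n + b)\<^sup>2\<close> from below by \<open>4 \<integral> b\<^sup>2\<close>, and the parallelogram identity leaves nothing for
\<open>\<integral> (a\<^sub>n - b)\<^sup>2\<close>. Where \<open>b = 0\<close> the bound \<open>(a\<^sub>n + b)\<^sup>2 \<ge> 0 = 4 b\<^sup>2\<close> is trivial, so pointwise convergence is
required only where \<open>b \<noteq> 0\<close>.\<close>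

lemma L2_convergence_from_norm_bound:
  fixes a :: "nat \<Rightarrow> 'a \<Rightarrow> real" and b :: "'a \<Rightarrow> real" and c :: "nat \<Rightarrow> real"
  assumes [measurable]: "\<And>n. a n \<in> borel_measurable M" "b \<in> borel_measurable M"
    and b: "integrable M (\<lambda>x. (b x)\<^sup>2)"
    and bound: "\<And>n. (\<integral>\<^sup>+x. ennreal ((a n x)\<^sup>2) \<partial>M) \<le> ennreal (c n * (\<integral>x. (b x)\<^sup>2 \<partial>M))"
    and c: "c \<longlonglongrightarrow> 1"
    and lim: "AE x in M. b x \<noteq> 0 \<longrightarrow> (\<lambda>n. a n x) \<longlonglongrightarrow> b x"
  shows "(\<lambda>n. \<integral>x. (a n x - b x)\<^sup>2 \<partial>M) \<longlonglongrightarrow> 0"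
    and "\<And>n. integrable M (\<lambda>x. (a n x - b x)\<^sup>2)"
proof -
  define N where "N = (\<integral>x. (b x)\<^sup>2 \<partial>M)"
  have N0: "N \<ge> 0" by (simp add: N_def)
  have ai: "integrable M (\<lambda>x. (a n x)\<^sup>2)" for n
    using bound[of n] by (intro integrableI_bounded) (auto intro: le_less_trans)
  have aN: "(\<integral>x. (a n x)\<^sup>2 \<partial>M) \<le> max 0 (c n) * N" for n
  proof -
    have "ennreal (\<integral>x. (a n x)\<^sup>2 \<partial>M) \<le> ennreal (c n * N)"
      using bound[of n] nn_integral_eq_integral[OF ai[of n]] by (simp add: N_def)
    also have "\<dots> \<le> ennreal (max 0 (c n) * N)"
      using N0 by (intro ennreal_leI mult_right_mono) auto
    finally show ?thesis
      using N0 by (subst (asm) ennreal_le_iff) auto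
  qed
  have plus: "integrable M (\<lambda>x. (a n x + b x)\<^sup>2)" for n
    using integrable_square_add_scaled(1)[of "a n" M b 1] ai b by simp
  show minus: "integrable M (\<lambda>x. (a n x - b x)\<^sup>2)" for n
    using integrable_square_add_scaled(1)[of "a n" M b "- 1"] ai b by simp
  have paral: "(\<integral>x. (a n x - b x)\<^sup>2 \<partial>M) = 2 * (\<integral>x. (a n x)\<^sup>2 \<partial>M) + 2 * N - (\<integral>x. (a n x + b x)\<^sup>2 \<partial>M)" for n
  proof -
    have "(\<integral>x. (a n x - b x)\<^sup>2 \<partial>M) = (\<integral>x. 2 * (a n x)\<^sup>2 + 2 * (b x)\<^sup>2 - (a n x + b x)\<^sup>2 \<partial>M)"
      by (intro Bochner_Integration.integral_cong) (auto simp: power2_eq_square algebra_simps)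
    also have "\<dots> = 2 * (\<integral>x. (a n x)\<^sup>2 \<partial>M) + 2 * N - (\<integral>x. (a n x + b x)\<^sup>2 \<partial>M)"
      using ai b plus by (simp add: N_def)
    finally show ?thesis .
  qed
  have "ennreal (4 * N) = (\<integral>\<^sup>+x. ennreal (4 * (b x)\<^sup>2) \<partial>M)"
    using b by (subst nn_integral_eq_integral) (auto simp: N_def)
  also have "\<dots> \<le> (\<integral>\<^sup>+x. liminf (\<lambda>n. ennreal ((a n x + b x)\<^sup>2)) \<partial>M)"
  proof (rule nn_integral_mono_AE, use lim in eventually_elim)
    case (elim x)
    show "ennreal (4 * (b x)\<^sup>2) \<le> liminf (\<lambda>n. ennreal ((a n x + b x)\<^sup>2))"
    proof (cases "b x = 0")
      case False
      with elim have "(\<lambda>n. ennreal ((a n x + b x)\<^sup>2)) \<longlonglongrightarrow> ennreal ((b x + b x)\<^sup>2)"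
        by (intro tendsto_ennrealI tendsto_intros) auto
      then have "liminf (\<lambda>n. ennreal ((a n x + b x)\<^sup>2)) = ennreal ((b x + b x)\<^sup>2)"
        by (intro lim_imp_Liminf) auto
      also have "(b x + b x)\<^sup>2 = 4 * (b x)\<^sup>2"
        by (simp add: power2_eq_square)
      finally show ?thesis by simp
    qed simp
  qed
  also have "\<dots> \<le> liminf (\<lambda>n. \<integral>\<^sup>+x. ennreal ((a n x + b x)\<^sup>2) \<partial>M)"
    by (rule nn_integral_liminf) measurable
  also have "(\<lambda>n. \<integral>\<^sup>+x. ennreal ((a n x + b x)\<^sup>2) \<partial>M) = (\<lambda>n. ennreal (\<integral>x. (a n x + b x)\<^sup>2 \<partial>M))"
    using plus by (intro ext nn_integral_eq_integral) auto
  finally have fatou: "ennreal (4 * N) \<le> liminf (\<lambda>n. ennreal (\<integral>x. (a n x + b x)\<^sup>2 \<partial>M))" .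
  have low: "\<forall>\<^sub>F n in sequentially. 4 * N - e < (\<integral>x. (a n x + b x)\<^sup>2 \<partial>M)" if "e > 0" for e
  proof (cases "4 * N - e < 0")
    case True
    have "0 \<le> (\<integral>x. (a n x + b x)\<^sup>2 \<partial>M)" for n by simp
    then show ?thesis using True by (intro always_eventually allI) (rule less_le_trans)
  next
    case False
    then have "ennreal (4 * N - e) < ennreal (4 * N)"
      using that by (subst ennreal_less_iff) auto
    then have "ennreal (4 * N - e) < liminf (\<lambda>n. ennreal (\<integral>x. (a n x + b x)\<^sup>2 \<partial>M))"
      using fatou by (rule less_le_trans)
    from less_LiminfD[OF this] show ?thesis
      by eventually_elim (use False in \<open>simp add: ennreal_less_iff\<close>)
  qed
  show "(\<lambda>n. \<integral>x. (a n x - b x)\<^sup>2 \<partial>M) \<longlonglongrightarrow> 0"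
  proof (rule order_tendstoI)
    fix e :: real assume "e < 0"
    moreover have "0 \<le> (\<integral>x. (a n x - b x)\<^sup>2 \<partial>M)" for n by simp
    ultimately show "\<forall>\<^sub>F n in sequentially. e < (\<integral>x. (a n x - b x)\<^sup>2 \<partial>M)"
      by (intro always_eventually allI) (rule less_le_trans)
  next
    fix e :: real assume e: "0 < e"
    have "(\<lambda>n. 2 * (max 0 (c n) * N)) \<longlonglongrightarrow> 2 * (max 0 1 * N)"
      by (intro tendsto_intros c)
    then have "\<forall>\<^sub>F n in sequentially. 2 * (max 0 (c n) * N) < 2 * N + e / 2"
      by (rule order_tendstoD) (use e in simp)
    moreover have "\<forall>\<^sub>F n in sequentially. 4 * N - e / 2 < (\<integral>x. (a n x + b x)\<^sup>2 \<partial>M)"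
      using e by (intro low) simp
    ultimately show "\<forall>\<^sub>F n in sequentially. (\<integral>x. (a n x - b x)\<^sup>2 \<partial>M) < e"
    proof eventually_elim
      case (elim n)
      have arith: "A < e" if "A = 2 * B + 2 * N - C" "B \<le> D" "2 * D < 2 * N + e / 2" "4 * N - e / 2 < C"
        for A B C D :: real
        using that by linarith
      show ?case
        by (rule arith[OF paral[of n] aN[of n]]) (use elim in auto)
    qed
  qed
qed

text \<open>Formally \<open>(\<surd>G)' = k / (2 \<surd>G)\<close>. The square root is regularised to \<open>\<surd>(G + \<epsilon>)\<close>, for which the estimate
holds on short intervals up to a factor \<open>\<eta> > 1\<close>, since \<open>\<surd>(G + \<epsilon>)\<close> is nearly constant there. Short
intervals are glued by bisection, and then \<open>\<epsilon> \<rightarrow> 0\<close> and \<open>\<eta> \<rightarrow> 1\<close>. The convention \<open>0 / 0 = 0\<close> agrees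
with the hypothesis that \<open>k\<close> vanishes where \<open>G\<close> does.\<close>

lemma sqrt_increment_bound:
  fixes G k :: "real \<Rightarrow> real"
  assumes ab: "a \<le> b" and G: "continuous_on {a..b} G" "\<And>x. a \<le> x \<Longrightarrow> x \<le> b \<Longrightarrow> 0 \<le> G x"
    and [measurable]: "G \<in> borel_measurable borel" "k \<in> borel_measurable borel"
    and k: "\<And>u v. a \<le> u \<Longrightarrow> u \<le> v \<Longrightarrow> v \<le> b \<Longrightarrow>
      ennreal \<bar>G v - G u\<bar> \<le> (\<integral>\<^sup>+y. ennreal \<bar>k y\<bar> * indicator {u<..v} y \<partial>lborel)"
    and k0: "\<And>y. a < y \<Longrightarrow> y \<le> b \<Longrightarrow> G y = 0 \<Longrightarrow> k y = 0"
  shows "ennreal \<bar>sqrt (G b) - sqrt (G a)\<bar> \<le>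
    (\<integral>\<^sup>+y. ennreal (\<bar>k y\<bar> / (2 * sqrt (G y))) * indicator {a<..b} y \<partial>lborel)" (is "_ \<le> ?X")
proof -
  have reg: "ennreal \<bar>sqrt (G b + \<epsilon>) - sqrt (G a + \<epsilon>)\<bar> \<le> ennreal \<eta> * ?X" if \<epsilon>: "\<epsilon> > 0" and \<eta>: "\<eta> > 1" for \<epsilon> \<eta>
  proof -
    define H where "H y = sqrt (G y + \<epsilon>)" for y
    have [measurable]: "H \<in> borel_measurable borel" unfolding H_def by measurable
    have Hpos: "H y > 0" if "a \<le> y" "y \<le> b" for y
      using G(2)[OF that] \<epsilon> by (simp add: H_def)
    have Hc: "continuous_on {a..b} H"
      unfolding H_def by (intro continuous_intros G)
    define I where "I u v = (\<integral>\<^sup>+y. ennreal (\<bar>k y\<bar> / (2 * H y)) * indicator {u<..v} y \<partial>lborel)" for u v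
    have Iadd: "I u w = I u v + I v w" if "u \<le> v" "v \<le> w" for u v w
    proof -
      have "I u v + I v w = (\<integral>\<^sup>+y. ennreal (\<bar>k y\<bar> / (2 * H y)) * indicator {u<..v} y +
          ennreal (\<bar>k y\<bar> / (2 * H y)) * indicator {v<..w} y \<partial>lborel)"
        unfolding I_def by (rule nn_integral_add[symmetric]) measurable
      also have "\<dots> = I u w"
        unfolding I_def using that by (intro nn_integral_cong) (auto simp: indicator_def)
      finally show ?thesis by simp
    qed
    define P where "P u v \<longleftrightarrow> (a \<le> u \<longrightarrow> v \<le> b \<longrightarrow> u \<le> v \<longrightarrow> ennreal \<bar>H v - H u\<bar> \<le> ennreal \<eta> * I u v)" for u v
    have "P a b"
      using ab
    proof (induction rule: Bolzano)
      case (trans u v w)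
      show ?case unfolding P_def
      proof (intro impI)
        assume *: "a \<le> u" "w \<le> b" "u \<le> w"
        have "ennreal \<bar>H w - H u\<bar> \<le> ennreal (\<bar>H v - H u\<bar> + \<bar>H w - H v\<bar>)"
          by (intro ennreal_leI) simp
        also have "\<dots> = ennreal \<bar>H v - H u\<bar> + ennreal \<bar>H w - H v\<bar>"
          by (rule ennreal_plus) auto
        also have "\<dots> \<le> ennreal \<eta> * I u v + ennreal \<eta> * I v w"
          using trans * by (intro add_mono) (auto simp: P_def)
        also have "\<dots> = ennreal \<eta> * I u w"
          using trans by (simp add: Iadd[of u v w] distrib_left)
        finally show "ennreal \<bar>H w - H u\<bar> \<le> ennreal \<eta> * I u w" .
      qed
    next
      case (local x)
      \<comment> \<open>The oscillation \<open>e\<close> solves \<open>H x + e = \<eta> (H x - e)\<close>.\<close>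
      define e where "e = H x * ((\<eta> - 1) / (\<eta> + 1))"
      have Hx: "H x > 0" using local by (intro Hpos)
      have e: "e > 0" "H x - e > 0" "H x + e = \<eta> * (H x - e)"
        using Hx \<eta> by (auto simp: e_def field_simps)
      obtain d where d: "d > 0" "\<And>y. y \<in> {a..b} \<Longrightarrow> dist y x < d \<Longrightarrow> dist (H y) (H x) < e"
        using Hc local e(1) unfolding continuous_on_iff by (metis atLeastAtMost_iff)
      show ?case unfolding P_def
      proof (intro exI[of _ d] conjI allI impI)
        show "d > 0" by (rule d)
        fix u v assume 1: "u \<le> x \<and> x \<le> v \<and> v - u < d" and 2: "a \<le> u" "v \<le> b" "u \<le> v"
        have near: "\<bar>H y - H x\<bar> < e" if "u \<le> y" "y \<le> v" for y
          using d(2)[of y] that 1 2 by (simp add: dist_real_def abs_less_iff)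
        have pos: "H u > 0" "H v > 0" using Hpos 1 2 by auto
        have "(H v - H u) * (H v + H u) = G v - G u"
        proof -
          have "(H v - H u) * (H v + H u) = (H v)\<^sup>2 - (H u)\<^sup>2"
            by (simp add: power2_eq_square algebra_simps)
          then show ?thesis
            unfolding H_def using G(2)[of u] G(2)[of v] 1 2 \<epsilon> by simp
        qed
        then have "\<bar>H v - H u\<bar> * (H v + H u) = \<bar>G v - G u\<bar>"
          using pos by (metis abs_mult abs_of_pos add_pos_pos)
        then have eq: "\<bar>H v - H u\<bar> = \<bar>G v - G u\<bar> * (1 / (H v + H u))"
          using pos by (simp add: field_simps)
        have "ennreal \<bar>H v - H u\<bar> = ennreal \<bar>G v - G u\<bar> * ennreal (1 / (H v + H u))"
          unfolding eq using pos by (intro ennreal_mult) auto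
        also have "\<dots> \<le> (\<integral>\<^sup>+y. ennreal \<bar>k y\<bar> * indicator {u<..v} y \<partial>lborel) * ennreal (1 / (H v + H u))"
          using 1 2 by (intro mult_right_mono k) auto
        also have "\<dots> = (\<integral>\<^sup>+y. (ennreal \<bar>k y\<bar> * indicator {u<..v} y) * ennreal (1 / (H v + H u)) \<partial>lborel)"
          by (rule nn_integral_multc[symmetric]) measurable
        also have "\<dots> \<le> (\<integral>\<^sup>+y. ennreal \<eta> * (ennreal (\<bar>k y\<bar> / (2 * H y)) * indicator {u<..v} y) \<partial>lborel)"
        proof (intro nn_integral_mono)
          fix y
          show "(ennreal \<bar>k y\<bar> * indicator {u<..v} y) * ennreal (1 / (H v + H u))
              \<le> ennreal \<eta> * (ennreal (\<bar>k y\<bar> / (2 * H y)) * indicator {u<..v} y)"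
          proof (cases "y \<in> {u<..v}")
            case True
            then have y: "u \<le> y" "y \<le> v" by auto
            have Hy: "H y > 0" using y 1 2 by (intro Hpos) auto
            have "2 * H y \<le> 2 * (\<eta> * (H x - e))"
              using near[OF y] e(3) by (simp add: abs_less_iff)
            also have "\<dots> \<le> \<eta> * (H v + H u)"
              using near[of u] near[of v] 1 \<eta> by (auto simp: abs_less_iff)
            finally have "1 / (H v + H u) \<le> \<eta> * (1 / (2 * H y))"
              using pos Hy by (simp add: field_simps)
            then have "\<bar>k y\<bar> * (1 / (H v + H u)) \<le> \<bar>k y\<bar> * (\<eta> * (1 / (2 * H y)))"
              by (rule mult_left_mono) simp
            then have "ennreal (\<bar>k y\<bar> * (1 / (H v + H u))) \<le> ennreal (\<eta> * (\<bar>k y\<bar> / (2 * H y)))"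
              by (intro ennreal_leI) (simp add: field_simps)
            moreover have "ennreal (\<bar>k y\<bar> * (1 / (H v + H u))) = ennreal \<bar>k y\<bar> * ennreal (1 / (H v + H u))"
              using pos by (intro ennreal_mult) auto
            moreover have "ennreal (\<eta> * (\<bar>k y\<bar> / (2 * H y))) = ennreal \<eta> * ennreal (\<bar>k y\<bar> / (2 * H y))"
              using Hy \<eta> by (intro ennreal_mult) auto
            ultimately show ?thesis
              using True by simp
          qed simp
        qed
        also have "\<dots> = ennreal \<eta> * I u v"
          unfolding I_def by (rule nn_integral_cmult) measurable
        finally show "ennreal \<bar>H v - H u\<bar> \<le> ennreal \<eta> * I u v" .
      qed
    qed
    then have "ennreal \<bar>H b - H a\<bar> \<le> ennreal \<eta> * I a b"
      using ab by (simp add: P_def)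
    also have "\<dots> \<le> ennreal \<eta> * ?X"
      unfolding I_def
    proof (intro mult_left_mono nn_integral_mono)
      fix y
      show "ennreal (\<bar>k y\<bar> / (2 * H y)) * indicator {a<..b} y \<le> ennreal (\<bar>k y\<bar> / (2 * sqrt (G y))) * indicator {a<..b} y"
      proof (cases "y \<in> {a<..b}")
        case True
        then have y: "a < y" "y \<le> b" by auto
        show ?thesis
        proof (cases "G y = 0")
          case False
          then have "G y > 0" using G(2)[of y] y by simp
          then have "\<bar>k y\<bar> / (2 * H y) \<le> \<bar>k y\<bar> / (2 * sqrt (G y))"
            using \<epsilon> by (intro divide_left_mono mult_pos_pos) (auto simp: H_def)
          then show ?thesis by (intro mult_right_mono ennreal_leI) auto
        qed (use k0[of y] y in simp)
      qed simp
    qed simp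
    finally show ?thesis by (simp add: H_def)
  qed
  show ?thesis
  proof (cases "?X = \<infinity>")
    case False
    then obtain r where r: "?X = ennreal r" "r \<ge> 0"
      by (cases ?X) auto
    have "\<bar>sqrt (G b + 1 / Suc n) - sqrt (G a + 1 / Suc n)\<bar> \<le> (1 + 1 / Suc n) * r" for n
    proof -
      have "ennreal ((1 + 1 / Suc n) * r) = ennreal (1 + 1 / Suc n) * ennreal r"
        using r by (intro ennreal_mult) auto
      then have "ennreal \<bar>sqrt (G b + 1 / Suc n) - sqrt (G a + 1 / Suc n)\<bar> \<le> ennreal ((1 + 1 / Suc n) * r)"
        unfolding r(1)[symmetric] by (simp only:) (rule reg, auto)
      moreover have "0 \<le> (1 + 1 / Suc n) * r"
        using r(2) by (intro mult_nonneg_nonneg) auto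
      ultimately show ?thesis
        by (simp only: ennreal_le_iff)
    qed
    moreover have "(\<lambda>n. \<bar>sqrt (G b + 1 / Suc n) - sqrt (G a + 1 / Suc n)\<bar>) \<longlonglongrightarrow> \<bar>sqrt (G b + 0) - sqrt (G a + 0)\<bar>"
      by (intro tendsto_intros LIMSEQ_Suc[OF lim_1_over_n])
    moreover have "(\<lambda>n. (1 + 1 / Suc n) * r) \<longlonglongrightarrow> (1 + 0) * r"
      by (intro tendsto_intros LIMSEQ_Suc[OF lim_1_over_n])
    ultimately have "\<bar>sqrt (G b + 0) - sqrt (G a + 0)\<bar> \<le> (1 + 0) * r"
      by (intro LIMSEQ_le) auto
    then show ?thesis
      using r by (simp add: ennreal_leI)
  qed simp
qed


lemma nn_integral_inverse_Icc:
  fixes a b :: real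
  assumes "0 < a" "a \<le> b"
  shows "(\<integral>\<^sup>+x. ennreal (1 / x) * indicator {a..b} x \<partial>lborel) = ennreal (ln b - ln a)"
proof -
  have "((\<lambda>x. 1 / x) has_integral ln b - ln a) {a..b}"
    by (rule fundamental_theorem_of_calculus[OF assms(2)])
      (use assms in \<open>auto intro!: derivative_eq_intros simp flip: has_real_derivative_iff_has_vector_derivative\<close>)
  from nn_integral_has_integral_lebesgue'[OF _ this] show ?thesis
    using assms by simp
qed

text \<open>The analytic content of finite Fisher information: \<open>x f(x)\<close> is an indefinite integral of \<open>- \<Lambda> f\<close> with
\<open>\<Lambda>\<close> square integrable under \<open>f\<close>. The conditions are invariant under \<open>x \<mapsto> - x\<close>, so results on the
positive half-line transfer to the negative one.\<close>

locale scale_regular_density =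
  fixes f \<Lambda> :: "real \<Rightarrow> real"
  assumes f_meas[measurable]: "f \<in> borel_measurable borel" and f_nonneg: "\<And>x. 0 \<le> f x"
    and f_int: "integrable lborel f"
    and \<Lambda>_meas[measurable]: "\<Lambda> \<in> borel_measurable borel"
    and \<Lambda>_int: "integrable lborel (\<lambda>x. (\<Lambda> x)\<^sup>2 * f x)"
    and cont: "continuous_on UNIV (\<lambda>x. x * f x)"
    and incr: "\<And>a b. a \<le> b \<Longrightarrow> b * f b - a * f a = (LINT y:{a..b}|lborel. - (\<Lambda> y * f y))"
begin

lemma \<Lambda>f_int: "integrable lborel (\<lambda>x. \<Lambda> x * f x)"
proof -
  have "integrable lborel (\<lambda>x. (\<Lambda> x * sqrt (f x)) * sqrt (f x))"
    by (rule integrable_mult_square) (use f_nonneg f_int \<Lambda>_int in \<open>auto simp: power_mult_distrib\<close>)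
  then show ?thesis
    using f_nonneg by (simp add: mult.assoc)
qed

text \<open>The derivative of \<open>s \<mapsto> \<surd>f\<^sub>s(x)\<close> at \<open>s = 1\<close>, where \<open>f\<^sub>s(x) = f(x / s) / s\<close>.\<close>

definition root_score :: "real \<Rightarrow> real" where
  "root_score x = 1 / 2 * \<Lambda> x * sqrt (f x)"

lemma root_score_meas[measurable]: "root_score \<in> borel_measurable borel"
  unfolding root_score_def by measurable

lemma root_score_sq: "(root_score x)\<^sup>2 = 1 / 4 * ((\<Lambda> x)\<^sup>2 * f x)"
  using f_nonneg by (simp add: root_score_def power_mult_distrib power2_eq_square)

lemma root_score_int: "integrable lborel (\<lambda>x. (root_score x)\<^sup>2)"
  unfolding root_score_sq using \<Lambda>_int by simp

text \<open>The Cauchy-Schwarz inequality for the factorisation \<open>\<Lambda> f / (2 \<surd>(y f)) = root_score \<cdot> 1 / \<surd>y\<close>.\<close>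

lemma sqrt_xf_increment:
  assumes "0 < a" "a \<le> b"
  shows "(sqrt (b * f b) - sqrt (a * f a))\<^sup>2 \<le> (ln b - ln a) * (\<integral>y. (root_score y)\<^sup>2 * indicator {a..b} y \<partial>lborel)"
proof -
  have e1: "(\<bar>root_score y\<bar> * indicator {a..b} y)\<^sup>2 = (root_score y)\<^sup>2 * indicator {a..b} y" for y
    by (simp add: indicator_def)
  have e2: "(sqrt (1 / y) * indicator {a..b} y)\<^sup>2 = 1 / y * indicator {a..b} y" for y
    using assms by (auto simp: indicator_def)
  have i1: "integrable lborel (\<lambda>y. (\<bar>root_score y\<bar> * indicator {a..b} y)\<^sup>2)"
    unfolding e1 using integrable_mult_indicator[OF _ root_score_int, of "{a..b}"] by (simp add: mult.commute)
  have nn: "(\<integral>\<^sup>+y. ennreal (1 / y * indicator {a..b} y) \<partial>lborel) = ennreal (ln b - ln a)"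
    unfolding nn_integral_inverse_Icc[OF assms, symmetric]
    by (intro nn_integral_cong) (auto simp: indicator_def)
  have ipos: "0 \<le> 1 / y * indicator {a..b} y" for y :: real
    using assms by (auto simp: indicator_def)
  have i2: "integrable lborel (\<lambda>y. (sqrt (1 / y) * indicator {a..b} y)\<^sup>2)"
    unfolding e2 by (intro integrableI_nonneg AE_I2 ipos) (use nn in auto)
  have i3: "(\<integral>y. (sqrt (1 / y) * indicator {a..b} y)\<^sup>2 \<partial>lborel) = ln b - ln a"
    unfolding e2 by (subst integral_eq_nn_integral) (use nn ipos assms in \<open>auto intro!: AE_I2\<close>)
  have "ennreal \<bar>sqrt (b * f b) - sqrt (a * f a)\<bar> \<le>
      (\<integral>\<^sup>+y. ennreal (\<bar>\<Lambda> y * f y\<bar> / (2 * sqrt (y * f y))) * indicator {a<..b} y \<partial>lborel)"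
  proof (rule sqrt_increment_bound[where G="\<lambda>y. y * f y" and k="\<lambda>y. \<Lambda> y * f y"])
    show "continuous_on {a..b} (\<lambda>y. y * f y)"
      using cont by (rule continuous_on_subset) simp
    fix u v assume uv: "a \<le> u" "u \<le> v" "v \<le> b"
    have si: "set_integrable lborel {u..v} (\<lambda>y. - (\<Lambda> y * f y))"
      unfolding set_integrable_def by (rule integrable_mult_indicator) (use \<Lambda>f_int in auto)
    have "\<bar>v * f v - u * f u\<bar> \<le> (\<integral>y. \<bar>indicator {u..v} y *\<^sub>R - (\<Lambda> y * f y)\<bar> \<partial>lborel)"
      unfolding incr[OF uv(2)] set_lebesgue_integral_def by (rule integral_abs_bound)
    then have "ennreal \<bar>v * f v - u * f u\<bar> \<le> ennreal (\<integral>y. \<bar>indicator {u..v} y *\<^sub>R - (\<Lambda> y * f y)\<bar> \<partial>lborel)"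
      by (rule ennreal_leI)
    also have "\<dots> = (\<integral>\<^sup>+y. ennreal \<bar>indicator {u..v} y *\<^sub>R - (\<Lambda> y * f y)\<bar> \<partial>lborel)"
      using si unfolding set_integrable_def by (intro nn_integral_eq_integral[symmetric]) auto
    also have "\<dots> = (\<integral>\<^sup>+y. ennreal \<bar>\<Lambda> y * f y\<bar> * indicator {u<..v} y \<partial>lborel)"
      by (intro nn_integral_cong_AE eventually_mono[OF AE_lborel_singleton[of u]]) (auto simp: indicator_def)
    finally show "ennreal \<bar>v * f v - u * f u\<bar> \<le> (\<integral>\<^sup>+y. ennreal \<bar>\<Lambda> y * f y\<bar> * indicator {u<..v} y \<partial>lborel)" .
  qed (use assms f_nonneg in auto)
  also have "\<dots> = (\<integral>\<^sup>+y. ennreal (\<bar>root_score y\<bar> * indicator {a..b} y * (sqrt (1 / y) * indicator {a..b} y)) \<partial>lborel)"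
  proof (intro nn_integral_cong_AE eventually_mono[OF AE_lborel_singleton[of a]])
    fix y assume "y \<noteq> a"
    show "ennreal (\<bar>\<Lambda> y * f y\<bar> / (2 * sqrt (y * f y))) * indicator {a<..b} y =
        ennreal (\<bar>root_score y\<bar> * indicator {a..b} y * (sqrt (1 / y) * indicator {a..b} y))"
    proof (cases "y \<in> {a<..b}")
      case True
      then have y: "y > 0" using assms by auto
      have "\<bar>\<Lambda> y * f y\<bar> / (2 * sqrt (y * f y)) = \<bar>root_score y\<bar> * sqrt (1 / y)"
      proof (cases "f y = 0")
        case False
        then have fy: "f y > 0" using f_nonneg[of y] by simp
        have "\<bar>\<Lambda> y * f y\<bar> = \<bar>\<Lambda> y\<bar> * (sqrt (f y) * sqrt (f y))"
          using fy by (simp add: abs_mult)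
        then show ?thesis
          using y fy by (simp add: root_score_def abs_mult real_sqrt_mult real_sqrt_divide field_simps)
      qed (simp add: root_score_def)
      then show ?thesis using True by simp
    qed (use \<open>y \<noteq> a\<close> in auto)
  qed
  also have "\<dots> = ennreal (\<integral>y. \<bar>root_score y\<bar> * indicator {a..b} y * (sqrt (1 / y) * indicator {a..b} y) \<partial>lborel)"
    using assms by (intro nn_integral_eq_integral integrable_mult_square i1 i2)
      (auto intro!: AE_I2 simp: indicator_def)
  finally have le: "\<bar>sqrt (b * f b) - sqrt (a * f a)\<bar>
      \<le> (\<integral>y. \<bar>root_score y\<bar> * indicator {a..b} y * (sqrt (1 / y) * indicator {a..b} y) \<partial>lborel)"
    using assms by (subst (asm) ennreal_le_iff) (auto intro!: integral_nonneg_AE AE_I2 simp: indicator_def)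
  have "(sqrt (b * f b) - sqrt (a * f a))\<^sup>2 = \<bar>sqrt (b * f b) - sqrt (a * f a)\<bar>\<^sup>2"
    by simp
  also have "\<dots> \<le> (\<integral>y. \<bar>root_score y\<bar> * indicator {a..b} y * (sqrt (1 / y) * indicator {a..b} y) \<partial>lborel)\<^sup>2"
    using le by (intro power_mono) auto
  also have "\<dots> \<le> (\<integral>y. (\<bar>root_score y\<bar> * indicator {a..b} y)\<^sup>2 \<partial>lborel) * (\<integral>y. (sqrt (1 / y) * indicator {a..b} y)\<^sup>2 \<partial>lborel)"
    by (intro integral_Cauchy_Schwarz i1 i2) measurable
  also have "\<dots> = (ln b - ln a) * (\<integral>y. (root_score y)\<^sup>2 * indicator {a..b} y \<partial>lborel)"
    unfolding i3 by (simp add: e1 mult.commute)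
  finally show ?thesis .
qed


lemma root_score_half_int: "integrable lborel (\<lambda>x. (root_score x * indicator {0<..} x)\<^sup>2)"
proof -
  have "(\<lambda>x. (root_score x * indicator {0<..} x)\<^sup>2) = (\<lambda>x. indicator {0<..} x *\<^sub>R (root_score x)\<^sup>2)"
    by (auto simp: indicator_def)
  then show ?thesis
    using integrable_mult_indicator[OF _ root_score_int, of "{0<..}"] by simp
qed

text \<open>With \<open>G(x) = x f(x)\<close> one has \<open>\<surd>f\<^sub>s(x) = \<surd>G(x / s) / \<surd>x\<close>, so the increment is taken between \<open>x\<close> and
\<open>x / s\<close>. After the pointwise bound, the integrals are interchanged: for fixed \<open>y\<close>, the points \<open>x\<close> with
\<open>y\<close> between \<open>x\<close> and \<open>x / s\<close> form an interval of measure \<open>|ln s|\<close> with respect to \<open>dx / x\<close>.\<close>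

lemma scaling_norm_bound:
  assumes s: "s > 0"
  shows "(\<integral>\<^sup>+x. ennreal ((sqrt (f (x / s) / s) - sqrt (f x))\<^sup>2 * indicator {0<..} x) \<partial>lborel)
    \<le> ennreal ((ln s)\<^sup>2 * (\<integral>x. (root_score x * indicator {0<..} x)\<^sup>2 \<partial>lborel))"
proof -
  define K where "K x y \<longleftrightarrow> 0 < x \<and> min x (x / s) \<le> y \<and> y \<le> max x (x / s)" for x y :: real
  have [measurable]: "Measurable.pred (borel \<Otimes>\<^sub>M borel) (\<lambda>(x, y). K x y)"
    unfolding K_def case_prod_unfold by measurable
  have Ky: "K x y \<longleftrightarrow> 0 < y \<and> min y (s * y) \<le> x \<and> x \<le> max y (s * y)" for x y
  proof -
    have "K x y \<longleftrightarrow> 0 < x \<and> 0 < y \<and> ((x \<le> y \<and> y \<le> x / s) \<or> (x / s \<le> y \<and> y \<le> x))"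
      using s unfolding K_def by (cases "x \<le> x / s") (auto simp: min_def max_def intro: less_le_trans divide_pos_pos)
    also have "\<dots> \<longleftrightarrow> 0 < x \<and> 0 < y \<and> ((x \<le> y \<and> s * y \<le> x) \<or> (x \<le> s * y \<and> y \<le> x))"
      using s by (auto simp: field_simps)
    also have "\<dots> \<longleftrightarrow> 0 < y \<and> min y (s * y) \<le> x \<and> x \<le> max y (s * y)"
    proof -
      have "(0 < x \<and> 0 < y \<and> ((x \<le> y \<and> w \<le> x) \<or> (x \<le> w \<and> y \<le> x))) \<longleftrightarrow>
          0 < y \<and> min y w \<le> x \<and> x \<le> max y w" if "0 < y \<Longrightarrow> 0 < w" for w
        using that by (auto simp: min_def max_def split: if_splits)
      then show ?thesis using s by simp
    qed
    finally show ?thesis .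
  qed
  have pt: "ennreal ((sqrt (f (x / s) / s) - sqrt (f x))\<^sup>2 * indicator {0<..} x)
      \<le> (\<integral>\<^sup>+y. (if K x y then ennreal (\<bar>ln s\<bar> * (root_score y)\<^sup>2 * (1 / x)) else 0) \<partial>lborel)" for x
  proof (cases "x > 0")
    case x: True
    define a b where "a = min x (x / s)" and "b = max x (x / s)"
    have ab: "0 < a" "a \<le> b" using x s by (auto simp: a_def b_def)
    have "(sqrt (f (x / s) / s) - sqrt (f x))\<^sup>2 = ((sqrt ((x / s) * f (x / s)) - sqrt (x * f x)) / sqrt x)\<^sup>2"
    proof -
      have "f (x / s) / s = (x / s) * f (x / s) / x" "f x = x * f x / x"
        using x by auto
      then have "sqrt (f (x / s) / s) = sqrt ((x / s) * f (x / s)) / sqrt x" "sqrt (f x) = sqrt (x * f x) / sqrt x"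
        by (metis real_sqrt_divide)+
      then show ?thesis by (simp add: diff_divide_distrib)
    qed
    also have "\<dots> = (sqrt (b * f b) - sqrt (a * f a))\<^sup>2 / x"
      using x by (auto simp: power_divide a_def b_def min_def max_def power2_commute)
    also have "\<dots> \<le> ((ln b - ln a) * (\<integral>y. (root_score y)\<^sup>2 * indicator {a..b} y \<partial>lborel)) / x"
      using x by (intro divide_right_mono sqrt_xf_increment ab) auto
    also have "ln b - ln a = \<bar>ln s\<bar>"
    proof -
      have "x \<le> x / s \<longleftrightarrow> s \<le> 1"
        using x s by (simp add: pos_le_divide_eq mult_le_cancel_left1)
      then show ?thesis
        using x s by (auto simp: a_def b_def min_def max_def ln_div)
    qed
    finally have "(sqrt (f (x / s) / s) - sqrt (f x))\<^sup>2 \<le> (\<bar>ln s\<bar> * (\<integral>y. (root_score y)\<^sup>2 * indicator {a..b} y \<partial>lborel)) / x" .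
    also have "\<dots> = (\<integral>y. \<bar>ln s\<bar> * (1 / x) * ((root_score y)\<^sup>2 * indicator {a..b} y) \<partial>lborel)"
      by simp
    finally have "ennreal ((sqrt (f (x / s) / s) - sqrt (f x))\<^sup>2) \<le>
        ennreal (\<integral>y. \<bar>ln s\<bar> * (1 / x) * ((root_score y)\<^sup>2 * indicator {a..b} y) \<partial>lborel)"
      by (rule ennreal_leI)
    also have "\<dots> = (\<integral>\<^sup>+y. ennreal (\<bar>ln s\<bar> * (1 / x) * ((root_score y)\<^sup>2 * indicator {a..b} y)) \<partial>lborel)"
    proof (rule nn_integral_eq_integral[symmetric])
      show "integrable lborel (\<lambda>y. \<bar>ln s\<bar> * (1 / x) * ((root_score y)\<^sup>2 * indicator {a..b} y))"
        using integrable_mult_indicator[OF _ root_score_int, of "{a..b}"]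
        by (intro integrable_mult_right) (simp add: mult.commute)
    qed (use x in \<open>auto intro!: AE_I2\<close>)
    also have "\<dots> = (\<integral>\<^sup>+y. (if K x y then ennreal (\<bar>ln s\<bar> * (root_score y)\<^sup>2 * (1 / x)) else 0) \<partial>lborel)"
      using x by (intro nn_integral_cong) (auto simp: K_def a_def b_def indicator_def mult.commute mult.left_commute)
    finally show ?thesis using x by simp
  qed simp
  have "(\<integral>\<^sup>+x. ennreal ((sqrt (f (x / s) / s) - sqrt (f x))\<^sup>2 * indicator {0<..} x) \<partial>lborel)
      \<le> (\<integral>\<^sup>+x. \<integral>\<^sup>+y. (if K x y then ennreal (\<bar>ln s\<bar> * (root_score y)\<^sup>2 * (1 / x)) else 0) \<partial>lborel \<partial>lborel)"
    by (intro nn_integral_mono pt)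
  also have "\<dots> = (\<integral>\<^sup>+y. \<integral>\<^sup>+x. (if K x y then ennreal (\<bar>ln s\<bar> * (root_score y)\<^sup>2 * (1 / x)) else 0) \<partial>lborel \<partial>lborel)"
    by (rule lborel_pair.Fubini') measurable
  also have "\<dots> = (\<integral>\<^sup>+y. ennreal ((ln s)\<^sup>2 * (root_score y * indicator {0<..} y)\<^sup>2) \<partial>lborel)"
  proof (intro nn_integral_cong)
    fix y
    show "(\<integral>\<^sup>+x. (if K x y then ennreal (\<bar>ln s\<bar> * (root_score y)\<^sup>2 * (1 / x)) else 0) \<partial>lborel)
        = ennreal ((ln s)\<^sup>2 * (root_score y * indicator {0<..} y)\<^sup>2)"
    proof (cases "y > 0")
      case y: True
      define a b where "a = min y (s * y)" and "b = max y (s * y)"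
      have ab: "0 < a" "a \<le> b" using y s by (auto simp: a_def b_def)
      have "(\<integral>\<^sup>+x. (if K x y then ennreal (\<bar>ln s\<bar> * (root_score y)\<^sup>2 * (1 / x)) else 0) \<partial>lborel)
          = (\<integral>\<^sup>+x. ennreal (\<bar>ln s\<bar> * (root_score y)\<^sup>2) * (ennreal (1 / x) * indicator {a..b} x) \<partial>lborel)"
        using y ab by (intro nn_integral_cong) (auto simp: Ky a_def[symmetric] b_def[symmetric] indicator_def ennreal_mult'[symmetric])
      also have "\<dots> = ennreal (\<bar>ln s\<bar> * (root_score y)\<^sup>2) * (\<integral>\<^sup>+x. ennreal (1 / x) * indicator {a..b} x \<partial>lborel)"
        by (rule nn_integral_cmult) measurable
      also have "\<dots> = ennreal (\<bar>ln s\<bar> * (root_score y)\<^sup>2) * ennreal (ln b - ln a)"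
        by (simp only: nn_integral_inverse_Icc[OF ab])
      also have "ln b - ln a = \<bar>ln s\<bar>"
        using y s by (auto simp: a_def b_def min_def max_def ln_mult)
      also have "ennreal (\<bar>ln s\<bar> * (root_score y)\<^sup>2) * ennreal \<bar>ln s\<bar> = ennreal ((ln s)\<^sup>2 * (root_score y * indicator {0<..} y)\<^sup>2)"
      proof -
        have "\<bar>ln s\<bar> * (root_score y)\<^sup>2 * \<bar>ln s\<bar> = (ln s)\<^sup>2 * (root_score y)\<^sup>2"
          by (simp add: power2_eq_square abs_if)
        then show ?thesis
          using y by (simp add: ennreal_mult'[symmetric])
      qed
      finally show ?thesis .
    qed (simp add: Ky)
  qed
  also have "\<dots> = ennreal ((ln s)\<^sup>2 * (\<integral>x. (root_score x * indicator {0<..} x)\<^sup>2 \<partial>lborel))"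
    using root_score_half_int by (subst nn_integral_eq_integral) auto
  finally show ?thesis .
qed

lemma AE_deriv_xf: "AE x in lborel. ((\<lambda>y. y * f y) has_real_derivative - (\<Lambda> x * f x)) (at x)"
  by (rule AE_has_derivative_indefinite_integral) (use \<Lambda>f_int incr in auto)

lemma scaling_pointwise_derivative:
  assumes d: "((\<lambda>y. y * f y) has_real_derivative - (\<Lambda> x * f x)) (at x)" and x: "x > 0" and fx: "f x > 0"
  shows "((\<lambda>t. (sqrt (f (x / (1 + t)) / (1 + t)) - sqrt (f x)) / t) \<longlongrightarrow> root_score x) (at 0)"
proof -
  define h where "h t = sqrt ((x / (1 + t)) * f (x / (1 + t)) / x)" for t
  have i: "((\<lambda>t. x / (1 + t)) has_real_derivative - x) (at 0)"
    by (auto intro!: derivative_eq_intros simp: field_simps)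
  have "((\<lambda>t. (x / (1 + t)) * f (x / (1 + t))) has_real_derivative - (\<Lambda> x * f x) * (- x)) (at 0)"
    using DERIV_chain2[of "\<lambda>y. y * f y" "- (\<Lambda> x * f x)" "\<lambda>t. x / (1 + t)" 0 "- x" UNIV] d i by simp
  then have q: "((\<lambda>t. (x / (1 + t)) * f (x / (1 + t)) / x) has_real_derivative \<Lambda> x * f x) (at 0)"
    using DERIV_cdivide[of "\<lambda>t. (x / (1 + t)) * f (x / (1 + t))" "- (\<Lambda> x * f x) * (- x)" 0 UNIV x] x by simp
  have sq: "(sqrt has_real_derivative inverse (sqrt (f x)) / 2) (at (f x))"
    by (rule DERIV_real_sqrt[OF fx])
  have "(h has_real_derivative inverse (sqrt (f x)) / 2 * (\<Lambda> x * f x)) (at 0)"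
    unfolding h_def by (rule DERIV_chain2[OF _ q]) (use sq x in simp)
  moreover have "inverse (sqrt (f x)) / 2 * (\<Lambda> x * f x) = root_score x"
  proof -
    have "f x = sqrt (f x) * sqrt (f x)" using fx by simp
    then have "inverse (sqrt (f x)) * f x = sqrt (f x)"
      using fx by (metis mult.assoc left_inverse mult_1 real_sqrt_eq_zero_cancel_iff less_irrefl)
    moreover have "inverse (sqrt (f x)) / 2 * (\<Lambda> x * f x) = 1 / 2 * \<Lambda> x * (inverse (sqrt (f x)) * f x)"
      by simp
    ultimately show ?thesis by (simp only: root_score_def)
  qed
  ultimately have "((\<lambda>t. (h t - h 0) / (t - 0)) \<longlongrightarrow> root_score x) (at 0)"
    unfolding has_field_derivative_iff by simp
  moreover have "h t = sqrt (f (x / (1 + t)) / (1 + t))" for t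
    using x by (simp add: h_def)
  ultimately show ?thesis by simp
qed

text \<open>The norm bound gives the factor \<open>(ln (1 + t) / t)\<^sup>2 \<rightarrow> 1\<close>, so that pointwise convergence on \<open>{f > 0}\<close>
suffices.\<close>

theorem scaling_L2_derivative:
  shows "((\<lambda>t. \<integral>x. (((sqrt (f (x / (1 + t)) / (1 + t)) - sqrt (f x)) / t - root_score x) * indicator {0<..} x)\<^sup>2 \<partial>lborel)
      \<longlongrightarrow> 0) (at 0)"
    and "\<And>t. t > -1 \<Longrightarrow> t \<noteq> 0 \<Longrightarrow>
      integrable lborel (\<lambda>x. (((sqrt (f (x / (1 + t)) / (1 + t)) - sqrt (f x)) / t - root_score x) * indicator {0<..} x)\<^sup>2)"
proof -
  let ?D = "\<lambda>t x. (sqrt (f (x / (1 + t)) / (1 + t)) - sqrt (f x)) / t"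
  have main: "(\<lambda>n. \<integral>x. ((?D (X n) x - root_score x) * indicator {0<..} x)\<^sup>2 \<partial>lborel) \<longlonglongrightarrow> 0 \<and>
      (\<forall>n. integrable lborel (\<lambda>x. ((?D (X n) x - root_score x) * indicator {0<..} x)\<^sup>2))"
    if X: "\<And>n. X n \<in> {-1<..} - {0}" "X \<longlonglongrightarrow> 0" for X
  proof -
    define a where "a n x = ?D (X n) x * indicator {0<..} x" for n x
    define b where "b x = root_score x * indicator {0<..} x" for x
    define c where "c n = (ln (1 + X n) / X n)\<^sup>2" for n
    have am: "a n \<in> borel_measurable lborel" for n
      unfolding a_def by measurable
    have bm: "b \<in> borel_measurable lborel"
      unfolding b_def by measurable
    have bound: "(\<integral>\<^sup>+x. ennreal ((a n x)\<^sup>2) \<partial>lborel) \<le> ennreal (c n * (\<integral>x. (b x)\<^sup>2 \<partial>lborel))" for n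
    proof -
      define t where "t = X n"
      have t: "1 + t > 0" "t \<noteq> 0" using X(1)[of n] by (auto simp: t_def)
      have "(\<integral>\<^sup>+x. ennreal ((a n x)\<^sup>2) \<partial>lborel) = (\<integral>\<^sup>+x. ennreal (1 / t\<^sup>2) *
          ennreal ((sqrt (f (x / (1 + t)) / (1 + t)) - sqrt (f x))\<^sup>2 * indicator {0<..} x) \<partial>lborel)"
        by (intro nn_integral_cong)
          (auto simp: a_def t_def[symmetric] indicator_def power_divide ennreal_mult'[symmetric])
      also have "\<dots> = ennreal (1 / t\<^sup>2) * (\<integral>\<^sup>+x.
          ennreal ((sqrt (f (x / (1 + t)) / (1 + t)) - sqrt (f x))\<^sup>2 * indicator {0<..} x) \<partial>lborel)"
        by (rule nn_integral_cmult) measurable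
      also have "\<dots> \<le> ennreal (1 / t\<^sup>2) * ennreal ((ln (1 + t))\<^sup>2 * (\<integral>x. (root_score x * indicator {0<..} x)\<^sup>2 \<partial>lborel))"
        by (intro mult_left_mono scaling_norm_bound t) simp
      also have "\<dots> = ennreal (c n * (\<integral>x. (b x)\<^sup>2 \<partial>lborel))"
        by (simp add: ennreal_mult'[symmetric] c_def b_def t_def power_divide)
      finally show ?thesis .
    qed
    have c: "c \<longlonglongrightarrow> 1"
    proof -
      have "((\<lambda>t. ln (1 + t)) has_real_derivative 1) (at 0)"
        by (auto intro!: derivative_eq_intros)
      then have "((\<lambda>t::real. ln (1 + t) / t) \<longlongrightarrow> 1) (at 0)"
        unfolding has_field_derivative_iff by simp
      moreover have "filterlim X (at 0) sequentially"
        unfolding filterlim_at using X by (auto intro: always_eventually)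
      ultimately have "(\<lambda>n. ln (1 + X n) / X n) \<longlonglongrightarrow> 1"
        by (rule filterlim_compose)
      then have "(\<lambda>n. (ln (1 + X n) / X n)\<^sup>2) \<longlonglongrightarrow> 1\<^sup>2"
        by (rule tendsto_power)
      then show ?thesis by (simp add: c_def[abs_def])
    qed
    have lim: "AE x in lborel. b x \<noteq> 0 \<longrightarrow> (\<lambda>n. a n x) \<longlonglongrightarrow> b x"
      using AE_deriv_xf
    proof eventually_elim
      case (elim x)
      show ?case
      proof
        assume "b x \<noteq> 0"
        then have x: "x > 0" "f x \<noteq> 0" by (auto simp: b_def root_score_def indicator_def split: if_splits)
        then have "f x > 0" using f_nonneg[of x] by simp
        from scaling_pointwise_derivative[OF elim x(1) this]
        have "((\<lambda>t. ?D t x) \<longlongrightarrow> root_score x) (at 0)" .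
        moreover have "filterlim X (at 0) sequentially"
          unfolding filterlim_at using X by (auto intro: always_eventually)
        ultimately have "(\<lambda>n. ?D (X n) x) \<longlonglongrightarrow> root_score x"
          by (rule filterlim_compose)
        then show "(\<lambda>n. a n x) \<longlonglongrightarrow> b x"
          using x by (simp add: a_def b_def)
      qed
    qed
    have eq: "a n x - b x = (?D (X n) x - root_score x) * indicator {0<..} x" for n x
      unfolding a_def b_def by (simp add: left_diff_distrib)
    show ?thesis
      using L2_convergence_from_norm_bound[OF am bm root_score_half_int[folded b_def] bound c lim]
      unfolding eq by blast
  qed
  have "((\<lambda>t. \<integral>x. ((?D t x - root_score x) * indicator {0<..} x)\<^sup>2 \<partial>lborel) \<longlongrightarrow> 0) (at 0 within {-1<..})"
    unfolding tendsto_at_iff_sequentially comp_def using main by blast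
  moreover have "at 0 within {-1<..} = at (0::real)"
    by (rule at_within_open) auto
  ultimately show "((\<lambda>t. \<integral>x. ((?D t x - root_score x) * indicator {0<..} x)\<^sup>2 \<partial>lborel) \<longlongrightarrow> 0) (at 0)"
    by simp
  fix t :: real assume t: "t > -1" "t \<noteq> 0"
  have "(\<lambda>n. (if n = 0 then t else 1 / Suc n)) \<longlonglongrightarrow> 0"
    by (rule Lim_transform_eventually[OF LIMSEQ_Suc[OF lim_1_over_n]])
      (use eventually_gt_at_top[of 0] in \<open>eventually_elim, simp\<close>)
  moreover have "(if n = 0 then t else 1 / Suc n) \<in> {-1<..} - {0}" for n
  proof -
    have "1 / real (Suc n) > 0" by simp
    then have "1 / real (Suc n) > - 1" "1 / real (Suc n) \<noteq> 0" by linarith+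
    then show ?thesis using t by simp
  qed
  ultimately have "integrable lborel (\<lambda>x. ((?D (if 0 = (0::nat) then t else 1 / Suc 0) x - root_score x) * indicator {0<..} x)\<^sup>2)"
    using main[of "\<lambda>n. if n = 0 then t else 1 / Suc n"] by blast
  then show "integrable lborel (\<lambda>x. ((?D t x - root_score x) * indicator {0<..} x)\<^sup>2)"
    by simp
qed

end

section \<open>Absolute continuity, test functions and the score\<close>

lemma absolutely_continuous_fun_imp_continuous:
  assumes "absolutely_continuous_fun g"
  shows "continuous_on UNIV g"
  unfolding continuous_on_iff
proof (intro ballI allI impI)
  fix x e :: real assume "e > 0"
  then obtain d where d: "d > 0" "\<And>P. finite P \<Longrightarrow> (\<forall>(a, b)\<in>P. a < b) \<Longrightarrow>
      disjoint_family_on (\<lambda>(a, b). {a<..<b}) P \<Longrightarrow> (\<Sum>(a, b)\<in>P. b - a) < d \<Longrightarrow>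
      (\<Sum>(a, b)\<in>P. \<bar>g b - g a\<bar>) < e"
    using assms unfolding absolutely_continuous_fun_def by meson
  have *: "\<bar>g b - g a\<bar> < e" if "a < b" "b - a < d" for a b
    using d(2)[of "{(a, b)}"] that by (simp add: disjoint_family_on_def)
  show "\<exists>d>0. \<forall>y\<in>UNIV. dist y x < d \<longrightarrow> dist (g y) (g x) < e"
  proof (intro exI[of _ d] conjI ballI impI d(1))
    fix y assume "dist y x < d"
    then show "dist (g y) (g x) < e"
      using *[of x y] *[of y x] \<open>e > 0\<close>
      by (cases x y rule: linorder_cases) (auto simp: dist_real_def abs_minus_commute)
  qed
qed

text \<open>The integrand is split into a bounded part, whose contribution is controlled by the total length, and a part
of small integral; disjointness is used as a bound by \<open>1\<close> on the sum of the indicators.\<close>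

lemma absolutely_continuous_fun_indefinite_integral:
  fixes k g :: "real \<Rightarrow> real"
  assumes k: "integrable lborel k"
    and g: "\<And>a b. a \<le> b \<Longrightarrow> g b - g a = (LINT y:{a..b}|lborel. k y)"
  shows "absolutely_continuous_fun g"
  unfolding absolutely_continuous_fun_def
proof (intro allI impI)
  fix \<epsilon> :: real assume \<epsilon>: "\<epsilon> > 0"
  have [measurable]: "k \<in> borel_measurable borel" using k by auto
  define t where "t N y = min \<bar>k y\<bar> (real N)" for N :: nat and y
  have ti: "integrable lborel (t N)" for N
    by (rule Bochner_Integration.integrable_bound[OF k]) (auto simp: t_def[abs_def])
  have "(\<lambda>N. \<integral>y. \<bar>k y\<bar> - t N y \<partial>lborel) \<longlonglongrightarrow> (\<integral>y. 0 \<partial>(lborel::real measure))"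
  proof (rule integral_dominated_convergence[where w="\<lambda>y. \<bar>k y\<bar>"])
    show "AE y in lborel. (\<lambda>N. \<bar>k y\<bar> - t N y) \<longlonglongrightarrow> 0"
    proof (intro AE_I2 tendsto_eventually)
      fix y
      obtain N0 :: nat where "\<bar>k y\<bar> \<le> real N0" using real_arch_simple by blast
      then show "\<forall>\<^sub>F N in sequentially. \<bar>k y\<bar> - t N y = 0"
        by (intro eventually_sequentiallyI[of N0]) (auto simp: t_def)
    qed
  qed (use k in \<open>auto simp: t_def[abs_def]\<close>)
  then have "\<forall>\<^sub>F N in sequentially. (\<integral>y. \<bar>k y\<bar> - t N y \<partial>lborel) < \<epsilon> / 2"
    using \<epsilon> by (intro order_tendstoD) auto
  then obtain N where N: "(\<integral>y. \<bar>k y\<bar> - t N y \<partial>lborel) < \<epsilon> / 2"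
    by (auto simp: eventually_sequentially)
  show "\<exists>\<delta>>0. \<forall>P. finite P \<longrightarrow> (\<forall>(a, b)\<in>P. a < b) \<longrightarrow> disjoint_family_on (\<lambda>(a, b). {a<..<b}) P \<longrightarrow>
      (\<Sum>(a, b)\<in>P. b - a) < \<delta> \<longrightarrow> (\<Sum>(a, b)\<in>P. \<bar>g b - g a\<bar>) < \<epsilon>"
  proof (intro exI[of _ "\<epsilon> / (2 * (real N + 1))"] conjI allI impI)
    show "\<epsilon> / (2 * (real N + 1)) > 0" using \<epsilon> by simp
    fix P :: "(real \<times> real) set"
    assume P: "finite P" "\<forall>(a, b)\<in>P. a < b" "disjoint_family_on (\<lambda>(a, b). {a<..<b}) P"
      "(\<Sum>(a, b)\<in>P. b - a) < \<epsilon> / (2 * (real N + 1))"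
    define J where "J p = {fst p<..<snd p}" for p :: "real \<times> real"
    define w where "w p y = indicator (J p) y * (\<bar>k y\<bar> - t N y) + indicator (J p) y * t N y" for p y
    have J: "J p \<in> sets lborel" for p by (simp add: J_def)
    have i1: "integrable lborel (\<lambda>y. indicator (J p) y * (\<bar>k y\<bar> - t N y))" for p
      using integrable_mult_indicator[OF J, of "\<lambda>y. \<bar>k y\<bar> - t N y" p] k ti by simp
    have i2: "integrable lborel (\<lambda>y. indicator (J p) y * t N y)" for p
      using integrable_mult_indicator[OF J, of "t N" p] ti by simp
    have tN: "0 \<le> t N y" "t N y \<le> real N" "t N y \<le> \<bar>k y\<bar>" for y by (auto simp: t_def)
    have one: "\<bar>g (snd p) - g (fst p)\<bar> \<le>
        (\<integral>y. indicator (J p) y * (\<bar>k y\<bar> - t N y) \<partial>lborel) + real N * (snd p - fst p)" if p: "p \<in> P" for p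
    proof -
      have lt: "fst p < snd p" using P(2) p by auto
      have "\<bar>g (snd p) - g (fst p)\<bar> \<le> (\<integral>y. \<bar>indicator {fst p..snd p} y *\<^sub>R k y\<bar> \<partial>lborel)"
        unfolding g[OF less_imp_le[OF lt]] set_lebesgue_integral_def by (rule integral_abs_bound)
      also have "\<dots> = (\<integral>y. indicator (J p) y * (\<bar>k y\<bar> - t N y) + indicator (J p) y * t N y \<partial>lborel)"
      proof (rule integral_cong_AE)
        show "AE y in lborel. \<bar>indicator {fst p..snd p} y *\<^sub>R k y\<bar> =
            indicator (J p) y * (\<bar>k y\<bar> - t N y) + indicator (J p) y * t N y"
          using AE_lborel_singleton[of "fst p"] AE_lborel_singleton[of "snd p"]
          by eventually_elim (auto simp: J_def indicator_def)
      qed (use i1[of p] i2[of p] in auto)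
      also have "\<dots> = (\<integral>y. indicator (J p) y * (\<bar>k y\<bar> - t N y) \<partial>lborel) + (\<integral>y. indicator (J p) y * t N y \<partial>lborel)"
        by (rule Bochner_Integration.integral_add[OF i1 i2])
      also have "(\<integral>y. indicator (J p) y * t N y \<partial>lborel) \<le> (\<integral>y. indicator (J p) y * real N \<partial>lborel)"
      proof (intro integral_mono i2)
        show "integrable lborel (\<lambda>y. indicator (J p) y * real N)"
          using integrable_real_indicator[of "J p" lborel] lt by (simp add: J_def)
      qed (auto simp: indicator_def tN)
      also have "\<dots> = real N * (snd p - fst p)"
        using lt by (simp add: J_def)
      finally show ?thesis by simp
    qed
    have "(\<Sum>(a, b)\<in>P. \<bar>g b - g a\<bar>) = (\<Sum>p\<in>P. \<bar>g (snd p) - g (fst p)\<bar>)"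
      by (simp add: case_prod_unfold)
    also have "\<dots> \<le> (\<Sum>p\<in>P. (\<integral>y. indicator (J p) y * (\<bar>k y\<bar> - t N y) \<partial>lborel) + real N * (snd p - fst p))"
      by (intro sum_mono one)
    also have "\<dots> = (\<integral>y. (\<Sum>p\<in>P. indicator (J p) y * (\<bar>k y\<bar> - t N y)) \<partial>lborel) + real N * (\<Sum>p\<in>P. snd p - fst p)"
      using i1 by (simp add: sum.distrib sum_distrib_left Bochner_Integration.integral_sum)
    also have "(\<integral>y. (\<Sum>p\<in>P. indicator (J p) y * (\<bar>k y\<bar> - t N y)) \<partial>lborel) \<le> (\<integral>y. \<bar>k y\<bar> - t N y \<partial>lborel)"
    proof (intro integral_mono Bochner_Integration.integrable_sum i1)
      show "integrable lborel (\<lambda>y. \<bar>k y\<bar> - t N y)" using k ti by auto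
      fix y
      have "(\<Sum>p\<in>P. indicator (J p) y :: real) \<le> 1"
      proof -
        have "card {p\<in>P. y \<in> J p} \<le> 1"
        proof (rule card_le_Suc0_iff_eq[THEN iffD2, simplified One_nat_def[symmetric]])
          show "finite {p\<in>P. y \<in> J p}" using P(1) by simp
          show "\<forall>a1\<in>{p\<in>P. y \<in> J p}. \<forall>a2\<in>{p\<in>P. y \<in> J p}. a1 = a2"
          proof (intro ballI)
            fix p q assume pq: "p \<in> {p\<in>P. y \<in> J p}" "q \<in> {p\<in>P. y \<in> J p}"
            show "p = q"
            proof (rule ccontr)
              assume "p \<noteq> q"
              then have "J p \<inter> J q = {}"
                using P(3) pq by (auto simp: disjoint_family_on_def case_prod_unfold J_def)
              then show False using pq by blast
            qed
          qed
        qed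
        moreover have "(\<Sum>p\<in>P. indicator (J p) y :: real) = real (card {p\<in>P. y \<in> J p})"
          using P(1) by (simp add: indicator_def of_bool_def sum.If_cases Collect_conj_eq Int_commute)
        ultimately show ?thesis by simp
      qed
      then have "(\<Sum>p\<in>P. indicator (J p) y) * (\<bar>k y\<bar> - t N y) \<le> 1 * (\<bar>k y\<bar> - t N y)"
        using tN(3)[of y] by (intro mult_right_mono) auto
      then show "(\<Sum>p\<in>P. indicator (J p) y * (\<bar>k y\<bar> - t N y)) \<le> \<bar>k y\<bar> - t N y"
        by (simp add: sum_distrib_right)
    qed
    also have "\<dots> < \<epsilon> / 2" by (rule N)
    also have "real N * (\<Sum>p\<in>P. snd p - fst p) \<le> \<epsilon> / 2"
    proof -
      have S: "(\<Sum>p\<in>P. snd p - fst p) < \<epsilon> / (2 * (real N + 1))"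
        using P(4) by (simp add: case_prod_unfold)
      have S0: "0 \<le> (\<Sum>p\<in>P. snd p - fst p)"
        using P(2) by (intro sum_nonneg) auto
      have "real N * (\<Sum>p\<in>P. snd p - fst p) \<le> (real N + 1) * (\<epsilon> / (2 * (real N + 1)))"
        using S S0 by (intro mult_mono) auto
      also have "\<dots> = \<epsilon> / 2"
        using of_nat_0_le_iff[of N, where ?'a=real] by (simp add: field_simps del: of_nat_0_le_iff)
      finally show ?thesis .
    qed
    finally show "(\<Sum>(a, b)\<in>P. \<bar>g b - g a\<bar>) < \<epsilon>" by simp
  qed
qed

lemma C_c1_iff:
  "\<phi> \<in> C_c1 \<longleftrightarrow> (\<exists>\<psi> K. (\<forall>x. (\<phi> has_real_derivative \<psi> x) (at x)) \<and> continuous_on UNIV \<psi> \<and> (\<forall>x. \<bar>x\<bar> > K \<longrightarrow> \<psi> x = 0))"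
proof
  assume \<phi>: "\<phi> \<in> C_c1"
  then have "bounded {x. deriv \<phi> x \<noteq> 0}"
    by (simp add: C_c1_def)
  then obtain K where "\<And>x. deriv \<phi> x \<noteq> 0 \<Longrightarrow> \<bar>x\<bar> \<le> K"
    by (auto simp: bounded_iff)
  then show "\<exists>\<psi> K. (\<forall>x. (\<phi> has_real_derivative \<psi> x) (at x)) \<and> continuous_on UNIV \<psi> \<and> (\<forall>x. \<bar>x\<bar> > K \<longrightarrow> \<psi> x = 0)"
    using \<phi> by (intro exI[of _ "deriv \<phi>"] exI[of _ K]) (auto simp: C_c1_def DERIV_deriv_iff_real_differentiable not_less[symmetric])
next
  assume "\<exists>\<psi> K. (\<forall>x. (\<phi> has_real_derivative \<psi> x) (at x)) \<and> continuous_on UNIV \<psi> \<and> (\<forall>x. \<bar>x\<bar> > K \<longrightarrow> \<psi> x = 0)"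
  then obtain \<psi> K where \<psi>: "\<And>x. (\<phi> has_real_derivative \<psi> x) (at x)" "continuous_on UNIV \<psi>" "\<And>x. \<bar>x\<bar> > K \<Longrightarrow> \<psi> x = 0"
    by blast
  have d: "deriv \<phi> = \<psi>" using \<psi>(1) by (intro ext DERIV_imp_deriv)
  have "bounded {x. \<psi> x \<noteq> 0}"
    unfolding bounded_iff by (intro exI[of _ K]) (use \<psi>(3) in \<open>force simp: not_less[symmetric]\<close>)
  then show "\<phi> \<in> C_c1"
    using \<psi> d by (auto simp: C_c1_def real_differentiable_def)
qed

lemma C_c1E:
  assumes "\<phi> \<in> C_c1"
  obtains K where "K > 0" "\<And>x. (\<phi> has_real_derivative deriv \<phi> x) (at x)" "continuous_on UNIV (deriv \<phi>)"
    "\<And>x. \<bar>x\<bar> > K \<Longrightarrow> deriv \<phi> x = 0"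
proof -
  obtain \<psi> K where \<psi>: "\<And>x. (\<phi> has_real_derivative \<psi> x) (at x)" "continuous_on UNIV \<psi>" "\<And>x. \<bar>x\<bar> > K \<Longrightarrow> \<psi> x = 0"
    using assms unfolding C_c1_iff by blast
  have d: "deriv \<phi> = \<psi>" using \<psi>(1) by (intro ext DERIV_imp_deriv)
  show thesis
    by (rule that[of "max K 1"]) (use \<psi> d in auto)
qed

lemma continuous_compact_support_bounded:
  fixes \<psi> :: "real \<Rightarrow> real"
  assumes "continuous_on UNIV \<psi>" "\<And>x. \<bar>x\<bar> > K \<Longrightarrow> \<psi> x = 0"
  obtains B where "B \<ge> 0" "\<And>x. \<bar>\<psi> x\<bar> \<le> B"
proof -
  have "bounded (\<psi> ` {-K..K})"
    by (intro compact_imp_bounded compact_continuous_image continuous_on_subset[OF assms(1)]) auto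
  then obtain B where B: "\<And>x. x \<in> {-K..K} \<Longrightarrow> \<bar>\<psi> x\<bar> \<le> B"
    unfolding bounded_iff ball_simps real_norm_def by blast
  show thesis
  proof (rule that[of "max B 0"])
    fix x show "\<bar>\<psi> x\<bar> \<le> max B 0"
    proof (cases "\<bar>x\<bar> > K")
      case False
      then have "x \<in> {-K..K}" by auto
      from B[OF this] show ?thesis by (simp add: le_max_iff_disj)
    qed (use assms(2)[of x] in simp)
  qed simp
qed

text \<open>A test function is constant outside the support of its derivative, hence bounded.\<close>

lemma C_c1_bounds:
  assumes "\<phi> \<in> C_c1"
  obtains B where "\<And>x. \<bar>\<phi> x\<bar> \<le> B" "\<And>x. \<bar>deriv \<phi> x\<bar> \<le> B" "\<And>x. \<bar>x * deriv \<phi> x\<bar> \<le> B"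
proof -
  obtain K where K: "K > 0" "\<And>x. (\<phi> has_real_derivative deriv \<phi> x) (at x)" "continuous_on UNIV (deriv \<phi>)"
    "\<And>x. \<bar>x\<bar> > K \<Longrightarrow> deriv \<phi> x = 0"
    using C_c1E[OF assms] by blast
  obtain B1 where B1: "B1 \<ge> 0" "\<And>x. \<bar>deriv \<phi> x\<bar> \<le> B1"
    using continuous_compact_support_bounded[OF K(3,4)] by blast
  have B2: "\<bar>x * deriv \<phi> x\<bar> \<le> K * B1" for x
  proof (cases "\<bar>x\<bar> > K")
    case False
    then show ?thesis unfolding abs_mult using B1 by (intro mult_mono) auto
  qed (use K B1 in simp)
  have cont: "continuous_on UNIV \<phi>"
    using K(2) by (auto intro!: DERIV_continuous_on)
  have "bounded (\<phi> ` {-(K + 1)..K + 1})"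
    by (intro compact_imp_bounded compact_continuous_image continuous_on_subset[OF cont]) auto
  then obtain B3 where B3: "\<And>x. x \<in> {-(K + 1)..K + 1} \<Longrightarrow> \<bar>\<phi> x\<bar> \<le> B3"
    unfolding bounded_iff ball_simps real_norm_def by blast
  have B4: "\<bar>\<phi> x\<bar> \<le> B3" for x
  proof -
    consider "x \<in> {-(K + 1)..K + 1}" | "x > K + 1" | "x < -(K + 1)"
      by force
    then show ?thesis
    proof cases
      case 2
      have "\<phi> x = \<phi> (K + 1)"
      proof (rule DERIV_isconst2[of "K + 1" x \<phi>])
        show "continuous_on {K + 1..x} \<phi>" using cont by (rule continuous_on_subset) simp
        fix y assume "K + 1 < y" "y < x"
        then show "(\<phi> has_real_derivative 0) (at y)" using K(2)[of y] K(4)[of y] by simp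
      qed (use 2 in auto)
      then show ?thesis using B3[of "K + 1"] K(1) by simp
    next
      case 3
      have "\<phi> (-(K + 1)) = \<phi> x"
      proof (rule DERIV_isconst2[of x "-(K + 1)" \<phi>])
        show "continuous_on {x..-(K + 1)} \<phi>" using cont by (rule continuous_on_subset) simp
        fix y assume "x < y" "y < -(K + 1)"
        then show "(\<phi> has_real_derivative 0) (at y)" using K(2)[of y] K(4)[of y] by simp
      qed (use 3 in auto)
      then show ?thesis using B3[of "-(K + 1)"] K(1) by simp
    qed (use B3 in auto)
  qed
  have nonneg: "0 \<le> B3" "0 \<le> K * B1"
    using order_trans[OF abs_ge_zero B4] B1(1) K(1) by auto
  show thesis
  proof (rule that[of "B3 + B1 + K * B1"])
    fix x
    show "\<bar>\<phi> x\<bar> \<le> B3 + B1 + K * B1" using B4[of x] nonneg B1(1) by linarith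
    show "\<bar>deriv \<phi> x\<bar> \<le> B3 + B1 + K * B1" using B1(2)[of x] nonneg by linarith
    show "\<bar>x * deriv \<phi> x\<bar> \<le> B3 + B1 + K * B1" using B2[of x] nonneg B1(1) by linarith
  qed
qed

lemma C_c1_measurable:
  assumes "\<phi> \<in> C_c1"
  shows "\<phi> \<in> borel_measurable borel" "deriv \<phi> \<in> borel_measurable borel"
proof -
  obtain K where K: "K > 0" "\<And>x. (\<phi> has_real_derivative deriv \<phi> x) (at x)" "continuous_on UNIV (deriv \<phi>)"
    "\<And>x. \<bar>x\<bar> > K \<Longrightarrow> deriv \<phi> x = 0"
    using C_c1E[OF assms] by blast
  show "deriv \<phi> \<in> borel_measurable borel"
    using K(3) by (rule borel_measurable_continuous_onI)
  have "continuous_on UNIV \<phi>"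
    using K(2) by (auto intro!: DERIV_continuous_on)
  then show "\<phi> \<in> borel_measurable borel"
    by (rule borel_measurable_continuous_onI)
qed

lemma C_c1_add_scaled:
  assumes "\<phi> \<in> C_c1" "\<psi> \<in> C_c1"
  shows "(\<lambda>x. \<phi> x + c * \<psi> x) \<in> C_c1" "deriv (\<lambda>x. \<phi> x + c * \<psi> x) = (\<lambda>x. deriv \<phi> x + c * deriv \<psi> x)"
proof -
  obtain K where K: "K > 0" "\<And>x. (\<phi> has_real_derivative deriv \<phi> x) (at x)" "continuous_on UNIV (deriv \<phi>)"
    "\<And>x. \<bar>x\<bar> > K \<Longrightarrow> deriv \<phi> x = 0"
    using C_c1E[OF assms(1)] by blast
  obtain K' where K': "K' > 0" "\<And>x. (\<psi> has_real_derivative deriv \<psi> x) (at x)" "continuous_on UNIV (deriv \<psi>)"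
    "\<And>x. \<bar>x\<bar> > K' \<Longrightarrow> deriv \<psi> x = 0"
    using C_c1E[OF assms(2)] by blast
  have d: "((\<lambda>x. \<phi> x + c * \<psi> x) has_real_derivative deriv \<phi> x + c * deriv \<psi> x) (at x)" for x
    by (intro derivative_intros DERIV_cmult K(2) K'(2))
  then show "deriv (\<lambda>x. \<phi> x + c * \<psi> x) = (\<lambda>x. deriv \<phi> x + c * deriv \<psi> x)"
    by (intro ext DERIV_imp_deriv)
  show "(\<lambda>x. \<phi> x + c * \<psi> x) \<in> C_c1"
    unfolding C_c1_iff
    by (intro exI[of _ "\<lambda>x. deriv \<phi> x + c * deriv \<psi> x"] exI[of _ "max K K'"] conjI allI d impI)
      (use K(3,4) K'(3,4) in \<open>auto intro!: continuous_intros\<close>)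
qed

lemma C_c1_const: "(\<lambda>_. c) \<in> C_c1"
  unfolding C_c1_iff by (intro exI[of _ "\<lambda>_. 0"]) auto

lemma C_c1_primitive:
  fixes \<psi> :: "real \<Rightarrow> real"
  assumes "continuous_on UNIV \<psi>" "\<And>x. \<bar>x\<bar> > K \<Longrightarrow> \<psi> x = 0"
  obtains \<phi> where "\<phi> \<in> C_c1" "deriv \<phi> = \<psi>" "\<And>x. \<phi> x = (\<integral>y. indicator {..x} y * \<psi> y \<partial>lborel)"
proof -
  define \<phi> where "\<phi> x = (\<integral>y. indicator {..x} y * \<psi> y \<partial>lborel)" for x
  have deriv: "(\<phi> has_real_derivative \<psi> x) (at x)" for x
  proof -
    define a b where "a = - (\<bar>K\<bar> + \<bar>x\<bar> + 2)" and "b = \<bar>K\<bar> + \<bar>x\<bar> + 2"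
    have xab: "a < x" "x < b" by (auto simp: a_def b_def)
    have c: "continuous_on {a..b} \<psi>"
      using assms(1) by (rule continuous_on_subset) simp
    have eq: "integral {a..y} \<psi> = \<phi> y" if "y \<in> {a<..<b}" for y
    proof -
      have "continuous_on {a..y} \<psi>"
        using assms(1) by (rule continuous_on_subset) simp
      then have "integral {a..y} \<psi> = (LINT z:{a..y}|lborel. \<psi> z)"
        by (intro set_borel_integral_eq_integral(2)[symmetric] borel_integrable_atLeastAtMost')
      also have "\<dots> = \<phi> y"
        unfolding \<phi>_def set_lebesgue_integral_def
      proof (intro Bochner_Integration.integral_cong refl)
        fix z
        have "\<psi> z = 0" if "z < a" using that assms(2)[of z] by (simp add: a_def)
        then show "indicator {a..y} z *\<^sub>R \<psi> z = indicator {..y} z * \<psi> z"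
          by (auto simp: indicator_def not_le)
      qed
      finally show ?thesis .
    qed
    have "((\<lambda>y. integral {a..y} \<psi>) has_real_derivative \<psi> x) (at x within {a..b})"
      using xab by (intro integral_has_real_derivative c) auto
    then have "((\<lambda>y. integral {a..y} \<psi>) has_real_derivative \<psi> x) (at x)"
      using xab by (simp add: at_within_Icc_at)
    then show ?thesis
      by (rule has_field_derivative_transform_within_open[of _ _ _ "{a<..<b}"]) (use xab eq in auto)
  qed
  show thesis
  proof (rule that)
    show "\<phi> \<in> C_c1"
      unfolding C_c1_iff using deriv assms by blast
    show "deriv \<phi> = \<psi>"
      using deriv by (intro ext DERIV_imp_deriv)
  qed (rule \<phi>_def)
qed

context real_distribution
begin

lemma C_c1_integrable:
  assumes "\<phi> \<in> C_c1"
  shows "integrable M \<phi>" "integrable M (\<lambda>x. (\<phi> x)\<^sup>2)" "integrable M (\<lambda>x. x * deriv \<phi> x)"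
proof -
  obtain B where B: "\<And>x. \<bar>\<phi> x\<bar> \<le> B" "\<And>x. \<bar>deriv \<phi> x\<bar> \<le> B" "\<And>x. \<bar>x * deriv \<phi> x\<bar> \<le> B"
    using C_c1_bounds[OF assms] by blast
  note [measurable] = C_c1_measurable[OF assms]
  show "integrable M \<phi>"
    by (rule integrable_const_bound[of _ B]) (use B in auto)
  have B0: "B \<ge> 0" using B(1)[of 0] by simp
  show "integrable M (\<lambda>x. (\<phi> x)\<^sup>2)"
  proof (rule integrable_const_bound[of _ "B\<^sup>2"])
    show "AE x in M. norm ((\<phi> x)\<^sup>2) \<le> B\<^sup>2"
      using B(1) B0 by (intro AE_I2) (simp add: abs_le_square_iff[symmetric])
  qed measurable
  show "integrable M (\<lambda>x. x * deriv \<phi> x)"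
    by (rule integrable_const_bound[of _ B]) (use B in auto)
qed

lemma fisher_functional_bound:
  assumes fin: "fisher_scale1 M < \<infinity>" and \<phi>: "\<phi> \<in> C_c1"
  shows "(\<integral>x. x * deriv \<phi> x \<partial>M)\<^sup>2 \<le> enn2real (fisher_scale1 M) * (\<integral>x. (\<phi> x)\<^sup>2 \<partial>M)"
proof -
  define L N where "L = (\<integral>x. x * deriv \<phi> x \<partial>M)" and "N = (\<integral>x. (\<phi> x)\<^sup>2 \<partial>M)"
  have N0: "N \<ge> 0" by (simp add: N_def)
  have le: "ennreal (L\<^sup>2) / ennreal N \<le> fisher_scale1 M"
    unfolding fisher_scale1_def L_def N_def using \<phi> by (intro SUP_upper) auto
  obtain C where C: "fisher_scale1 M = ennreal C" "C \<ge> 0"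
    using fin by (cases "fisher_scale1 M") auto
  show ?thesis
  proof (cases "N = 0")
    case True
    have "L\<^sup>2 = 0"
    proof (rule ccontr)
      assume "L\<^sup>2 \<noteq> 0"
      then have "ennreal (L\<^sup>2) / ennreal N = \<infinity>"
        using True by (simp add: ennreal_divide_eq_top_iff)
      then show False using le fin by simp
    qed
    then show ?thesis using N0 by (simp add: L_def N_def)
  next
    case False
    then have "N > 0" using N0 by simp
    then have "ennreal (L\<^sup>2 / N) \<le> ennreal C"
      using le C by (simp add: divide_ennreal)
    then have "L\<^sup>2 / N \<le> C"
      using C by simp
    then show ?thesis
      using \<open>N > 0\<close> C by (simp add: L_def N_def field_simps)
  qed
qed

text \<open>The representing function lies in the closure of the test functions, so the supremum defining the
information equals its squared norm and not merely a lower bound of it.\<close>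

lemma scale_score_representation:
  assumes fin: "fisher_scale1 M < \<infinity>"
  obtains \<Lambda> where "\<Lambda> \<in> borel_measurable borel" "integrable M (\<lambda>x. (\<Lambda> x)\<^sup>2)"
    "\<And>\<phi>. \<phi> \<in> C_c1 \<Longrightarrow> (\<integral>x. x * deriv \<phi> x \<partial>M) = (\<integral>x. \<phi> x * \<Lambda> x \<partial>M)"
    "fisher_scale1 M = ennreal (\<integral>x. (\<Lambda> x)\<^sup>2 \<partial>M)"
proof -
  let ?L = "\<lambda>\<phi>. \<integral>x. x * deriv \<phi> x \<partial>M"
  have Ladd: "?L (\<lambda>x. \<phi> x + c * \<psi> x) = ?L \<phi> + c * ?L \<psi>" if "\<phi> \<in> C_c1" "\<psi> \<in> C_c1" for \<phi> \<psi> c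
  proof -
    have "?L (\<lambda>x. \<phi> x + c * \<psi> x) = (\<integral>x. x * deriv \<phi> x + c * (x * deriv \<psi> x) \<partial>M)"
      unfolding C_c1_add_scaled(2)[OF that] by (simp add: algebra_simps)
    also have "\<dots> = ?L \<phi> + c * ?L \<psi>"
      using C_c1_integrable(3) that by simp
    finally show ?thesis .
  qed
  have ne: "C_c1 \<noteq> {}" using C_c1_const by blast
  obtain \<Lambda> where \<Lambda>: "\<Lambda> \<in> borel_measurable M" "integrable M (\<lambda>x. (\<Lambda> x)\<^sup>2)"
    "\<And>\<phi>. \<phi> \<in> C_c1 \<Longrightarrow> ?L \<phi> = (\<integral>x. \<phi> x * \<Lambda> x \<partial>M)"
    "\<And>e. e > 0 \<Longrightarrow> \<exists>\<phi>\<in>C_c1. integrable M (\<lambda>x. (\<phi> x - \<Lambda> x)\<^sup>2) \<and> (\<integral>x. (\<phi> x - \<Lambda> x)\<^sup>2 \<partial>M) \<le> e"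
  proof (rule L2_functional_representation[of C_c1 M ?L "enn2real (fisher_scale1 M)", OF ne])
    show "\<phi> \<in> borel_measurable M" if "\<phi> \<in> C_c1" for \<phi>
      using C_c1_measurable[OF that] by simp
    show "integrable M (\<lambda>x. (\<phi> x)\<^sup>2)" if "\<phi> \<in> C_c1" for \<phi>
      by (rule C_c1_integrable(2)[OF that])
    show "(\<lambda>x. \<phi> x + c * \<psi> x) \<in> C_c1" if "\<phi> \<in> C_c1" "\<psi> \<in> C_c1" for \<phi> \<psi> c
      by (rule C_c1_add_scaled(1)[OF that])
    show "?L (\<lambda>x. \<phi> x + c * \<psi> x) = ?L \<phi> + c * ?L \<psi>" if "\<phi> \<in> C_c1" "\<psi> \<in> C_c1" for \<phi> \<psi> c
      by (rule Ladd[OF that])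
    show "(?L \<phi>)\<^sup>2 \<le> enn2real (fisher_scale1 M) * (\<integral>x. (\<phi> x)\<^sup>2 \<partial>M)" if "\<phi> \<in> C_c1" for \<phi>
      by (rule fisher_functional_bound[OF fin that])
  qed (rule that)
  define g where "g = (\<integral>x. (\<Lambda> x)\<^sup>2 \<partial>M)"
  have g0: "g \<ge> 0" by (simp add: g_def)
  have "fisher_scale1 M \<le> ennreal g"
    unfolding fisher_scale1_def
  proof (rule SUP_least)
    fix \<phi> assume \<phi>: "\<phi> \<in> C_c1"
    define N where "N = (\<integral>x. (\<phi> x)\<^sup>2 \<partial>M)"
    have N0: "N \<ge> 0" by (simp add: N_def)
    have CS: "(?L \<phi>)\<^sup>2 \<le> N * g"
      unfolding \<Lambda>(3)[OF \<phi>] N_def g_def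
      by (rule integral_Cauchy_Schwarz) (use C_c1_measurable[OF \<phi>] C_c1_integrable[OF \<phi>] \<Lambda> in auto)
    have "ennreal ((?L \<phi>)\<^sup>2) / ennreal N \<le> ennreal g"
    proof (cases "N = 0")
      case False
      then have "N > 0" using N0 by simp
      then show ?thesis
        using CS g0 by (simp add: divide_ennreal field_simps)
    qed (use CS in simp)
    then show "ennreal ((?L \<phi>)\<^sup>2) / ennreal (\<integral>x. (\<phi> x)\<^sup>2 \<partial>M) \<le> ennreal g"
      unfolding N_def .
  qed
  moreover have "ennreal g \<le> fisher_scale1 M"
  proof (rule ccontr)
    assume "\<not> ennreal g \<le> fisher_scale1 M"
    then have lt: "fisher_scale1 M < ennreal g" by simp
    define I where "I = enn2real (fisher_scale1 M)"
    have I: "fisher_scale1 M = ennreal I" "I \<ge> 0"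
      using fin by (auto simp: I_def)
    have Ig: "I < g" using lt I by (simp add: ennreal_less_iff)
    \<comment> \<open>For \<open>\<phi>\<close> within \<open>c\<close> of \<open>\<Lambda>\<close> in squared norm, the quotient of \<open>\<phi>\<close> is at least \<open>g - c > I\<close>,
      by \<open>(L - (g - c))\<^sup>2 \<ge> 0\<close>.\<close>
    define c where "c = (g - I) / 2"
    have c: "c > 0" "g - c > I" using Ig by (auto simp: c_def field_simps)
    obtain \<phi> where \<phi>: "\<phi> \<in> C_c1" "(\<integral>x. (\<phi> x - \<Lambda> x)\<^sup>2 \<partial>M) \<le> c"
      using \<Lambda>(4)[OF c(1)] by blast
    define L N where "L = ?L \<phi>" and "N = (\<integral>x. (\<phi> x)\<^sup>2 \<partial>M)"
    have N0: "N \<ge> 0" by (simp add: N_def)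
    have "(\<integral>x. (\<phi> x + (- 1) * \<Lambda> x)\<^sup>2 \<partial>M) = N + 2 * (- 1) * L + (- 1)\<^sup>2 * g"
      unfolding N_def L_def \<Lambda>(3)[OF \<phi>(1)] g_def
      by (rule integrable_square_add_scaled(2)) (use C_c1_measurable[OF \<phi>(1)] C_c1_integrable[OF \<phi>(1)] \<Lambda> in auto)
    then have "N - 2 * L + g \<le> c" using \<phi>(2) by simp
    then have "(g - c) * N \<le> (g - c) * (2 * L - (g - c))"
      using c I(2) by (intro mult_left_mono) auto
    also have "\<dots> \<le> L\<^sup>2"
      using zero_le_power2[of "L - (g - c)"] by (simp add: power2_eq_square algebra_simps)
    also have "\<dots> \<le> I * N"
      using fisher_functional_bound[OF fin \<phi>(1)] by (simp add: L_def N_def I_def)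
    finally have "((g - c) - I) * N \<le> 0" by (simp add: algebra_simps)
    then have "N = 0" using c(2) N0 by (simp add: mult_le_0_iff)
    then have "L\<^sup>2 \<le> 0" using fisher_functional_bound[OF fin \<phi>(1)] by (simp add: L_def N_def)
    then have "L = 0" by simp
    then show False using \<open>N - 2 * L + g \<le> c\<close> \<open>N = 0\<close> c I(2) by simp
  qed
  ultimately have "fisher_scale1 M = ennreal g" by (rule antisym)
  then show thesis
    using that[of \<Lambda>] \<Lambda>(1-3) by (simp add: g_def)
qed

end

section \<open>The density recovered from its score\<close>

text \<open>The score in its weak form, before any density is known to exist. At this stage an atom of \<open>M\<close> at any point
is still possible.\<close>

locale scale_score_function = real_distribution M for M :: "real measure" +
  fixes \<Lambda> :: "real \<Rightarrow> real"
  assumes \<Lambda>_meas[measurable]: "\<Lambda> \<in> borel_measurable borel"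
    and \<Lambda>_sq: "integrable M (\<lambda>x. (\<Lambda> x)\<^sup>2)"
    and repr: "\<And>\<phi>. \<phi> \<in> C_c1 \<Longrightarrow> (\<integral>x. x * deriv \<phi> x \<partial>M) = (\<integral>x. \<phi> x * \<Lambda> x \<partial>M)"
begin

lemma \<Lambda>_int: "integrable M \<Lambda>"
  by (rule integrable_of_square[OF _ \<Lambda>_sq]) simp

lemma \<Lambda>_mean: "(\<integral>x. \<Lambda> x \<partial>M) = 0"
  using repr[OF C_c1_const[of 1]] by simp

text \<open>This turns out to be \<open>x \<mapsto> x f(x)\<close>.\<close>

definition score_tail :: "real \<Rightarrow> real" where
  "score_tail y = (\<integral>x. indicator {y..} x * \<Lambda> x \<partial>M)"

lemma score_tail_meas[measurable]: "score_tail \<in> borel_measurable borel"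
proof -
  have "(\<lambda>y. \<integral>x. (if y \<le> x then \<Lambda> x else 0) \<partial>M) \<in> borel_measurable borel"
    by measurable
  moreover have "score_tail = (\<lambda>y. \<integral>x. (if y \<le> x then \<Lambda> x else 0) \<partial>M)"
    unfolding score_tail_def by (intro ext Bochner_Integration.integral_cong) auto
  ultimately show ?thesis by simp
qed

definition score_L1 where "score_L1 = (\<integral>x. \<bar>\<Lambda> x\<bar> \<partial>M)"

lemma score_on_int: "S \<in> sets borel \<Longrightarrow> integrable M (\<lambda>x. indicator S x * \<Lambda> x)"
  using integrable_mult_indicator[OF _ \<Lambda>_int, of S] by simp

lemma score_on_bound: 
  assumes "S \<in> sets borel"
  shows "\<bar>\<integral>x. indicator S x * \<Lambda> x \<partial>M\<bar> \<le> score_L1"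
proof -
  have "\<bar>\<integral>x. indicator S x * \<Lambda> x \<partial>M\<bar> \<le> (\<integral>x. \<bar>indicator S x * \<Lambda> x\<bar> \<partial>M)"
    by (rule integral_abs_bound)
  also have "\<dots> \<le> score_L1"
    unfolding score_L1_def using \<Lambda>_int score_on_int[OF assms]
    by (intro integral_mono) (auto simp: indicator_def)
  finally show ?thesis .
qed

lemma score_tail_bound: "\<bar>score_tail y\<bar> \<le> score_L1"
  unfolding score_tail_def by (rule score_on_bound) simp

lemma score_tail_diff: "a \<le> b \<Longrightarrow> score_tail b - score_tail a = - (\<integral>x. indicator {a..<b} x * \<Lambda> x \<partial>M)"
proof -
  assume ab: "a \<le> b"
  have "score_tail a = (\<integral>x. indicator {b..} x * \<Lambda> x + indicator {a..<b} x * \<Lambda> x \<partial>M)"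
    unfolding score_tail_def using ab by (intro Bochner_Integration.integral_cong) (auto simp: indicator_def)
  also have "\<dots> = score_tail b + (\<integral>x. indicator {a..<b} x * \<Lambda> x \<partial>M)"
    unfolding score_tail_def by (intro Bochner_Integration.integral_add score_on_int) auto
  finally show ?thesis by simp
qed

text \<open>Every continuous \<open>\<psi>\<close> with compact support is the derivative of a test function, its primitive; Fubini's
theorem moves the primitive from \<open>\<psi>\<close> to the score. So \<open>x M(dx)\<close> is absolutely continuous with density
\<open>score_tail\<close>.\<close>

lemma tail_identity:
  fixes \<psi> :: "real \<Rightarrow> real"
  assumes "continuous_on UNIV \<psi>" "\<And>x. \<bar>x\<bar> > K \<Longrightarrow> \<psi> x = 0"
  shows "(\<integral>x. x * \<psi> x \<partial>M) = (\<integral>y. \<psi> y * score_tail y \<partial>lborel)"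
proof -
  obtain \<phi> where \<phi>: "\<phi> \<in> C_c1" "deriv \<phi> = \<psi>" "\<And>x. \<phi> x = (\<integral>y. indicator {..x} y * \<psi> y \<partial>lborel)"
    using C_c1_primitive[OF assms] by blast
  have [measurable]: "\<psi> \<in> borel_measurable borel"
    by (rule borel_measurable_continuous_onI[OF assms(1)])
  have \<psi>i: "integrable lborel \<psi>"
  proof -
    have "integrable lborel (\<lambda>y. indicator {-K..K} y *\<^sub>R \<psi> y)"
      using borel_integrable_atLeastAtMost'[of "-K" K \<psi>] continuous_on_subset[OF assms(1)]
      by (simp add: set_integrable_def)
    moreover have "(\<lambda>y. indicator {-K..K} y *\<^sub>R \<psi> y) = \<psi>"
      using assms(2) by (intro ext) (force simp: indicator_def not_less[symmetric])
    ultimately show ?thesis by simp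
  qed
  interpret P: pair_sigma_finite M lborel by unfold_locales
  have prod: "integrable (M \<Otimes>\<^sub>M lborel) (\<lambda>(x, y). \<Lambda> x * \<psi> y)"
  proof (rule P.Fubini_integrable)
    show "integrable M (\<lambda>x. \<integral>y. norm (case (x, y) of (x, y) \<Rightarrow> \<Lambda> x * \<psi> y) \<partial>lborel)"
      using \<Lambda>_int by (simp add: abs_mult)
  qed (use \<psi>i in auto)
  have prod2: "integrable (M \<Otimes>\<^sub>M lborel) (\<lambda>(x, y). if y \<le> x then \<Lambda> x * \<psi> y else 0)"
    by (rule Bochner_Integration.integrable_bound[OF prod]) (auto simp: case_prod_unfold)
  have "(\<integral>x. x * \<psi> x \<partial>M) = (\<integral>x. (\<integral>y. (if y \<le> x then \<Lambda> x * \<psi> y else 0) \<partial>lborel) \<partial>M)"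
  proof -
    have "\<phi> x * \<Lambda> x = (\<integral>y. (if y \<le> x then \<Lambda> x * \<psi> y else 0) \<partial>lborel)" for x
    proof -
      have "\<phi> x * \<Lambda> x = (\<integral>y. \<Lambda> x * (indicator {..x} y * \<psi> y) \<partial>lborel)"
        unfolding \<phi>(3) by (simp add: mult.commute)
      also have "\<dots> = (\<integral>y. (if y \<le> x then \<Lambda> x * \<psi> y else 0) \<partial>lborel)"
        by (intro Bochner_Integration.integral_cong) auto
      finally show ?thesis .
    qed
    then show ?thesis
      using repr[OF \<phi>(1)] \<phi>(2) by simp
  qed
  also have "\<dots> = (\<integral>y. (\<integral>x. (if y \<le> x then \<Lambda> x * \<psi> y else 0) \<partial>M) \<partial>lborel)"
    using P.Fubini_integral[OF prod2] by simp
  also have "\<dots> = (\<integral>y. \<psi> y * score_tail y \<partial>lborel)"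
  proof (intro Bochner_Integration.integral_cong refl)
    fix y
    have "(\<integral>x. (if y \<le> x then \<Lambda> x * \<psi> y else 0) \<partial>M) = (\<integral>x. \<psi> y * (indicator {y..} x * \<Lambda> x) \<partial>M)"
      by (intro Bochner_Integration.integral_cong) (auto simp: indicator_def)
    then show "(\<integral>x. (if y \<le> x then \<Lambda> x * \<psi> y else 0) \<partial>M) = \<psi> y * score_tail y"
      by (simp add: score_tail_def)
  qed
  finally show ?thesis .
qed

text \<open>Passage from continuous functions to half-open intervals by trapezoidal approximations, with dominated
convergence on both sides.\<close>

lemma interval_identity:
  assumes ab: "a < b"
  shows "(\<integral>x. indicator {a<..b} x * x \<partial>M) = (\<integral>y. indicator {a<..b} y * score_tail y \<partial>lborel)"
proof -
  \<comment> \<open>Trapezoids with slope \<open>n + 1\<close>, rising to the right of \<open>a\<close> and falling to the right of \<open>b\<close>, so that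
    the limit is the indicator of the interval open at \<open>a\<close> and closed at \<open>b\<close>.\<close>
  define \<psi> where "\<psi> n x = max 0 (min 1 (min (real (Suc n) * (x - a)) (1 - real (Suc n) * (x - b))))" for n :: nat and x :: real
  have \<psi>c: "continuous_on UNIV (\<psi> n)" for n
    unfolding \<psi>_def by (intro continuous_intros)
  have \<psi>0: "\<psi> n x = 0" if x: "x \<notin> {a..b + 1}" for n x
  proof -
    consider "x < a" | "x > b + 1" using x by fastforce
    then show ?thesis
    proof cases
      case 1
      then have "real (Suc n) * (x - a) \<le> 0" by (intro mult_nonneg_nonpos) auto
      then show ?thesis by (simp add: \<psi>_def min_def max_def)
    next
      case 2
      then have "1 * 1 \<le> real (Suc n) * (x - b)" by (intro mult_mono) auto
      then show ?thesis by (simp add: \<psi>_def min_le_iff_disj max_absorb1)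
    qed
  qed
  have \<psi>01: "0 \<le> \<psi> n x" "\<psi> n x \<le> 1" for n x by (auto simp: \<psi>_def)
  have \<psi>le: "\<bar>\<psi> n x\<bar> \<le> indicator {a..b + 1} x" for n x
    using \<psi>0[of x n] \<psi>01[of n x] by (auto simp: indicator_def)
  have [measurable]: "\<psi> n \<in> borel_measurable borel" for n
    by (rule borel_measurable_continuous_onI[OF \<psi>c])
  have \<psi>lim: "(\<lambda>n. \<psi> n x) \<longlonglongrightarrow> indicator {a<..b} x" for x
  proof -
    have big: "\<forall>\<^sub>F n in sequentially. real (Suc n) * c \<ge> 1" if "c > 0" for c :: real
    proof -
      obtain n0 where n0: "inverse (real (Suc n0)) < c" using reals_Archimedean[OF \<open>c > 0\<close>] by auto
      have "real (Suc n) * c \<ge> 1" if "n \<ge> n0" for n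
      proof -
        have "1 = real (Suc n0) * inverse (real (Suc n0))" by simp
        also have "\<dots> \<le> real (Suc n) * c" using n0 that \<open>c > 0\<close> by (intro mult_mono) auto
        finally show ?thesis .
      qed
      then show ?thesis by (auto simp: eventually_sequentially)
    qed
    consider "x \<le> a" | "a < x" "x \<le> b" | "x > b" by force
    then show ?thesis
    proof cases
      case 1
      then have "real (Suc n) * (x - a) \<le> 0" for n by (intro mult_nonneg_nonpos) auto
      then have "\<psi> n x = 0" for n
        unfolding \<psi>_def by (intro max_absorb1) (simp only: min_le_iff_disj, simp)
      then show ?thesis using 1 by simp
    next
      case 2
      have "real (Suc n) * (x - b) \<le> 0" for n using 2 by (intro mult_nonneg_nonpos) auto
      then have le1: "1 \<le> 1 - real (Suc n) * (x - b)" for n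
        using diff_mono[OF order_refl, of "real (Suc n) * (x - b)" 0 1] by simp
      have "\<forall>\<^sub>F n in sequentially. \<psi> n x = 1"
        using big[of "x - a"] 2(1)
      proof (simp, elim eventually_mono)
        fix n assume "1 \<le> (1 + real n) * (x - a)"
        then have "1 \<le> real (Suc n) * (x - a)" by simp
        then show "\<psi> n x = 1" using le1[of n] unfolding \<psi>_def by (simp only: min_absorb1 min.boundedI)
      qed
      then show ?thesis using 2 by (simp add: tendsto_eventually)
    next
      case 3
      have "\<forall>\<^sub>F n in sequentially. \<psi> n x = 0"
        using big[of "x - b"] 3
      proof (simp, elim eventually_mono)
        fix n assume "1 \<le> (1 + real n) * (x - b)"
        then have "1 - real (Suc n) * (x - b) \<le> 0" by simp
        then show "\<psi> n x = 0" unfolding \<psi>_def by (simp add: min_le_iff_disj max_absorb1)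
      qed
      then show ?thesis using 3 by (simp add: tendsto_eventually)
    qed
  qed
  have eq: "(\<integral>x. x * \<psi> n x \<partial>M) = (\<integral>y. \<psi> n y * score_tail y \<partial>lborel)" for n
  proof (rule tail_identity[OF \<psi>c])
    fix x assume "\<bar>x\<bar> > \<bar>a\<bar> + \<bar>b\<bar> + 1"
    then show "\<psi> n x = 0" by (intro \<psi>0) auto
  qed
  define B where "B = \<bar>a\<bar> + \<bar>b\<bar> + 1"
  have "(\<lambda>n. \<integral>x. x * \<psi> n x \<partial>M) \<longlonglongrightarrow> (\<integral>x. x * indicator {a<..b} x \<partial>M)"
  proof (rule integral_dominated_convergence[where w="\<lambda>_. B"])
    show "AE x in M. (\<lambda>n. x * \<psi> n x) \<longlonglongrightarrow> x * indicator {a<..b} x"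
      by (intro AE_I2 tendsto_mult tendsto_const \<psi>lim)
    show "AE x in M. norm (x * \<psi> n x) \<le> B" for n
    proof (intro AE_I2)
      fix x
      show "norm (x * \<psi> n x) \<le> B"
      proof (cases "x \<in> {a..b + 1}")
        case True
        then have "\<bar>x\<bar> \<le> B" by (auto simp: B_def)
        then have "\<bar>x\<bar> * \<bar>\<psi> n x\<bar> \<le> B * 1" using \<psi>01[of n x] by (intro mult_mono) auto
        then show ?thesis by (simp add: abs_mult)
      qed (simp add: \<psi>0 B_def)
    qed
  qed auto
  moreover have "(\<lambda>n. \<integral>y. \<psi> n y * score_tail y \<partial>lborel) \<longlonglongrightarrow> (\<integral>y. indicator {a<..b} y * score_tail y \<partial>lborel)"
  proof (rule integral_dominated_convergence[where w="\<lambda>y. indicator {a..b + 1} y * score_L1"])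
    show "AE y in lborel. (\<lambda>n. \<psi> n y * score_tail y) \<longlonglongrightarrow> indicator {a<..b} y * score_tail y"
      by (intro AE_I2 tendsto_mult tendsto_const \<psi>lim)
    show "AE y in lborel. norm (\<psi> n y * score_tail y) \<le> indicator {a..b + 1} y * score_L1" for n
      unfolding real_norm_def abs_mult by (intro AE_I2 mult_mono \<psi>le score_tail_bound) auto
    show "integrable lborel (\<lambda>y. indicator {a..b + 1} y * score_L1)"
      using integrable_real_indicator[of "{a..b+1}" lborel] ab by simp
  qed auto
  ultimately have "(\<integral>x. x * indicator {a<..b} x \<partial>M) = (\<integral>y. indicator {a<..b} y * score_tail y \<partial>lborel)"
    unfolding eq by (rule LIMSEQ_unique)
  then show ?thesis by (simp add: mult.commute)
qed

text \<open>The tail is continuous from the left, and its limit from the right differs from its value by the contribution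
of a possible atom. The averages are written as integrals over a fixed unit interval in order to apply
dominated convergence.\<close>

lemma one_sided_averages:
  "(\<lambda>n. real (Suc n) * (\<integral>y. indicator {b - 1 / real (Suc n)<..b} y * score_tail y \<partial>lborel)) \<longlonglongrightarrow> score_tail b"
  "(\<lambda>n. real (Suc n) * (\<integral>y. indicator {b<..b + 1 / real (Suc n)} y * score_tail y \<partial>lborel)) \<longlonglongrightarrow>
     (\<integral>x. indicator {b<..} x * \<Lambda> x \<partial>M)"
proof -
  have scale: "real (Suc n) * (\<integral>y. indicator {b + \<alpha> / real (Suc n)<..b + \<beta> / real (Suc n)} y * score_tail y \<partial>lborel)
      = (\<integral>u. indicator {\<alpha><..\<beta>} u * score_tail (b + u / real (Suc n)) \<partial>lborel)" for n and \<alpha> \<beta> :: real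
  proof -
    have "(\<integral>y. indicator {b + \<alpha> / real (Suc n)<..b + \<beta> / real (Suc n)} y * score_tail y \<partial>lborel) =
        \<bar>1 / real (Suc n)\<bar> *\<^sub>R (\<integral>u. indicator {b + \<alpha> / real (Suc n)<..b + \<beta> / real (Suc n)} (b + 1 / real (Suc n) * u)
          * score_tail (b + 1 / real (Suc n) * u) \<partial>lborel)"
      by (rule lborel_integral_real_affine) simp
    also have "\<dots> = 1 / real (Suc n) * (\<integral>u. indicator {\<alpha><..\<beta>} u * score_tail (b + u / real (Suc n)) \<partial>lborel)"
      by (auto intro!: Bochner_Integration.integral_cong simp: indicator_def divide_less_cancel divide_le_cancel simp del: of_nat_Suc)
    finally show ?thesis by (simp del: of_nat_Suc)
  qed
  have inv0: "(\<lambda>n. b + u / real (Suc n)) \<longlonglongrightarrow> b" for u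
  proof -
    have "(\<lambda>n. b + u / real (Suc n)) \<longlonglongrightarrow> b + 0"
      by (intro tendsto_add tendsto_const LIMSEQ_Suc[OF lim_const_over_n])
    then show ?thesis by simp
  qed
  have Glim: "(\<lambda>n. score_tail (b + u / real (Suc n))) \<longlonglongrightarrow> (\<integral>x. indicator S x * \<Lambda> x \<partial>M)"
    if S: "S = (if u \<le> 0 then {b..} else {b<..})" for u S
    unfolding score_tail_def
  proof (rule integral_dominated_convergence[where w="\<lambda>x. \<bar>\<Lambda> x\<bar>"])
    show "AE x in M. (\<lambda>n. indicator {b + u / real (Suc n)..} x * \<Lambda> x) \<longlonglongrightarrow> indicator S x * \<Lambda> x"
    proof (intro AE_I2 tendsto_mult tendsto_const tendsto_eventually)
      fix x
      consider "x < b" | "x > b" | "x = b" by force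
      then show "\<forall>\<^sub>F n in sequentially. indicator {b + u / real (Suc n)..} x = (indicator S x :: real)"
      proof cases
        case 1
        from order_tendstoD(1)[OF inv0[of u] 1] show ?thesis
          by eventually_elim (use 1 S in \<open>auto simp: indicator_def\<close>)
      next
        case 2
        from order_tendstoD(2)[OF inv0[of u] 2] show ?thesis
          by eventually_elim (use 2 S in \<open>auto simp: indicator_def\<close>)
      next
        case 3
        have "u / real (Suc n) \<le> 0 \<longleftrightarrow> u \<le> 0" for n by (simp add: divide_le_0_iff del: of_nat_Suc)
        then show ?thesis using 3 S by (intro always_eventually) (auto simp: indicator_def simp del: of_nat_Suc)
      qed
    qed
    show "integrable M (\<lambda>x. \<bar>\<Lambda> x\<bar>)" using \<Lambda>_int by simp
    have "S \<in> sets borel" using S by (cases "u \<le> 0") auto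
    then show "(\<lambda>x. indicator S x * \<Lambda> x) \<in> borel_measurable M" by measurable
  qed (auto simp: indicator_def simp del: of_nat_Suc)
  have conv: "(\<lambda>n. \<integral>u. indicator {\<alpha><..\<alpha> + 1} u * score_tail (b + u / real (Suc n)) \<partial>lborel) \<longlonglongrightarrow> c"
    if c: "\<And>u. \<alpha> < u \<Longrightarrow> u \<le> \<alpha> + 1 \<Longrightarrow> (\<lambda>n. score_tail (b + u / real (Suc n))) \<longlonglongrightarrow> c" for \<alpha> c
  proof -
    have ii: "integrable lborel (\<lambda>u. indicator {\<alpha><..\<alpha> + 1} u * r)" for r :: real
      using integrable_real_indicator[of "{\<alpha><..\<alpha> + 1}" lborel] by simp
    have "(\<lambda>n. \<integral>u. indicator {\<alpha><..\<alpha> + 1} u * score_tail (b + u / real (Suc n)) \<partial>lborel) \<longlonglongrightarrow> (\<integral>u. indicator {\<alpha><..\<alpha> + 1} u * c \<partial>lborel)"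
    proof (rule integral_dominated_convergence[where w="\<lambda>u. indicator {\<alpha><..\<alpha> + 1} u * score_L1"])
      show "AE u in lborel. (\<lambda>n. indicator {\<alpha><..\<alpha> + 1} u * score_tail (b + u / real (Suc n))) \<longlonglongrightarrow> indicator {\<alpha><..\<alpha> + 1} u * c"
      proof (intro AE_I2)
        fix u
        show "(\<lambda>n. indicator {\<alpha><..\<alpha> + 1} u * score_tail (b + u / real (Suc n))) \<longlonglongrightarrow> indicator {\<alpha><..\<alpha> + 1} u * c"
          using c[of u] by (cases "u \<in> {\<alpha><..\<alpha> + 1}") (auto simp del: of_nat_Suc)
      qed
      show "AE u in lborel. norm (indicator {\<alpha><..\<alpha> + 1} u * score_tail (b + u / real (Suc n))) \<le> indicator {\<alpha><..\<alpha> + 1} u * score_L1" for n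
        using score_tail_bound by (intro AE_I2) (auto simp: indicator_def simp del: of_nat_Suc)
    qed (use ii in auto)
    also have "(\<integral>u. indicator {\<alpha><..\<alpha> + 1} u * c \<partial>lborel) = c"
      by simp
    finally show ?thesis .
  qed
  have "(\<lambda>n. \<integral>u. indicator {-1<..-1 + 1} u * score_tail (b + u / real (Suc n)) \<partial>lborel) \<longlonglongrightarrow> score_tail b"
  proof (rule conv)
    fix u :: real assume "-1 < u" "u \<le> -1 + 1"
    then show "(\<lambda>n. score_tail (b + u / real (Suc n))) \<longlonglongrightarrow> score_tail b"
      unfolding score_tail_def[of b] by (intro Glim) simp
  qed
  then show "(\<lambda>n. real (Suc n) * (\<integral>y. indicator {b - 1 / real (Suc n)<..b} y * score_tail y \<partial>lborel)) \<longlonglongrightarrow> score_tail b"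
    using scale[of _ "-1" "0"] by (simp del: of_nat_Suc)
  have "(\<lambda>n. \<integral>u. indicator {0<..0 + 1} u * score_tail (b + u / real (Suc n)) \<partial>lborel) \<longlonglongrightarrow> (\<integral>x. indicator {b<..} x * \<Lambda> x \<partial>M)"
    by (rule conv, rule Glim) simp
  then show "(\<lambda>n. real (Suc n) * (\<integral>y. indicator {b<..b + 1 / real (Suc n)} y * score_tail y \<partial>lborel)) \<longlonglongrightarrow>
     (\<integral>x. indicator {b<..} x * \<Lambda> x \<partial>M)"
    using scale[of _ 0 1] by (simp del: of_nat_Suc)
qed


lemma first_moment_integrable: "integrable M (\<lambda>x. indicator {a<..b} x * x)"
proof (rule integrable_const_bound[of _ "\<bar>a\<bar> + \<bar>b\<bar>"])
  show "AE x in M. norm (indicator {a<..b} x * x) \<le> \<bar>a\<bar> + \<bar>b\<bar>"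
    by (intro AE_I2) (auto simp: indicator_def)
qed measurable

lemma score_tail_nonneg: "b > 0 \<Longrightarrow> 0 \<le> score_tail b"
proof -
  assume b: "b > 0"
  show "0 \<le> score_tail b"
  proof (rule tendsto_lowerbound[OF one_sided_averages(1)])
    have "(\<lambda>n. 1 / real (Suc n)) \<longlonglongrightarrow> 0" by (rule LIMSEQ_Suc[OF lim_1_over_n])
    from order_tendstoD(2)[OF this b]
    show "\<forall>\<^sub>F n in sequentially. 0 \<le> real (Suc n) * (\<integral>y. indicator {b - 1 / real (Suc n)<..b} y * score_tail y \<partial>lborel)"
    proof eventually_elim
      case (elim n)
      have "0 \<le> (\<integral>x. indicator {b - 1 / real (Suc n)<..b} x * x \<partial>M)"
        using elim by (intro integral_nonneg_AE AE_I2) (auto simp: indicator_def simp del: of_nat_Suc)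
      also have "\<dots> = (\<integral>y. indicator {b - 1 / real (Suc n)<..b} y * score_tail y \<partial>lborel)"
        by (rule interval_identity) simp
      finally show ?case by simp
    qed
  qed simp
qed

lemma score_tail_nonpos: "b < 0 \<Longrightarrow> score_tail b \<le> 0"
proof -
  assume b: "b < 0"
  show "score_tail b \<le> 0"
  proof (rule tendsto_upperbound[OF one_sided_averages(1)])
    show "\<forall>\<^sub>F n in sequentially. real (Suc n) * (\<integral>y. indicator {b - 1 / real (Suc n)<..b} y * score_tail y \<partial>lborel) \<le> 0"
    proof (intro always_eventually allI)
      fix n
      have "(\<integral>y. indicator {b - 1 / real (Suc n)<..b} y * score_tail y \<partial>lborel) = (\<integral>x. indicator {b - 1 / real (Suc n)<..b} x * x \<partial>M)"
        by (rule interval_identity[symmetric]) simp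
      also have "\<dots> = - (\<integral>x. - (indicator {b - 1 / real (Suc n)<..b} x * x) \<partial>M)"
        by simp
      also have "\<dots> \<le> 0"
        unfolding neg_le_0_iff_le
        using b by (intro integral_nonneg_AE AE_I2) (auto simp: indicator_def simp del: of_nat_Suc)
      finally show "real (Suc n) * (\<integral>y. indicator {b - 1 / real (Suc n)<..b} y * score_tail y \<partial>lborel) \<le> 0"
        by (intro mult_nonneg_nonpos) auto
    qed
  qed simp
qed

text \<open>On \<open>S n\<close> the integrand \<open>(n + 1) x\<close> is bounded by \<open>1\<close>, and it tends to \<open>0\<close> pointwise, also at the
possible atom \<open>x = 0\<close>.\<close>

lemma origin_average:
  assumes S: "\<And>n. S n = {-1 / real (Suc n)<..0} \<or> S n = {0<..1 / real (Suc n)}"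
  shows "(\<lambda>n. real (Suc n) * (\<integral>x. indicator (S n) x * x \<partial>M)) \<longlonglongrightarrow> 0"
proof -
  have Sm[measurable]: "S n \<in> sets borel" for n using S[of n] by auto
  have "(\<lambda>n. \<integral>x. real (Suc n) * (indicator (S n) x * x) \<partial>M) \<longlonglongrightarrow> (\<integral>x. 0 \<partial>M)"
  proof (rule integral_dominated_convergence[where w="\<lambda>_. 1"])
    show "AE x in M. (\<lambda>n. real (Suc n) * (indicator (S n) x * x)) \<longlonglongrightarrow> 0"
    proof (intro AE_I2)
      fix x
      show "(\<lambda>n. real (Suc n) * (indicator (S n) x * x)) \<longlonglongrightarrow> 0"
      proof (cases "x = 0")
        case False
        have "(\<lambda>n. 1 / real (Suc n)) \<longlonglongrightarrow> 0" by (rule LIMSEQ_Suc[OF lim_1_over_n])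
        moreover have "\<bar>x\<bar> > 0" using False by simp
        ultimately have "\<forall>\<^sub>F n in sequentially. 1 / real (Suc n) < \<bar>x\<bar>"
          by (rule order_tendstoD(2))
        then have "\<forall>\<^sub>F n in sequentially. real (Suc n) * (indicator (S n) x * x) = 0"
        proof eventually_elim
          case (elim n)
          then have "x \<notin> S n" using S[of n] by (auto simp del: of_nat_Suc)
          then show ?case by simp
        qed
        then show ?thesis by (rule tendsto_eventually)
      qed simp
    qed
    show "AE x in M. norm (real (Suc n) * (indicator (S n) x * x)) \<le> 1" for n
    proof (intro AE_I2)
      fix x
      show "norm (real (Suc n) * (indicator (S n) x * x)) \<le> 1"
      proof (cases "x \<in> S n")
        case True
        then have "\<bar>x\<bar> \<le> 1 / real (Suc n)" using S[of n] by (auto simp del: of_nat_Suc)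
        then have "\<bar>x\<bar> * real (Suc n) \<le> 1" by (simp add: pos_le_divide_eq del: of_nat_Suc)
        then show ?thesis using True by (simp add: abs_mult mult.commute del: of_nat_Suc)
      qed simp
    qed
  qed auto
  then show ?thesis by (simp del: of_nat_Suc)
qed

text \<open>Both one-sided limits of the tail at the origin are limits of averages of \<open>x\<close> under \<open>M\<close>, hence zero. Their
equality rules out a contribution of an atom at the origin to the score.\<close>

lemma score_tail_zero: "score_tail 0 = 0" and score_tail_right_zero: "(\<integral>x. indicator {0<..} x * \<Lambda> x \<partial>M) = 0"
proof -
  have "(\<lambda>n. real (Suc n) * (\<integral>x. indicator {- 1 / real (Suc n)<..0} x * x \<partial>M)) \<longlonglongrightarrow> 0"
    by (rule origin_average) simp
  moreover have "(\<integral>x. indicator {- 1 / real (Suc n)<..0} x * x \<partial>M) = (\<integral>y. indicator {0 - 1 / real (Suc n)<..0} y * score_tail y \<partial>lborel)" for n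
    by (subst interval_identity) (simp_all del: of_nat_Suc)
  ultimately show "score_tail 0 = 0"
    using LIMSEQ_unique[OF one_sided_averages(1)[of 0]] by simp
  have "(\<lambda>n. real (Suc n) * (\<integral>x. indicator {0<..1 / real (Suc n)} x * x \<partial>M)) \<longlonglongrightarrow> 0"
    by (rule origin_average) simp
  moreover have "(\<integral>x. indicator {0<..1 / real (Suc n)} x * x \<partial>M) = (\<integral>y. indicator {0<..0 + 1 / real (Suc n)} y * score_tail y \<partial>lborel)" for n
    by (subst interval_identity) (simp_all del: of_nat_Suc)
  ultimately show "(\<integral>x. indicator {0<..} x * \<Lambda> x \<partial>M) = 0"
    using LIMSEQ_unique[OF one_sided_averages(2)[of 0]] by simp
qed

lemma \<Lambda>_zero_atom: "\<Lambda> 0 = 0 \<or> measure M {0} = 0"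
proof -
  have "(\<integral>x. indicator {0..} x * \<Lambda> x \<partial>M) = (\<integral>x. indicator {0<..} x * \<Lambda> x + indicator {0} x * \<Lambda> 0 \<partial>M)"
    by (intro Bochner_Integration.integral_cong) (auto simp: indicator_def)
  also have "\<dots> = (\<integral>x. indicator {0<..} x * \<Lambda> x \<partial>M) + (\<integral>x. indicator {0} x * \<Lambda> 0 \<partial>M)"
  proof (rule Bochner_Integration.integral_add)
    show "integrable M (\<lambda>x. indicator {0<..} x * \<Lambda> x)" by (rule score_on_int) simp
    show "integrable M (\<lambda>x. indicator {0} x * \<Lambda> 0)"
      by (rule integrable_const_bound[of _ "\<bar>\<Lambda> 0\<bar>"]) (auto simp: indicator_def)
  qed
  also have "\<dots> = measure M {0} * \<Lambda> 0"
    using score_tail_right_zero by simp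
  finally show ?thesis
    using score_tail_zero unfolding score_tail_def by auto
qed

lemma emeasure_same_sign:
  assumes ab: "a \<le> b" "0 \<le> a \<or> b \<le> 0"
  shows "(\<integral>\<^sup>+x. ennreal \<bar>x\<bar> * indicator {a<..b} x \<partial>M) = (\<integral>\<^sup>+x. ennreal \<bar>score_tail x\<bar> * indicator {a<..b} x \<partial>lborel)"
proof (cases "a = b")
  case False
  then have lt: "a < b" using ab by simp
  define s where "s = (if 0 \<le> a then 1 else - 1 :: real)"
  have s: "\<bar>x\<bar> * indicator {a<..b} x = s * (indicator {a<..b} x * x)" for x
    using ab lt by (auto simp: s_def indicator_def)
  have sG: "\<bar>score_tail x\<bar> * indicator {a<..b} x = s * (indicator {a<..b} x * score_tail x)" for x
    using ab lt score_tail_nonneg[of x] score_tail_nonpos[of x] score_tail_zero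
    by (cases "x = 0") (auto simp: s_def indicator_def abs_if)
  have "(\<integral>\<^sup>+x. ennreal \<bar>x\<bar> * indicator {a<..b} x \<partial>M) = (\<integral>\<^sup>+x. ennreal (\<bar>x\<bar> * indicator {a<..b} x) \<partial>M)"
    by (intro nn_integral_cong) (auto simp: indicator_def)
  also have "\<dots> = ennreal (\<integral>x. \<bar>x\<bar> * indicator {a<..b} x \<partial>M)"
  proof (rule nn_integral_eq_integral)
    show "integrable M (\<lambda>x. \<bar>x\<bar> * indicator {a<..b} x)"
      unfolding s using first_moment_integrable[of a b] by simp
  qed simp
  also have "(\<integral>x. \<bar>x\<bar> * indicator {a<..b} x \<partial>M) = (\<integral>x. \<bar>score_tail x\<bar> * indicator {a<..b} x \<partial>lborel)"
    unfolding s sG using interval_identity[OF lt] by simp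
  also have "ennreal \<dots> = (\<integral>\<^sup>+x. ennreal (\<bar>score_tail x\<bar> * indicator {a<..b} x) \<partial>lborel)"
  proof (rule nn_integral_eq_integral[symmetric])
    show "integrable lborel (\<lambda>x. \<bar>score_tail x\<bar> * indicator {a<..b} x)"
    proof (rule Bochner_Integration.integrable_bound)
      show "integrable lborel (\<lambda>x. indicator {a<..b} x * score_L1)"
        using integrable_real_indicator[of "{a<..b}" lborel] ab by simp
    qed (use score_tail_bound in \<open>auto simp: indicator_def intro!: AE_I2 order_trans[OF score_tail_bound abs_ge_self]\<close>)
  qed auto
  also have "\<dots> = (\<integral>\<^sup>+x. ennreal \<bar>score_tail x\<bar> * indicator {a<..b} x \<partial>lborel)"
    by (intro nn_integral_cong) (auto simp: indicator_def)
  finally show ?thesis .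
qed simp

text \<open>Signs are removed to obtain an identity between measures; the tail has the sign of its argument.\<close>

lemma abs_density_eq: "density M (\<lambda>x. ennreal \<bar>x\<bar>) = density lborel (\<lambda>x. ennreal \<bar>score_tail x\<bar>)"
proof (rule measure_eqI_generator_eq[where E="range (\<lambda>(a, b). {a<..b::real})" and \<Omega>=UNIV and A="\<lambda>i::nat. {-real i<..real i}"])
  have Ioc: "(\<integral>\<^sup>+x. ennreal \<bar>x\<bar> * indicator {a<..b} x \<partial>M) = (\<integral>\<^sup>+x. ennreal \<bar>score_tail x\<bar> * indicator {a<..b} x \<partial>lborel)" for a b
  proof -
    consider "a \<le> b" "0 \<le> a \<or> b \<le> 0" | "a < 0" "0 < b" | "b < a" by force
    then show ?thesis
    proof cases
      case 2
      have split: "indicator {a<..b} x = (indicator {a<..0} x + indicator {0<..b} x :: ennreal)" for x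
        using 2 by (auto simp: indicator_def)
      show ?thesis
        unfolding split distrib_left using emeasure_same_sign[of a 0] emeasure_same_sign[of 0 b] 2
        by (subst (1 2) nn_integral_add) auto
    qed (use emeasure_same_sign in auto)
  qed
  show "emeasure (density M (\<lambda>x. ennreal \<bar>x\<bar>)) X = emeasure (density lborel (\<lambda>x. ennreal \<bar>score_tail x\<bar>)) X"
    if "X \<in> range (\<lambda>(a, b). {a<..b::real})" for X
    using that Ioc by (auto simp: emeasure_density)
  show "Int_stable (range (\<lambda>(a, b). {a<..b::real}))"
  proof (rule Int_stableI)
    fix X Y :: "real set"
    assume X: "X \<in> range (\<lambda>(a, b). {a<..b::real})" and Y: "Y \<in> range (\<lambda>(a, b). {a<..b::real})"
    obtain p where "X = (\<lambda>(a, b). {a<..b}) p"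
      using X by (rule rangeE)
    moreover obtain q where "Y = (\<lambda>(a, b). {a<..b}) q"
      using Y by (rule rangeE)
    ultimately obtain a b a' b' where "X = {a<..b}" "Y = {a'<..b'}"
      by (cases p; cases q) simp
    then have "X \<inter> Y = {max a a'<..min b b'}"
      by (simp add: Int_greaterThanAtMost)
    then have "X \<inter> Y = (\<lambda>(a, b). {a<..b}) (max a a', min b b')" by simp
    then show "X \<inter> Y \<in> range (\<lambda>(a, b). {a<..b::real})" by (rule range_eqI)
  qed
  show "sets (density M (\<lambda>x. ennreal \<bar>x\<bar>)) = sigma_sets UNIV (range (\<lambda>(a, b). {a<..b::real}))"
    by (simp add: borel_sigma_sets_Ioc)
  show "sets (density lborel (\<lambda>x. ennreal \<bar>score_tail x\<bar>)) = sigma_sets UNIV (range (\<lambda>(a, b). {a<..b::real}))"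
    by (simp add: borel_sigma_sets_Ioc)
  show "(\<Union>i. {-real i<..real i}) = UNIV"
  proof (intro set_eqI iffI UNIV_I)
    fix x :: real
    obtain n where "\<bar>x\<bar> < real n" using reals_Archimedean2 by blast
    then have "x \<in> {-real n<..real n}" by auto
    then show "x \<in> (\<Union>i. {-real i<..real i})" by blast
  qed
  fix i :: nat
  have "(\<integral>\<^sup>+x. ennreal \<bar>x\<bar> * indicator {-real i<..real i} x \<partial>M) \<le> (\<integral>\<^sup>+x. ennreal (real i) \<partial>M)"
    by (intro nn_integral_mono) (auto simp: indicator_def intro!: ennreal_leI)
  also have "\<dots> < \<infinity>" using emeasure_space_1 by simp
  finally show "emeasure (density M (\<lambda>x. ennreal \<bar>x\<bar>)) {-real i<..real i} \<noteq> \<infinity>"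
    by (simp add: emeasure_density)
qed auto

definition tail_density :: "real \<Rightarrow> real" where
  "tail_density x = \<bar>score_tail x\<bar> / \<bar>x\<bar>"

lemma tail_density_meas[measurable]: "tail_density \<in> borel_measurable borel"
  unfolding tail_density_def by measurable

lemma tail_density_nonneg: "0 \<le> tail_density x"
  by (simp add: tail_density_def)

lemma x_tail_density: "x * tail_density x = score_tail x"
  using score_tail_nonneg[of x] score_tail_nonpos[of x] score_tail_zero by (cases x "0::real" rule: linorder_cases) (auto simp: tail_density_def)

lemma remove_zero_mass_density: "remove_zero_mass M = density lborel (\<lambda>x. ennreal (tail_density x))"
proof -
  have "remove_zero_mass M = density (density M (\<lambda>x. ennreal \<bar>x\<bar>)) (\<lambda>x. ennreal (1 / \<bar>x\<bar>))"
    unfolding remove_zero_mass_def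
    by (subst density_density_eq) (auto intro!: density_cong simp: indicator_def ennreal_mult'[symmetric])
  also have "\<dots> = density lborel (\<lambda>x. ennreal (tail_density x))"
    unfolding abs_density_eq
    by (subst density_density_eq) (auto intro!: density_cong simp: tail_density_def ennreal_mult'[symmetric])
  finally show ?thesis .
qed

end

lemma (in real_distribution) nn_integral_zero_split:
  assumes F: "remove_zero_mass M = density lborel (\<lambda>x. ennreal (f x))" and [measurable]: "f \<in> borel_measurable borel"
    and u[measurable]: "u \<in> borel_measurable borel"
  shows "(\<integral>\<^sup>+x. u x \<partial>M) = (\<integral>\<^sup>+x. ennreal (f x) * u x \<partial>lborel) + u 0 * emeasure M {0}"
proof -
  have "(\<integral>\<^sup>+x. u x \<partial>M) = (\<integral>\<^sup>+x. indicator (- {0}) x * u x + u 0 * indicator {0} x \<partial>M)"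
    by (intro nn_integral_cong) (auto simp: indicator_def)
  also have "\<dots> = (\<integral>\<^sup>+x. indicator (- {0}) x * u x \<partial>M) + u 0 * emeasure M {0}"
    by (subst nn_integral_add) (auto simp: nn_integral_cmult)
  also have "(\<integral>\<^sup>+x. indicator (- {0}) x * u x \<partial>M) = (\<integral>\<^sup>+x. u x \<partial>remove_zero_mass M)"
    unfolding remove_zero_mass_def by (subst nn_integral_density) auto
  also have "\<dots> = (\<integral>\<^sup>+x. ennreal (f x) * u x \<partial>lborel)"
    unfolding F by (subst nn_integral_density) auto
  finally show ?thesis .
qed

lemma (in real_distribution) integral_vanishing_at_zero:
  fixes u :: "real \<Rightarrow> real"
  assumes F: "remove_zero_mass M = density lborel (\<lambda>x. ennreal (f x))" and [measurable]: "f \<in> borel_measurable borel"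
    and f0: "\<And>x. 0 \<le> f x" and u[measurable]: "u \<in> borel_measurable borel" and u0: "u 0 = 0"
  shows "integrable M u \<longleftrightarrow> integrable lborel (\<lambda>x. f x * u x)"
    and "(\<integral>x. u x \<partial>M) = (\<integral>x. f x * u x \<partial>lborel)"
proof -
  have u_eq: "(\<lambda>x. (indicator (- {0}) x :: real) *\<^sub>R u x) = u"
    using u0 by (auto simp: indicator_def)
  have "remove_zero_mass M = density M (\<lambda>x. ennreal (indicator (- {0}) x))"
    unfolding remove_zero_mass_def by (intro density_cong) (auto simp: indicator_def)
  then have *: "density M (\<lambda>x. ennreal (indicator (- {0}) x)) = density lborel (\<lambda>x. ennreal (f x))"
    using F by simp
  have "integrable M u \<longleftrightarrow> integrable M (\<lambda>x. indicator (- {0}) x *\<^sub>R u x)"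
    unfolding u_eq ..
  also have "\<dots> \<longleftrightarrow> integrable (density M (\<lambda>x. ennreal (indicator (- {0}) x))) u"
    by (rule integrable_density[symmetric]) auto
  also have "\<dots> \<longleftrightarrow> integrable lborel (\<lambda>x. f x *\<^sub>R u x)"
    unfolding * by (rule integrable_density) (use f0 in auto)
  finally show "integrable M u \<longleftrightarrow> integrable lborel (\<lambda>x. f x * u x)" by simp
  have "(\<integral>x. u x \<partial>M) = (\<integral>x. indicator (- {0}) x *\<^sub>R u x \<partial>M)"
    unfolding u_eq ..
  also have "\<dots> = (\<integral>x. u x \<partial>density M (\<lambda>x. ennreal (indicator (- {0}) x)))"
    by (rule integral_density[symmetric]) auto
  also have "\<dots> = (\<integral>x. f x *\<^sub>R u x \<partial>lborel)"
    unfolding * by (rule integral_density) (use f0 in auto)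
  finally show "(\<integral>x. u x \<partial>M) = (\<integral>x. f x * u x \<partial>lborel)" by simp
qed

text \<open>Changing \<open>\<Lambda>\<close> at the origin is harmless by \<open>\<Lambda>_zero_atom\<close>; with \<open>\<Lambda> 0 = 0\<close>, integrals of the score
under \<open>M\<close> are integrals against the density.\<close>

theorem (in scale_score_function) density_regularity:
  assumes \<Lambda>0: "\<Lambda> 0 = 0"
  shows "scale_regular_density tail_density \<Lambda>" "has_scale_density M tail_density"
proof -
  note split = integral_vanishing_at_zero[OF remove_zero_mass_density tail_density_meas tail_density_nonneg]
  have fi: "integrable lborel tail_density"
  proof (rule integrableI_nonneg)
    have "(\<integral>\<^sup>+x. ennreal (tail_density x) \<partial>lborel) = emeasure (remove_zero_mass M) UNIV"
      unfolding remove_zero_mass_density by (simp add: emeasure_density)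
    also have "\<dots> = emeasure M (- {0})"
      unfolding remove_zero_mass_def by (simp add: emeasure_density)
    also have "\<dots> < \<infinity>" by (simp add: less_top[symmetric])
    finally show "(\<integral>\<^sup>+x. ennreal (tail_density x) \<partial>lborel) < \<infinity>" .
  qed (use tail_density_nonneg in auto)
  have \<Lambda>2: "integrable lborel (\<lambda>x. (\<Lambda> x)\<^sup>2 * tail_density x)"
    using split(1)[of "\<lambda>x. (\<Lambda> x)\<^sup>2"] \<Lambda>0 \<Lambda>_sq by (simp add: mult.commute)
  have \<Lambda>1: "integrable lborel (\<lambda>x. - (\<Lambda> x * tail_density x))"
    using split(1)[of \<Lambda>] \<Lambda>0 \<Lambda>_int by (simp add: mult.commute)
  have incr: "b * tail_density b - a * tail_density a = (LINT y:{a..b}|lborel. - (\<Lambda> y * tail_density y))" if "a \<le> b" for a b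
  proof -
    have "b * tail_density b - a * tail_density a = - (\<integral>x. tail_density x * (indicator {a..<b} x * \<Lambda> x) \<partial>lborel)"
      unfolding x_tail_density score_tail_diff[OF that] using \<Lambda>0 by (subst split(2)) auto
    also have "\<dots> = (\<integral>x. - (tail_density x * (indicator {a..<b} x * \<Lambda> x)) \<partial>lborel)"
      by simp
    also have "\<dots> = (LINT y:{a..b}|lborel. - (\<Lambda> y * tail_density y))"
      unfolding set_lebesgue_integral_def
      by (intro integral_cong_AE eventually_mono[OF AE_lborel_singleton[of b]]) (auto simp: indicator_def)
    finally show ?thesis .
  qed
  have ac: "absolutely_continuous_fun (\<lambda>x. x * tail_density x)"
    by (rule absolutely_continuous_fun_indefinite_integral[OF \<Lambda>1]) (use incr in auto)
  show "scale_regular_density tail_density \<Lambda>"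
    by unfold_locales (use tail_density_nonneg fi \<Lambda>2 absolutely_continuous_fun_imp_continuous[OF ac] incr in auto)
  show "has_scale_density M tail_density"
    unfolding has_scale_density_def using tail_density_nonneg remove_zero_mass_density ac by simp
qed

section \<open>Likelihood ratios\<close>

text \<open>Uniqueness of the likelihood ratio: two versions agree off the union of their exceptional null sets.\<close>

lemma likelihood_ratio_AE_eq:
  assumes M: "sigma_finite_measure M" and [measurable_cong]: "sets N = sets M"
    and L[measurable]: "L \<in> borel_measurable M" and S: "S \<in> null_sets M"
    and eq: "density M L = density N (indicator (space M - S))"
  shows "likelihood_ratio N M \<in> borel_measurable M" "AE x in M. likelihood_ratio N M x = L x"
proof -
  interpret sigma_finite_measure M by fact
  define L' where "L' = likelihood_ratio N M"
  have "L' \<in> borel_measurable M \<and> (\<exists>S\<in>null_sets M. density M L' = density N (indicator (space M - S)))"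
    unfolding L'_def likelihood_ratio_def by (rule someI[of _ L]) (use L S eq in blast)
  then obtain S' where L'[measurable]: "L' \<in> borel_measurable M" and S': "S' \<in> null_sets M"
    and eq': "density M L' = density N (indicator (space M - S'))" by blast
  show "likelihood_ratio N M \<in> borel_measurable M" using L' by (simp add: L'_def)
  have [measurable]: "S \<in> sets M" "S' \<in> sets M" using S S' by auto
  let ?U = "space M - (S \<union> S')"
  have ind: "indicator ?U x = (indicator (space M - S) x * indicator ?U x :: ennreal)"
    "indicator ?U x = (indicator (space M - S') x * indicator ?U x :: ennreal)" for x
    by (auto simp: indicator_def)
  have "density (density M L) (indicator ?U) = density (density M L') (indicator ?U)"
    unfolding eq eq'
    by (subst (1 2) density_density_eq) (auto intro!: density_cong simp: indicator_def)
  then have "density M (\<lambda>x. L x * indicator ?U x) = density M (\<lambda>x. L' x * indicator ?U x)"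
    by (subst (asm) (1 2) density_density_eq) auto
  then have "AE x in M. L x * indicator ?U x = L' x * indicator ?U x"
    by (intro density_unique) auto
  moreover have "AE x in M. x \<notin> S" "AE x in M. x \<notin> S'" using S S' by (auto intro: AE_not_in)
  ultimately show "AE x in M. likelihood_ratio N M x = L x"
    using AE_space by eventually_elim (auto simp: L'_def indicator_def)
qed

text \<open>The singular part of the product is carried by the complement of the rectangle of regular points, which is
again a null set. Both sides of the defining identity are then the product of the measures
\<open>density M L\<close>.\<close>

lemma likelihood_ratio_PiM:
  fixes L :: "'a \<Rightarrow> ennreal"
  assumes M: "prob_space M" and N: "prob_space N" and sets[measurable_cong]: "sets N = sets M"
    and L[measurable]: "L \<in> borel_measurable M" and S: "S \<in> null_sets M"
    and eq: "density M L = density N (indicator (space M - S))" and I: "finite I"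
  shows "likelihood_ratio (PiM I (\<lambda>_. N)) (PiM I (\<lambda>_. M)) \<in> borel_measurable (PiM I (\<lambda>_. M))"
    "AE x in PiM I (\<lambda>_. M). likelihood_ratio (PiM I (\<lambda>_. N)) (PiM I (\<lambda>_. M)) x = (\<Prod>i\<in>I. L (x i))"
proof -
  interpret M: prob_space M by fact
  interpret N: prob_space N by fact
  interpret PM: product_sigma_finite "\<lambda>_. M" by unfold_locales
  interpret PN: product_sigma_finite "\<lambda>_. N" by unfold_locales
  let ?M = "PiM I (\<lambda>_. M)" and ?N = "PiM I (\<lambda>_. N)"
  interpret pM: prob_space ?M by (intro prob_space_PiM M)
  interpret pN: prob_space ?N by (intro prob_space_PiM N)
  have sp: "space N = space M" using sets by (rule sets_eq_imp_space_eq)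
  have sM[measurable_cong]: "sets ?N = sets ?M" by (intro sets_PiM_cong) (auto simp: sets)
  have Sm[measurable]: "S \<in> sets M" using S by auto
  let ?S = "space ?M - (\<Pi>\<^sub>E i\<in>I. space M - S)"
  have good: "(\<Pi>\<^sub>E i\<in>I. space M - S) \<in> sets ?M"
    using I by (intro sets_PiM_I_finite) auto
  \<comment> \<open>Off \<open>?S\<close> every coordinate avoids \<open>S\<close>.\<close>
  have nullS: "?S \<in> null_sets ?M"
  proof (rule null_setsI)
    have "emeasure M (space M - S) = 1"
      using S by (subst emeasure_Diff_null_set) (auto simp: M.emeasure_space_1)
    then have "emeasure ?M (\<Pi>\<^sub>E i\<in>I. space M - S) = 1"
      using I by (subst PM.emeasure_PiM) auto
    then show "emeasure ?M ?S = 0"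
      using good pM.emeasure_space_1 by (subst emeasure_compl) auto
    show "?S \<in> sets ?M" using good by auto
  qed
  have Lm[measurable]: "(\<lambda>x. \<Prod>i\<in>I. L (x i)) \<in> borel_measurable ?M"
  proof (intro borel_measurable_prod_ennreal)
    fix i assume "i \<in> I"
    then have "(\<lambda>x. x i) \<in> measurable ?M M" by (rule measurable_component_singleton)
    then show "(\<lambda>x. L (x i)) \<in> borel_measurable ?M" using L by (rule measurable_compose)
  qed
  have fin: "\<And>A. A \<in> sets M \<Longrightarrow> (\<integral>\<^sup>+x. L x * indicator A x \<partial>M) = emeasure N (A - S)"
  proof -
    fix A assume A[measurable]: "A \<in> sets M"
    have "(\<integral>\<^sup>+x. L x * indicator A x \<partial>M) = emeasure (density M L) A"
      by (simp add: emeasure_density)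
    also have "\<dots> = (\<integral>\<^sup>+x. indicator (space M - S) x * indicator A x \<partial>N)"
      unfolding eq by (subst emeasure_density) auto
    also have "\<dots> = (\<integral>\<^sup>+x. indicator (A - S) x \<partial>N)"
      using sets.sets_into_space[OF A] by (intro nn_integral_cong) (auto simp: indicator_def)
    also have "\<dots> = emeasure N (A - S)" by simp
    finally show "(\<integral>\<^sup>+x. L x * indicator A x \<partial>M) = emeasure N (A - S)" .
  qed
  have main: "density ?M (\<lambda>x. \<Prod>i\<in>I. L (x i)) = PiM I (\<lambda>_. density M L)"
  proof -
    have fm: "finite_measure (density M L)"
      using fin[OF sets.top] by (intro finite_measureI) (simp add: emeasure_density)
    interpret D: finite_measure "density M L" by (rule fm)
    interpret PD: product_sigma_finite "\<lambda>_. density M L" by unfold_locales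
    show ?thesis
    proof (rule PD.PiM_eqI[OF I])
      show "sets (density ?M (\<lambda>x. \<Prod>i\<in>I. L (x i))) = sets (PiM I (\<lambda>_. density M L))"
        by (auto intro!: sets_PiM_cong)
      fix A assume A: "\<And>i. i \<in> I \<Longrightarrow> A i \<in> sets (density M L)"
      then have A'[measurable]: "\<And>i. i \<in> I \<Longrightarrow> A i \<in> sets M" by simp
      have PA: "Pi\<^sub>E I A \<in> sets ?M" using I A' by (intro sets_PiM_I_finite) auto
      have "emeasure (density ?M (\<lambda>x. \<Prod>i\<in>I. L (x i))) (Pi\<^sub>E I A)
          = (\<integral>\<^sup>+x. (\<Prod>i\<in>I. L (x i)) * indicator (Pi\<^sub>E I A) x \<partial>?M)"
        using PA by (subst emeasure_density) auto
      also have "\<dots> = (\<integral>\<^sup>+x. (\<Prod>i\<in>I. L (x i) * indicator (A i) (x i)) \<partial>?M)"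
      proof (intro nn_integral_cong)
        fix x assume x: "x \<in> space ?M"
        have "indicator (Pi\<^sub>E I A) x = (\<Prod>i\<in>I. indicator (A i) (x i) :: ennreal)"
          using x I by (auto simp: indicator_def space_PiM PiE_iff prod.neutral intro!: prod_zero)
        then show "(\<Prod>i\<in>I. L (x i)) * indicator (Pi\<^sub>E I A) x = (\<Prod>i\<in>I. L (x i) * indicator (A i) (x i))"
          by (simp add: prod.distrib)
      qed
      also have "\<dots> = (\<Prod>i\<in>I. \<integral>\<^sup>+x. L x * indicator (A i) x \<partial>M)"
        using I A' by (intro PM.product_nn_integral_prod) auto
      also have "\<dots> = (\<Prod>i\<in>I. emeasure (density M L) (A i))"
        using A' by (intro prod.cong refl) (simp add: emeasure_density)
      finally show "emeasure (density ?M (\<lambda>x. \<Prod>i\<in>I. L (x i))) (Pi\<^sub>E I A) = (\<Prod>i\<in>I. emeasure (density M L) (A i))" .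
    qed
  qed
  have main2: "density ?N (indicator (space ?M - ?S)) = PiM I (\<lambda>_. density M L)"
  proof -
    have fm: "finite_measure (density M L)"
      using fin[OF sets.top] by (intro finite_measureI) (simp add: emeasure_density)
    interpret D: finite_measure "density M L" by (rule fm)
    interpret PD: product_sigma_finite "\<lambda>_. density M L" by unfold_locales
    have compl: "space ?M - ?S = (\<Pi>\<^sub>E i\<in>I. space M - S)"
      using sets.sets_into_space[OF good] by auto
    show ?thesis
    proof (rule PD.PiM_eqI[OF I])
      show "sets (density ?N (indicator (space ?M - ?S))) = sets (PiM I (\<lambda>_. density M L))"
        by (auto intro!: sets_PiM_cong simp: sM)
      fix A assume A: "\<And>i. i \<in> I \<Longrightarrow> A i \<in> sets (density M L)"
      then have A'[measurable]: "\<And>i. i \<in> I \<Longrightarrow> A i \<in> sets M" by simp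
      have PA: "Pi\<^sub>E I A \<in> sets ?M" using I A' by (intro sets_PiM_I_finite) auto
      have "emeasure (density ?N (indicator (space ?M - ?S))) (Pi\<^sub>E I A)
          = (\<integral>\<^sup>+x. indicator (\<Pi>\<^sub>E i\<in>I. space M - S) x * indicator (Pi\<^sub>E I A) x \<partial>?N)"
        unfolding compl using PA good by (subst emeasure_density) (auto simp: sM)
      also have "\<dots> = (\<integral>\<^sup>+x. indicator (\<Pi>\<^sub>E i\<in>I. A i - S) x \<partial>?N)"
        using sets.sets_into_space[OF A'] by (intro nn_integral_cong) (auto simp: indicator_def PiE_iff)
      also have "\<dots> = emeasure ?N (\<Pi>\<^sub>E i\<in>I. A i - S)"
        using I A' sets by (intro nn_integral_indicator sets_PiM_I_finite) auto
      also have "\<dots> = (\<Prod>i\<in>I. emeasure N (A i - S))"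
        using I A' sets by (intro PN.emeasure_PiM) auto
      also have "\<dots> = (\<Prod>i\<in>I. emeasure (density M L) (A i))"
        using A' by (intro prod.cong refl) (simp add: emeasure_density fin)
      finally show "emeasure (density ?N (indicator (space ?M - ?S))) (Pi\<^sub>E I A) = (\<Prod>i\<in>I. emeasure (density M L) (A i))" .
    qed
  qed
  have sf: "sigma_finite_measure ?M" by unfold_locales
  have eq: "density ?M (\<lambda>x. \<Prod>i\<in>I. L (x i)) = density ?N (indicator (space ?M - ?S))"
    using main main2 by simp
  from likelihood_ratio_AE_eq[OF sf sM Lm nullS eq]
  show "likelihood_ratio ?N ?M \<in> borel_measurable ?M" "AE x in ?M. likelihood_ratio ?N ?M x = (\<Prod>i\<in>I. L (x i))"
    by auto
qed

text \<open>The right-hand side does not mention \<open>\<mu>\<close>: off \<open>S\<close> the \<open>\<mu>\<close>-densities satisfy \<open>p = q L\<close>, and on \<open>S\<close>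
one has \<open>q = 0\<close>.\<close>

lemma L2_distance_by_likelihood_ratio:
  fixes \<mu> P Q :: "real measure" and L w :: "real \<Rightarrow> real"
  assumes \<mu>: "dominates \<mu> P" "dominates \<mu> Q" and P: "real_distribution P" and Q: "real_distribution Q"
    and [measurable]: "L \<in> borel_measurable borel" "w \<in> borel_measurable borel" and L0: "\<And>x. 0 \<le> L x"
    and S: "S \<in> null_sets Q"
    and eq: "density Q (\<lambda>x. ennreal (L x)) = density P (indicator (- S))"
  shows "(\<integral>\<^sup>+x. ennreal ((root_density \<mu> P x - root_density \<mu> Q x * w x)\<^sup>2) \<partial>\<mu>)
      = (\<integral>\<^sup>+x. ennreal ((sqrt (L x) - w x)\<^sup>2) \<partial>Q) + emeasure P S"
proof -
  interpret P: real_distribution P by fact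
  interpret Q: real_distribution Q by fact
  have sb[measurable_cong]: "sets \<mu> = sets borel" using \<mu>(1) by (simp add: dominates_def)
  interpret sigma_finite_measure \<mu> using \<mu>(1) by (simp add: dominates_def)
  define p q where "p = RN_deriv \<mu> P" and "q = RN_deriv \<mu> Q"
  have [measurable]: "p \<in> borel_measurable borel" "q \<in> borel_measurable borel"
    using borel_measurable_RN_deriv[of \<mu> P] borel_measurable_RN_deriv[of \<mu> Q]
    unfolding p_def q_def measurable_cong_sets[OF sb refl] by auto
  have Sm[measurable]: "S \<in> sets borel" using S by auto
  have dp: "density \<mu> p = P" unfolding p_def using \<mu>(1) sb by (intro density_RN_deriv) (auto simp: dominates_def)
  have dq: "density \<mu> q = Q" unfolding q_def using \<mu>(2) sb by (intro density_RN_deriv) (auto simp: dominates_def)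
  have pf: "AE x in \<mu>. p x \<noteq> \<infinity>" unfolding p_def
    using \<mu>(1) sb P.sigma_finite_measure_axioms by (intro RN_deriv_finite) (auto simp: dominates_def)
  have qf: "AE x in \<mu>. q x \<noteq> \<infinity>" unfolding q_def
    using \<mu>(2) sb Q.sigma_finite_measure_axioms by (intro RN_deriv_finite) (auto simp: dominates_def)
  have "density \<mu> (\<lambda>x. p x * indicator (- S) x) = density P (indicator (- S))"
    unfolding dp[symmetric] by (subst density_density_eq) auto
  also have "\<dots> = density \<mu> (\<lambda>x. q x * ennreal (L x))"
    unfolding eq[symmetric] dq[symmetric] by (subst density_density_eq) auto
  finally have pq: "AE x in \<mu>. p x * indicator (- S) x = q x * ennreal (L x)"
    by (intro density_unique) auto
  have "emeasure (density \<mu> q) S = 0" unfolding dq using S by auto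
  then have "(\<integral>\<^sup>+x. q x * indicator S x \<partial>\<mu>) = 0"
    by (simp add: emeasure_density)
  then have qS: "AE x in \<mu>. q x * indicator S x = 0"
    by (subst (asm) nn_integral_0_iff_AE) auto
  have "(\<integral>\<^sup>+x. ennreal ((root_density \<mu> P x - root_density \<mu> Q x * w x)\<^sup>2) \<partial>\<mu>)
      = (\<integral>\<^sup>+x. q x * ennreal ((sqrt (L x) - w x)\<^sup>2) + p x * indicator S x \<partial>\<mu>)"
  proof (intro nn_integral_cong_AE, use pf qf pq qS in eventually_elim)
    case (elim x)
    define a b where "a = enn2real (p x)" and "b = enn2real (q x)"
    have a: "p x = ennreal a" "a \<ge> 0" and b: "q x = ennreal b" "b \<ge> 0"
      using elim by (auto simp: a_def b_def less_top)
    show ?case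
    proof (cases "x \<in> S")
      case True
      then have "b = 0" using elim(4) b by simp
      then show ?thesis using True a b
        by (simp add: root_density_def p_def[symmetric] q_def[symmetric])
    next
      case False
      then have "ennreal a = ennreal (b * L x)"
        using elim(3) a b L0[of x] by (simp add: ennreal_mult)
      then have ab: "a = b * L x" using a b L0[of x] by simp
      have "(sqrt a - sqrt b * w x)\<^sup>2 = b * (sqrt (L x) - w x)\<^sup>2"
      proof -
        have "sqrt a - sqrt b * w x = sqrt b * (sqrt (L x) - w x)"
          unfolding ab by (simp add: real_sqrt_mult algebra_simps)
        then show ?thesis using b by (simp add: power_mult_distrib)
      qed
      then show ?thesis using False a b
        by (simp add: root_density_def p_def[symmetric] q_def[symmetric] ennreal_mult)
    qed
  qed
  also have "\<dots> = (\<integral>\<^sup>+x. q x * ennreal ((sqrt (L x) - w x)\<^sup>2) \<partial>\<mu>) + (\<integral>\<^sup>+x. p x * indicator S x \<partial>\<mu>)"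
    by (rule nn_integral_add) auto
  also have "(\<integral>\<^sup>+x. q x * ennreal ((sqrt (L x) - w x)\<^sup>2) \<partial>\<mu>) = (\<integral>\<^sup>+x. ennreal ((sqrt (L x) - w x)\<^sup>2) \<partial>Q)"
    unfolding dq[symmetric] by (subst nn_integral_density) auto
  also have "(\<integral>\<^sup>+x. p x * indicator S x \<partial>\<mu>) = emeasure P S"
    unfolding dp[symmetric] by (subst emeasure_density) auto
  finally show ?thesis .
qed

lemma scale_model_one: "real_distribution F \<Longrightarrow> scale_model F 1 = F"
proof -
  assume "real_distribution F"
  then interpret real_distribution F .
  show ?thesis
    unfolding scale_model_def mult_1 by (rule distr_id2) simp
qed

text \<open>The likelihood ratio of the law scaled by \<open>s\<close> with respect to the original one, when \<open>f\<close> is the density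
away from the origin. The mass at \<open>0\<close> is invariant under scaling, whence the value \<open>1\<close> there.\<close>

definition scale_ratio :: "(real \<Rightarrow> real) \<Rightarrow> real \<Rightarrow> real \<Rightarrow> real" where
  "scale_ratio f s x = (if x = 0 then 1 else if f x = 0 then 0 else f (x / s) / s / f x)"

definition singular_part :: "(real \<Rightarrow> real) \<Rightarrow> real set" where
  "singular_part f = {x. x \<noteq> 0 \<and> f x = 0}"

locale scale_density = real_distribution M for M :: "real measure" +
  fixes f :: "real \<Rightarrow> real"
  assumes f_meas[measurable]: "f \<in> borel_measurable borel" and f_nonneg: "\<And>x. 0 \<le> f x"
    and F0: "remove_zero_mass M = density lborel (\<lambda>x. ennreal (f x))"
begin

lemma ratio_meas[measurable]: "scale_ratio f s \<in> borel_measurable borel"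
  unfolding scale_ratio_def by measurable

lemma ratio_nonneg: "s > 0 \<Longrightarrow> 0 \<le> scale_ratio f s x"
  using f_nonneg by (simp add: scale_ratio_def)

lemma singular_part_meas[measurable]: "singular_part f \<in> sets borel"
  unfolding singular_part_def by measurable

lemma AE_M_from_lborel:
  assumes "AE x in lborel. R x" "R 0"
  shows "AE x in M. R x"
proof -
  obtain N where N: "{x \<in> space lborel. \<not> R x} \<subseteq> N" "emeasure lborel N = 0" "N \<in> sets lborel"
    using assms(1) by (rule AE_E)
  have [measurable]: "N \<in> sets borel" using N(3) by simp
  have "emeasure M (N - {0}) = (\<integral>\<^sup>+x. indicator (N - {0}) x \<partial>M)" by simp
  also have "\<dots> = (\<integral>\<^sup>+x. ennreal (f x) * indicator (N - {0}) x \<partial>lborel)"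
    by (subst nn_integral_zero_split[OF F0 f_meas]) auto
  also have "\<dots> = 0"
  proof (subst nn_integral_0_iff_AE)
    have "AE x in lborel. x \<notin> N" using N by (intro AE_not_in null_setsI) auto
    then show "AE x in lborel. ennreal (f x) * indicator (N - {0}) x = 0"
      by eventually_elim (auto simp: indicator_def)
  qed simp
  finally have "N - {0} \<in> null_sets M" by (intro null_setsI) auto
  then have "AE x in M. x \<notin> N - {0}" by (rule AE_not_in)
  then show ?thesis
    by eventually_elim (use N(1) assms(2) in auto)
qed

lemma nn_integral_scale_model:
  assumes s: "s > 0" and [measurable]: "u \<in> borel_measurable borel"
  shows "(\<integral>\<^sup>+x. u x \<partial>scale_model M s) = (\<integral>\<^sup>+x. ennreal (f (x / s) / s) * u x \<partial>lborel) + u 0 * emeasure M {0}"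
proof -
  have "(\<integral>\<^sup>+x. u x \<partial>scale_model M s) = (\<integral>\<^sup>+x. u (s * x) \<partial>M)"
    unfolding scale_model_def by (rule nn_integral_distr) auto
  also have "\<dots> = (\<integral>\<^sup>+x. ennreal (f x) * u (s * x) \<partial>lborel) + u 0 * emeasure M {0}"
    by (subst nn_integral_zero_split[OF F0 f_meas]) auto
  also have "(\<integral>\<^sup>+x. ennreal (f x) * u (s * x) \<partial>lborel) =
      ennreal \<bar>1 / s\<bar> * (\<integral>\<^sup>+x. ennreal (f (0 + 1 / s * x)) * u (s * (0 + 1 / s * x)) \<partial>lborel)"
    using s by (intro nn_integral_real_affine) auto
  also have "\<dots> = (\<integral>\<^sup>+x. ennreal (1 / s) * (ennreal (f (x / s)) * u x) \<partial>lborel)"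
    using s by (subst nn_integral_cmult[symmetric]) auto
  also have "\<dots> = (\<integral>\<^sup>+x. ennreal (f (x / s) / s) * u x \<partial>lborel)"
    using s f_nonneg by (intro nn_integral_cong) (simp add: ennreal_mult[symmetric] mult.assoc[symmetric])
  finally show ?thesis .
qed

lemma singular_part_null: "singular_part f \<in> null_sets M"
proof (rule null_setsI)
  have "emeasure M (singular_part f) = (\<integral>\<^sup>+x. indicator (singular_part f) x \<partial>M)" by simp
  also have "\<dots> = (\<integral>\<^sup>+x. ennreal (f x) * indicator (singular_part f) x \<partial>lborel)"
    by (subst nn_integral_zero_split[OF F0 f_meas]) (auto simp: singular_part_def)
  also have "\<dots> = (\<integral>\<^sup>+(x::real). 0 \<partial>lborel)"
    by (intro nn_integral_cong) (auto simp: singular_part_def indicator_def)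
  finally show "emeasure M (singular_part f) = 0" by simp
qed simp

lemma density_scale_ratio:
  assumes s: "s > 0"
  shows "density M (\<lambda>x. ennreal (scale_ratio f s x)) = density (scale_model M s) (indicator (- singular_part f))"
proof (rule measure_eqI)
  show "sets (density M (\<lambda>x. ennreal (scale_ratio f s x))) = sets (density (scale_model M s) (indicator (- singular_part f)))"
    by (simp add: scale_model_def)
  fix A assume "A \<in> sets (density M (\<lambda>x. ennreal (scale_ratio f s x)))"
  then have [measurable]: "A \<in> sets borel" by simp
  have "emeasure (density M (\<lambda>x. ennreal (scale_ratio f s x))) A = (\<integral>\<^sup>+x. ennreal (scale_ratio f s x) * indicator A x \<partial>M)"
    by (simp add: emeasure_density)
  also have "\<dots> = (\<integral>\<^sup>+x. ennreal (f x) * (ennreal (scale_ratio f s x) * indicator A x) \<partial>lborel) + indicator A 0 * emeasure M {0}"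
    by (subst nn_integral_zero_split[OF F0 f_meas]) (auto simp: scale_ratio_def)
  also have "(\<integral>\<^sup>+x. ennreal (f x) * (ennreal (scale_ratio f s x) * indicator A x) \<partial>lborel) =
      (\<integral>\<^sup>+x. ennreal (f (x / s) / s) * (indicator (- singular_part f) x * indicator A x) \<partial>lborel)"
  proof (intro nn_integral_cong_AE eventually_mono[OF AE_lborel_singleton[of 0]])
    fix x :: real assume x: "x \<noteq> 0"
    show "ennreal (f x) * (ennreal (scale_ratio f s x) * indicator A x) =
        ennreal (f (x / s) / s) * (indicator (- singular_part f) x * indicator A x)"
      using x s f_nonneg
      by (auto simp: scale_ratio_def singular_part_def indicator_def ennreal_mult[symmetric] mult.assoc[symmetric])
  qed
  also have "\<dots> + indicator A 0 * emeasure M {0} = (\<integral>\<^sup>+x. indicator (- singular_part f) x * indicator A x \<partial>scale_model M s)"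
    by (subst nn_integral_scale_model[OF s]) (auto simp: singular_part_def)
  also have "\<dots> = emeasure (density (scale_model M s) (indicator (- singular_part f))) A"
    by (subst emeasure_density) (auto simp: scale_model_def)
  finally show "emeasure (density M (\<lambda>x. ennreal (scale_ratio f s x))) A =
      emeasure (density (scale_model M s) (indicator (- singular_part f))) A" .
qed


text \<open>The regular and the singular part of the Hellinger-type distance combine to one Lebesgue integral of root
densities; the atom at the origin contributes nothing, since the ratio is \<open>1\<close> and the score \<open>0\<close> there.\<close>

lemma scale_hellinger_identity:
  assumes s: "s > 0" and [measurable]: "\<Lambda> \<in> borel_measurable borel" and \<Lambda>0: "\<Lambda> 0 = 0"
  shows "(\<integral>\<^sup>+x. ennreal ((sqrt (scale_ratio f s x) - (1 + c * \<Lambda> x))\<^sup>2) \<partial>M) + emeasure (scale_model M s) (singular_part f)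
    = (\<integral>\<^sup>+x. ennreal ((sqrt (f (x / s) / s) - sqrt (f x) * (1 + c * \<Lambda> x))\<^sup>2) \<partial>lborel)"
proof -
  have "(\<integral>\<^sup>+x. ennreal ((sqrt (scale_ratio f s x) - (1 + c * \<Lambda> x))\<^sup>2) \<partial>M)
      = (\<integral>\<^sup>+x. ennreal (f x) * ennreal ((sqrt (scale_ratio f s x) - (1 + c * \<Lambda> x))\<^sup>2) \<partial>lborel)"
    by (subst nn_integral_zero_split[OF F0 f_meas]) (auto simp: scale_ratio_def \<Lambda>0)
  moreover have "emeasure (scale_model M s) (singular_part f) = (\<integral>\<^sup>+x. indicator (singular_part f) x \<partial>scale_model M s)"
    by (subst nn_integral_indicator) (auto simp: scale_model_def)
  moreover have "\<dots> = (\<integral>\<^sup>+x. ennreal (f (x / s) / s) * indicator (singular_part f) x \<partial>lborel)"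
    by (subst nn_integral_scale_model[OF s]) (auto simp: singular_part_def)
  ultimately have "(\<integral>\<^sup>+x. ennreal ((sqrt (scale_ratio f s x) - (1 + c * \<Lambda> x))\<^sup>2) \<partial>M) + emeasure (scale_model M s) (singular_part f)
    = (\<integral>\<^sup>+x. ennreal (f x) * ennreal ((sqrt (scale_ratio f s x) - (1 + c * \<Lambda> x))\<^sup>2)
        + ennreal (f (x / s) / s) * indicator (singular_part f) x \<partial>lborel)"
    by (subst nn_integral_add) auto
  also have "\<dots> = (\<integral>\<^sup>+x. ennreal ((sqrt (f (x / s) / s) - sqrt (f x) * (1 + c * \<Lambda> x))\<^sup>2) \<partial>lborel)"
  proof (intro nn_integral_cong_AE eventually_mono[OF AE_lborel_singleton[of 0]])
    fix x :: real assume x: "x \<noteq> 0"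
    show "ennreal (f x) * ennreal ((sqrt (scale_ratio f s x) - (1 + c * \<Lambda> x))\<^sup>2)
        + ennreal (f (x / s) / s) * indicator (singular_part f) x
        = ennreal ((sqrt (f (x / s) / s) - sqrt (f x) * (1 + c * \<Lambda> x))\<^sup>2)"
    proof (cases "f x = 0")
      case True
      then show ?thesis using x s f_nonneg[of "x / s"] by (simp add: singular_part_def)
    next
      case False
      then have fx: "f x > 0" using f_nonneg[of x] by simp
      have "sqrt (f (x / s) / s) - sqrt (f x) * (1 + c * \<Lambda> x) = sqrt (f x) * (sqrt (f (x / s) / s / f x) - (1 + c * \<Lambda> x))"
      proof -
        have "sqrt (f x) * sqrt (f (x / s) / s / f x) = sqrt (f (x / s) / s)"
          by (subst real_sqrt_mult[symmetric]) (use fx in simp)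
        then show ?thesis by (simp only: right_diff_distrib)
      qed
      then have "(sqrt (f (x / s) / s) - sqrt (f x) * (1 + c * \<Lambda> x))\<^sup>2 = f x * (sqrt (f (x / s) / s / f x) - (1 + c * \<Lambda> x))\<^sup>2"
        using fx by (simp add: power_mult_distrib)
      then show ?thesis using x False f_nonneg[of x]
        by (simp add: scale_ratio_def singular_part_def ennreal_mult)
    qed
  qed
  finally show ?thesis .
qed

end

locale scale_dqm = scale_density M f + scale_regular_density f \<Lambda>
  for M :: "real measure" and f \<Lambda> :: "real \<Rightarrow> real" +
  assumes \<Lambda>0: "\<Lambda> 0 = 0"
begin

lemma reflected: "scale_regular_density (\<lambda>x. f (- x)) (\<lambda>x. \<Lambda> (- x))"
proof unfold_locales
  show "integrable lborel (\<lambda>x. f (- x))"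
    using lborel_integrable_real_affine[OF f_int, of "-1" 0] by simp
  show "integrable lborel (\<lambda>x. (\<Lambda> (- x))\<^sup>2 * f (- x))"
    using lborel_integrable_real_affine[OF \<Lambda>_int, of "-1" 0] by simp
  have "continuous_on UNIV ((\<lambda>x. x * f x) \<circ> uminus)"
    by (intro continuous_on_compose continuous_on_minus continuous_on_id continuous_on_subset[OF cont]) simp
  from continuous_on_minus[OF this] show "continuous_on UNIV (\<lambda>x. x * f (- x))" by (simp add: o_def)
  fix a b :: real assume ab: "a \<le> b"
  have "(LINT y:{-b..-a}|lborel. - (\<Lambda> y * f y)) = (\<integral>y. indicator {-b..-a} (- y) * (- (\<Lambda> (- y) * f (- y))) \<partial>lborel)"
    unfolding set_lebesgue_integral_def
    by (subst lborel_integral_real_affine[where c="-1" and t=0]) auto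
  also have "\<dots> = (LINT y:{a..b}|lborel. - (\<Lambda> (- y) * f (- y)))"
    unfolding set_lebesgue_integral_def by (intro Bochner_Integration.integral_cong) (auto simp: indicator_def)
  finally have "(LINT y:{a..b}|lborel. - (\<Lambda> (- y) * f (- y))) = (- a) * f (- a) - (- b) * f (- b)"
    using incr[of "-b" "-a"] ab by simp
  then show "b * f (- b) - a * f (- a) = (LINT y:{a..b}|lborel. - (\<Lambda> (- y) * f (- y)))"
    by simp
qed (use f_nonneg in auto)

interpretation R: scale_regular_density "\<lambda>x. f (- x)" "\<lambda>x. \<Lambda> (- x)"
  by (rule reflected)

text \<open>The normalised squared remainders on the two half-lines.\<close>

definition half_err :: "real \<Rightarrow> real" where
  "half_err t = (\<integral>x. (((sqrt (f (x / (1 + t)) / (1 + t)) - sqrt (f x)) / t - root_score x) * indicator {0<..} x)\<^sup>2 \<partial>lborel)"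

definition half_err' :: "real \<Rightarrow> real" where
  "half_err' t = (\<integral>x. (((sqrt (f (- (x / (1 + t))) / (1 + t)) - sqrt (f (- x))) / t - R.root_score x) * indicator {0<..} x)\<^sup>2 \<partial>lborel)"

definition err :: "real \<Rightarrow> real" where
  "err t = half_err t + half_err' t"

lemma err_tendsto_0: "(err \<longlongrightarrow> 0) (at 0)"
proof -
  have "((\<lambda>t. half_err t + half_err' t) \<longlongrightarrow> 0 + 0) (at 0)"
    unfolding half_err_def half_err'_def
    by (intro tendsto_add scaling_L2_derivative(1) R.scaling_L2_derivative(1))
  then show ?thesis by (simp add: err_def[abs_def])
qed

lemma err_nonneg: "0 \<le> err t"
  unfolding err_def half_err_def half_err'_def by (intro add_nonneg_nonneg integral_nonneg_AE AE_I2) auto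

text \<open>Differentiability in quadratic mean of the scale family at \<open>1\<close>, including the negligibility of the singular
part, in one formula with \<open>err t \<rightarrow> 0\<close>.\<close>

theorem scale_dqm_identity:
  assumes t: "t > -1"
  shows "(\<integral>\<^sup>+x. ennreal ((sqrt (scale_ratio f (1 + t) x) - (1 + t / 2 * \<Lambda> x))\<^sup>2) \<partial>M)
      + emeasure (scale_model M (1 + t)) (singular_part f) = ennreal (t\<^sup>2 * err t)"
proof -
  let ?g = "\<lambda>x. (sqrt (f (x / (1 + t)) / (1 + t)) - sqrt (f x) * (1 + t / 2 * \<Lambda> x))\<^sup>2"
  have "(\<integral>\<^sup>+x. ennreal ((sqrt (scale_ratio f (1 + t) x) - (1 + t / 2 * \<Lambda> x))\<^sup>2) \<partial>M)
      + emeasure (scale_model M (1 + t)) (singular_part f) = (\<integral>\<^sup>+x. ennreal (?g x) \<partial>lborel)"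
    by (rule scale_hellinger_identity) (use t \<Lambda>0 in auto)
  also have "\<dots> = ennreal (t\<^sup>2 * err t)"
  proof (cases "t = 0")
    case False
    let ?h = "\<lambda>x. (((sqrt (f (x / (1 + t)) / (1 + t)) - sqrt (f x)) / t - root_score x) * indicator {0<..} x)\<^sup>2"
    let ?h' = "\<lambda>x. (((sqrt (f (- (x / (1 + t))) / (1 + t)) - sqrt (f (- x))) / t - R.root_score x) * indicator {0<..} x)\<^sup>2"
    have pos: "?g x * indicator {0<..} x = t\<^sup>2 * ?h x" for x
    proof (cases "x > 0")
      case True
      have "sqrt (f (x / (1 + t)) / (1 + t)) - sqrt (f x) * (1 + t / 2 * \<Lambda> x)
          = t * ((sqrt (f (x / (1 + t)) / (1 + t)) - sqrt (f x)) / t - root_score x)"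
        using False by (simp add: root_score_def field_simps)
      then show ?thesis using True by (simp add: power_mult_distrib)
    qed simp
    have neg: "?g (- x) * indicator {0<..} x = t\<^sup>2 * ?h' x" for x
    proof (cases "x > 0")
      case True
      have "sqrt (f (- x / (1 + t)) / (1 + t)) - sqrt (f (- x)) * (1 + t / 2 * \<Lambda> (- x))
          = t * ((sqrt (f (- (x / (1 + t))) / (1 + t)) - sqrt (f (- x))) / t - R.root_score x)"
        using False by (simp add: R.root_score_def field_simps)
      then show ?thesis using True by (simp add: power_mult_distrib)
    qed simp
    have gm[measurable]: "?g \<in> borel_measurable borel" by measurable
    have "(\<integral>\<^sup>+x. ennreal (?g x) \<partial>lborel) =
        (\<integral>\<^sup>+x. ennreal (?g x * indicator {0<..} x) + ennreal (?g x * indicator {..<0} x) \<partial>lborel)"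
      by (intro nn_integral_cong_AE eventually_mono[OF AE_lborel_singleton[of 0]]) (auto simp: indicator_def)
    also have "\<dots> = (\<integral>\<^sup>+x. ennreal (?g x * indicator {0<..} x) \<partial>lborel) + (\<integral>\<^sup>+x. ennreal (?g x * indicator {..<0} x) \<partial>lborel)"
      by (rule nn_integral_add) auto
    also have "(\<integral>\<^sup>+x. ennreal (?g x * indicator {..<0} x) \<partial>lborel) =
        ennreal \<bar>-1\<bar> * (\<integral>\<^sup>+x. ennreal (?g (0 + -1 * x) * indicator {..<0} (0 + -1 * x)) \<partial>lborel)"
      by (rule nn_integral_real_affine) auto
    also have "\<dots> = (\<integral>\<^sup>+x. ennreal (?g (- x) * indicator {0<..} x) \<partial>lborel)"
      by (simp, intro nn_integral_cong) (auto simp: indicator_def)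
    also have "(\<integral>\<^sup>+x. ennreal (?g x * indicator {0<..} x) \<partial>lborel) = ennreal (t\<^sup>2 * half_err t)"
      unfolding pos half_err_def using scaling_L2_derivative(2)[OF t False]
      by (subst nn_integral_eq_integral) auto
    also have "(\<integral>\<^sup>+x. ennreal (?g (- x) * indicator {0<..} x) \<partial>lborel) = ennreal (t\<^sup>2 * half_err' t)"
      unfolding neg half_err'_def using R.scaling_L2_derivative(2)[OF t False]
      by (subst nn_integral_eq_integral) auto
    also have "ennreal (t\<^sup>2 * half_err t) + ennreal (t\<^sup>2 * half_err' t) = ennreal (t\<^sup>2 * err t)"
    proof -
      have "0 \<le> half_err t" "0 \<le> half_err' t"
        unfolding half_err_def half_err'_def by (auto intro!: integral_nonneg_AE)
      then show ?thesis by (simp add: err_def distrib_left ennreal_plus[symmetric] del: ennreal_plus)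
    qed
    finally show ?thesis .
  qed simp
  finally show ?thesis .
qed

lemma \<Lambda>_sq_M: "integrable M (\<lambda>x. (\<Lambda> x)\<^sup>2)"
  using integral_vanishing_at_zero(1)[OF F0 f_meas f_nonneg, of "\<lambda>x. (\<Lambda> x)\<^sup>2"] \<Lambda>_int \<Lambda>0
  by (simp add: mult.commute)

lemma M_distribution: "real_distribution M" ..

theorem L2_differentiable: "L2_differentiable_at M 1"
  unfolding L2_differentiable_at_def scale_model_one[OF M_distribution]
proof (intro bexI[of _ \<Lambda>] conjI allI impI)
  show "integrable M (\<lambda>x. (\<Lambda> x)\<^sup>2)" by (rule \<Lambda>_sq_M)
  fix \<mu> :: "real \<Rightarrow> real measure"
  assume \<mu>: "\<forall>t. 1 + t > 0 \<longrightarrow> dominates (\<mu> t) (scale_model M (1 + t)) \<and> dominates (\<mu> t) M"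
  have rem: "L2_remainder (\<mu> t) M 1 t \<Lambda> = \<bar>t\<bar> * sqrt (err t)" if t: "t > -1" for t
  proof -
    have d: "dominates (\<mu> t) (scale_model M (1 + t))" "dominates (\<mu> t) M" using \<mu> t by auto
    have sb[measurable_cong]: "sets (\<mu> t) = sets borel" using d(1) by (simp add: dominates_def)
    have rm[measurable]: "root_density (\<mu> t) P \<in> borel_measurable borel" for P
      unfolding root_density_def using borel_measurable_RN_deriv[of "\<mu> t" P]
      unfolding measurable_cong_sets[OF sb refl] by measurable
    have "(\<integral>\<^sup>+x. ennreal ((root_density (\<mu> t) (scale_model M (1 + t)) x - root_density (\<mu> t) M x * (1 + t / 2 * \<Lambda> x))\<^sup>2) \<partial>\<mu> t)
        = (\<integral>\<^sup>+x. ennreal ((sqrt (scale_ratio f (1 + t) x) - (1 + t / 2 * \<Lambda> x))\<^sup>2) \<partial>M)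
      + emeasure (scale_model M (1 + t)) (singular_part f)"
      using t by (intro L2_distance_by_likelihood_ratio d real_distribution_scale_model M_distribution
          singular_part_null density_scale_ratio ratio_nonneg) auto
    also have "\<dots> = ennreal (t\<^sup>2 * err t)" by (rule scale_dqm_identity[OF t])
    finally have "(\<integral>x. (root_density (\<mu> t) (scale_model M (1 + t)) x - root_density (\<mu> t) M x * (1 + t / 2 * \<Lambda> x))\<^sup>2 \<partial>\<mu> t)
        = t\<^sup>2 * err t"
      using err_nonneg[of t] by (subst integral_eq_nn_integral) auto
    then show ?thesis
      unfolding L2_remainder_def scale_model_one[OF M_distribution] by (simp add: real_sqrt_mult)
  qed
  show "(\<lambda>t. L2_remainder (\<mu> t) M 1 t \<Lambda>) \<in> o[at 0](\<lambda>t. t)"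
  proof (rule landau_o.smallI)
    fix c :: real assume c: "c > 0"
    have "((\<lambda>t. sqrt (err t)) \<longlongrightarrow> sqrt 0) (at 0)"
      by (intro tendsto_intros err_tendsto_0)
    then have "\<forall>\<^sub>F t in at 0. sqrt (err t) < c"
      using c by (intro order_tendstoD) auto
    moreover have "\<forall>\<^sub>F t in at (0::real). t \<in> {-1<..}"
      by (rule eventually_at_in_open') auto
    ultimately show "\<forall>\<^sub>F t in at 0. norm (L2_remainder (\<mu> t) M 1 t \<Lambda>) \<le> c * norm t"
    proof eventually_elim
      case (elim t)
      have "norm (L2_remainder (\<mu> t) M 1 t \<Lambda>) = \<bar>t\<bar> * sqrt (err t)"
        using rem[of t] elim(2) err_nonneg[of t] by (simp add: abs_mult)
      also have "\<dots> \<le> \<bar>t\<bar> * c" using elim(1) by (intro mult_left_mono) auto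
      finally show ?case by (simp add: mult.commute)
    qed
  qed
qed simp

text \<open>Almost everywhere differentiability of \<open>x f(x)\<close> identifies the classical score with the representing
function.\<close>

lemma scale_score1_AE: "AE x in M. scale_score1 f x = \<Lambda> x"
proof -
  have "AE x in M. x = 0 \<or> ((\<lambda>y. y * f y) has_real_derivative - (\<Lambda> x * f x)) (at x)"
    by (rule AE_M_from_lborel) (use AE_deriv_xf in \<open>auto elim: eventually_mono\<close>)
  moreover have "AE x in M. x \<notin> singular_part f"
    by (rule AE_not_in[OF singular_part_null])
  ultimately show ?thesis
  proof eventually_elim
    case (elim x)
    show ?case
    proof (cases "x = 0")
      case False
      then have "deriv (\<lambda>y. y * f y) x = - (\<Lambda> x * f x)"
        using elim(1) by (auto intro: DERIV_imp_deriv)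
      then show ?thesis using False elim(2) by (simp add: scale_score1_def singular_part_def)
    qed (simp add: scale_score1_def \<Lambda>0)
  qed
qed

end

section \<open>Local asymptotic normality of the scale model\<close>

lemma ln_ext_measurable [measurable]: "ln_ext \<in> borel_measurable borel"
  unfolding ln_ext_def by measurable

lemma ln_ext_prod:
  assumes "finite I" "\<And>i. i \<in> I \<Longrightarrow> a i > 0"
  shows "ln_ext (\<Prod>i\<in>I. ennreal (a i)) = ereal (\<Sum>i\<in>I. ln (a i))"
proof -
  have pos: "(\<Prod>i\<in>I. a i) > 0" using assms by (intro prod_pos) auto
  have "(\<Prod>i\<in>I. ennreal (a i)) = ennreal (\<Prod>i\<in>I. a i)"
    using assms by (intro prod_ennreal) (auto intro: less_imp_le)
  moreover have "ln (\<Prod>i\<in>I. a i) = (\<Sum>i\<in>I. ln (a i))"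
    using assms(1) by (intro ln_prod) (use assms(2) in fastforce)+
  ultimately show ?thesis using pos by (simp add: ln_ext_def)
qed

lemma ereal_add_diff_real: "ereal s - ereal c + (y - ereal (s - c)) = y"
  by (cases y) auto

context scale_dqm
begin

lemma ratio_integral:
  assumes s: "s > 0"
  shows "integrable M (scale_ratio f s)"
    "(\<integral>x. scale_ratio f s x \<partial>M) = 1 - measure (scale_model M s) (singular_part f)"
proof -
  interpret S: real_distribution "scale_model M s"
    by (rule real_distribution_scale_model[OF M_distribution])
  have "(\<integral>\<^sup>+x. ennreal (scale_ratio f s x) \<partial>M) = emeasure (density M (\<lambda>x. ennreal (scale_ratio f s x))) UNIV"
    by (simp add: emeasure_density)
  also have "\<dots> = emeasure (scale_model M s) (- singular_part f)"
    unfolding density_scale_ratio[OF s] by (simp add: emeasure_density)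
  also have "\<dots> = ennreal (1 - measure (scale_model M s) (singular_part f))"
    using S.prob_compl[of "singular_part f"] by (simp add: S.emeasure_eq_measure Compl_eq_Diff_UNIV)
  finally have eq: "(\<integral>\<^sup>+x. ennreal (scale_ratio f s x) \<partial>M) = ennreal (1 - measure (scale_model M s) (singular_part f))" .
  show "integrable M (scale_ratio f s)"
    by (rule integrableI_nonneg) (use eq ratio_nonneg[OF s] in auto)
  show "(\<integral>x. scale_ratio f s x \<partial>M) = 1 - measure (scale_model M s) (singular_part f)"
    using eq ratio_nonneg[OF s] by (subst integral_eq_nn_integral) auto
qed

lemma dqm_parts:
  assumes t: "t > -1"
  shows "(\<integral>x. (sqrt (scale_ratio f (1 + t) x) - (1 + t / 2 * \<Lambda> x))\<^sup>2 \<partial>M) \<le> t\<^sup>2 * err t"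
    "measure (scale_model M (1 + t)) (singular_part f) \<le> t\<^sup>2 * err t"
proof -
  interpret S: real_distribution "scale_model M (1 + t)"
    by (rule real_distribution_scale_model[OF M_distribution])
  note eq = scale_dqm_identity[OF t]
  have e0: "0 \<le> t\<^sup>2 * err t" using err_nonneg[of t] by simp
  have "(\<integral>\<^sup>+x. ennreal ((sqrt (scale_ratio f (1 + t) x) - (1 + t / 2 * \<Lambda> x))\<^sup>2) \<partial>M) \<le> ennreal (t\<^sup>2 * err t)"
    unfolding eq[symmetric] by simp
  then have "enn2real (\<integral>\<^sup>+x. ennreal ((sqrt (scale_ratio f (1 + t) x) - (1 + t / 2 * \<Lambda> x))\<^sup>2) \<partial>M) \<le> t\<^sup>2 * err t"
    using e0 by (intro enn2real_leI)
  then show "(\<integral>x. (sqrt (scale_ratio f (1 + t) x) - (1 + t / 2 * \<Lambda> x))\<^sup>2 \<partial>M) \<le> t\<^sup>2 * err t"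
    by (subst integral_eq_nn_integral) auto
  have "ennreal (measure (scale_model M (1 + t)) (singular_part f)) \<le> ennreal (t\<^sup>2 * err t)"
    unfolding eq[symmetric] S.emeasure_eq_measure[symmetric] by simp
  then show "measure (scale_model M (1 + t)) (singular_part f) \<le> t\<^sup>2 * err t"
    using e0 by (simp add: ennreal_le_iff)
qed

text \<open>The general expansion is applied with \<open>l = h \<Lambda> / 2\<close>, the root score per unit of \<open>1 / \<surd>n\<close>. For the finitely
many \<open>n\<close> with \<open>1 + h / \<surd>n \<le> 0\<close> the likelihood ratio is replaced by \<open>1\<close>.\<close>

theorem LAN:
  assumes dens: "has_scale_density M f"
    and info: "fisher_scale1 M = ennreal (\<integral>x. (\<Lambda> x)\<^sup>2 \<partial>M)" and mean: "(\<integral>x. \<Lambda> x \<partial>M) = 0"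
  shows "LAN_at M 1"
  unfolding LAN_at_def
proof (intro exI[of _ f] conjI allI dens)
  fix h :: real
  define t where "t n = h / sqrt (real n)" for n :: nat
  define L where "L n = (if 1 + t n > 0 then scale_ratio f (1 + t n) else (\<lambda>_. 1))" for n
  define I where "I = (\<integral>x. (\<Lambda> x)\<^sup>2 \<partial>M)"
  define sc where "sc n x = 1 / sqrt (real n) * (\<Sum>i<n. h * \<Lambda> (x i))" for n :: nat and x :: "nat \<Rightarrow> real"
  define C where "C = 1 / 2 * h\<^sup>2 * I"
  \<comment> \<open>The remainder is built from \<open>\<Lambda>\<close> and the explicit product, whose measurability is evident; the
    score defined by a pointwise derivative and the likelihood ratio agree with them almost everywhere.\<close>
  define R where "R n x = ln_ext (\<Prod>i<n. ennreal (L n (x i))) - ereal (sc n x - C)" for n x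
  have pow: "scale_model_pow M n 1 = iid n" for n
    unfolding scale_model_pow_def scale_model_one[OF M_distribution] ..
  have Lm[measurable]: "L n \<in> borel_measurable borel" for n
    by (cases "1 + t n > 0") (auto simp: L_def)
  have L0: "0 \<le> L n x" for n x
    using ratio_nonneg by (simp add: L_def)
  have Li: "integrable M (L n)" for n
    using ratio_integral(1) by (simp add: L_def)
  have fs: "enn2ereal (fisher_scale M 1) = ereal I"
    unfolding fisher_scale_def info I_def by (simp add: enn2ereal_ennreal)
  have tlim: "(\<lambda>n. h\<^sup>2 * err (t n)) \<longlonglongrightarrow> 0"
  proof (cases "h = 0")
    case False
    have t0: "t \<longlonglongrightarrow> 0"
    proof -
      have "(\<lambda>n. h * inverse (sqrt (real n))) \<longlonglongrightarrow> h * 0"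
        by (intro tendsto_mult tendsto_const tendsto_inverse_0_at_top filterlim_compose[OF sqrt_at_top] filterlim_real_sequentially)
      then show ?thesis by (simp add: t_def[abs_def] divide_inverse)
    qed
    have "filterlim t (at 0) sequentially"
      unfolding filterlim_at using t0 False eventually_gt_at_top[of "0::nat"]
      by (auto simp: t_def elim!: eventually_mono)
    from filterlim_compose[OF err_tendsto_0 this] have "(\<lambda>n. err (t n)) \<longlonglongrightarrow> 0" .
    then have "(\<lambda>n. h\<^sup>2 * err (t n)) \<longlonglongrightarrow> h\<^sup>2 * 0" by (intro tendsto_intros)
    then show ?thesis by simp
  qed simp
  have ev: "\<forall>\<^sub>F n in sequentially. n > 0 \<and> 1 + t n > 0"
  proof -
    have "\<forall>\<^sub>F n in sequentially. t n > -1"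
    proof -
      have "(\<lambda>n. h * inverse (sqrt (real n))) \<longlonglongrightarrow> h * 0"
        by (intro tendsto_mult tendsto_const tendsto_inverse_0_at_top filterlim_compose[OF sqrt_at_top] filterlim_real_sequentially)
      then have "t \<longlonglongrightarrow> 0" by (simp add: t_def[abs_def] divide_inverse)
      then show ?thesis by (rule order_tendstoD(1)) simp
    qed
    then show ?thesis
      using eventually_gt_at_top[of "0::nat"] by eventually_elim simp
  qed
  have nt: "real n * (t n)\<^sup>2 = h\<^sup>2" if "n > 0" for n
    using that by (simp add: t_def power_divide)
  have dqm: "(\<lambda>n. real n * (\<integral>x. (sqrt (L n x) - 1 - (h / 2 * \<Lambda> x) / sqrt n)\<^sup>2 \<partial>M)) \<longlonglongrightarrow> 0"
  proof (rule tendsto_sandwich[OF _ _ tendsto_const tlim])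
    show "\<forall>\<^sub>F n in sequentially. real n * (\<integral>x. (sqrt (L n x) - 1 - (h / 2 * \<Lambda> x) / sqrt n)\<^sup>2 \<partial>M) \<le> h\<^sup>2 * err (t n)"
      using ev
    proof eventually_elim
      case (elim n)
      have "(\<integral>x. (sqrt (L n x) - 1 - (h / 2 * \<Lambda> x) / sqrt n)\<^sup>2 \<partial>M)
          = (\<integral>x. (sqrt (scale_ratio f (1 + t n) x) - (1 + t n / 2 * \<Lambda> x))\<^sup>2 \<partial>M)"
        using elim by (intro Bochner_Integration.integral_cong) (auto simp: L_def t_def diff_diff_eq mult.commute)
      then have "real n * (\<integral>x. (sqrt (L n x) - 1 - (h / 2 * \<Lambda> x) / sqrt n)\<^sup>2 \<partial>M) \<le> real n * ((t n)\<^sup>2 * err (t n))"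
        using dqm_parts(1)[of "t n"] elim by (intro mult_left_mono) auto
      also have "\<dots> = h\<^sup>2 * err (t n)"
        using nt[of n] elim by (simp only: mult.assoc[symmetric])
      finally show ?case .
    qed
  qed auto
  have mass: "(\<lambda>n. real n * (1 - (\<integral>x. L n x \<partial>M))) \<longlonglongrightarrow> 0"
  proof (rule tendsto_sandwich[OF _ _ tendsto_const tlim])
    show "\<forall>\<^sub>F n in sequentially. 0 \<le> real n * (1 - (\<integral>x. L n x \<partial>M))"
      using ev by eventually_elim (simp add: L_def ratio_integral(2))
    show "\<forall>\<^sub>F n in sequentially. real n * (1 - (\<integral>x. L n x \<partial>M)) \<le> h\<^sup>2 * err (t n)"
      using ev
    proof eventually_elim
      case (elim n)
      have "1 - (\<integral>x. L n x \<partial>M) = measure (scale_model M (1 + t n)) (singular_part f)"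
        using elim by (simp add: L_def ratio_integral(2))
      then have "real n * (1 - (\<integral>x. L n x \<partial>M)) \<le> real n * ((t n)\<^sup>2 * err (t n))"
        using dqm_parts(2)[of "t n"] elim by (intro mult_left_mono) auto
      also have "\<dots> = h\<^sup>2 * err (t n)"
        using nt[of n] elim by (simp only: mult.assoc[symmetric])
      finally show ?case .
    qed
  qed
  have prodm[measurable]: "(\<lambda>x. \<Prod>i<n. ennreal (L n (x i))) \<in> borel_measurable (iid n)" for n
  proof (intro borel_measurable_prod_ennreal)
    fix i assume "i \<in> {..<n}"
    then have "(\<lambda>x. x i) \<in> measurable (iid n) M" by (rule measurable_component_singleton)
    then have "(\<lambda>x. x i) \<in> borel_measurable (iid n)"
      unfolding measurable_cong_sets[OF refl events_eq_borel] .
    then show "(\<lambda>x. ennreal (L n (x i))) \<in> borel_measurable (iid n)" by measurable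
  qed
  have scm[measurable]: "sc n \<in> borel_measurable (iid n)" for n
    unfolding sc_def
  proof (intro borel_measurable_times borel_measurable_const borel_measurable_sum)
    fix i assume "i \<in> {..<n}"
    then have "(\<lambda>x. x i) \<in> measurable (iid n) M" by (rule measurable_component_singleton)
    then have "(\<lambda>x. x i) \<in> borel_measurable (iid n)"
      unfolding measurable_cong_sets[OF refl events_eq_borel] .
    then show "(\<lambda>x. \<Lambda> (x i)) \<in> borel_measurable (iid n)" by measurable
  qed
  have Rm: "R n \<in> borel_measurable (iid n)" for n
    unfolding R_def by measurable
  show "\<exists>R. (\<forall>n>0. 1 + h / sqrt (real n) > 0 \<longrightarrow>
         R n \<in> borel_measurable (scale_model_pow M n 1) \<and>
         (AE x in scale_model_pow M n 1.
            ln_ext (likelihood_ratio (scale_model_pow M n (1 + h / sqrt (real n))) (scale_model_pow M n 1) x)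
            = ereal (1 / sqrt (real n) * (\<Sum>i<n. h * scale_score f 1 (x i)))
              - ereal (1 / 2 * h\<^sup>2) * enn2ereal (fisher_scale M 1) + R n x)) \<and>
      (\<forall>\<epsilon>>0. (\<lambda>n. measure (scale_model_pow M n 1)
                  {x \<in> space (scale_model_pow M n 1). \<bar>R n x\<bar> > ereal \<epsilon>}) \<longlonglongrightarrow> 0)"
  proof (intro exI[of _ R] conjI allI impI)
    fix n :: nat assume n: "n > 0" and tn': "1 + h / sqrt (real n) > 0"
    then have tn: "1 + t n > 0" by (simp add: t_def)
    show "R n \<in> borel_measurable (scale_model_pow M n 1)"
      unfolding pow by (rule Rm)
    have "AE x in iid n. likelihood_ratio (PiM {..<n} (\<lambda>_. scale_model M (1 + t n))) (iid n) x
        = (\<Prod>i<n. ennreal (scale_ratio f (1 + t n) (x i)))"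
    proof (rule likelihood_ratio_PiM(2))
      show "prob_space (scale_model M (1 + t n))"
        using real_distribution_scale_model[OF M_distribution] by (simp add: real_distribution_def)
      show "density M (\<lambda>x. ennreal (scale_ratio f (1 + t n) x))
          = density (scale_model M (1 + t n)) (indicator (space M - singular_part f))"
        using density_scale_ratio[OF tn] by (simp add: Compl_eq_Diff_UNIV)
    qed (auto simp: prob_space_axioms singular_part_null scale_model_def)
    moreover have "AE x in iid n. \<forall>i\<in>{..<n}. scale_score1 f (x i) = \<Lambda> (x i)"
    proof (subst AE_finite_all)
      show "\<forall>i\<in>{..<n}. AE x in iid n. scale_score1 f (x i) = \<Lambda> (x i)"
        using scale_score1_AE by (intro ballI AE_PiM_component[where P="\<lambda>x. scale_score1 f x = \<Lambda> x"])
          (auto simp: prob_space_axioms)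
    qed simp
    ultimately show "AE x in scale_model_pow M n 1.
            ln_ext (likelihood_ratio (scale_model_pow M n (1 + h / sqrt (real n))) (scale_model_pow M n 1) x)
            = ereal (1 / sqrt (real n) * (\<Sum>i<n. h * scale_score f 1 (x i)))
              - ereal (1 / 2 * h\<^sup>2) * enn2ereal (fisher_scale M 1) + R n x"
      unfolding pow
    proof eventually_elim
      case (elim x)
      have "ln_ext (likelihood_ratio (scale_model_pow M n (1 + h / sqrt (real n))) (iid n) x)
          = ln_ext (\<Prod>i<n. ennreal (L n (x i)))"
        using elim(1) tn by (simp add: scale_model_pow_def t_def L_def)
      moreover have "1 / sqrt (real n) * (\<Sum>i<n. h * scale_score f 1 (x i)) = sc n x"
        using elim(2) by (simp add: sc_def scale_score_def)
      moreover have "ereal (1 / 2 * h\<^sup>2) * enn2ereal (fisher_scale M 1) = ereal C"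
        unfolding fs C_def by simp
      ultimately show ?case
        by (simp only: R_def ereal_add_diff_real)
    qed
  next
    fix \<epsilon> :: real assume \<epsilon>: "\<epsilon> > 0"
    let ?E = "\<lambda>n. {x\<in>space (iid n). (\<exists>i<n. L n (x i) = 0) \<or>
      \<bar>(\<Sum>i<n. ln (L n (x i))) - 2 / sqrt n * (\<Sum>i<n. h / 2 * \<Lambda> (x i)) + 2 * (\<integral>x. (h / 2 * \<Lambda> x)\<^sup>2 \<partial>M)\<bar> > \<epsilon>}"
    have lim: "(\<lambda>n. measure (iid n) (?E n)) \<longlonglongrightarrow> 0"
    proof (rule lan_of_differentiability_in_mean[OF _ L0 Li _ _ _ dqm mass \<epsilon>])
      show "integrable M (\<lambda>x. (h / 2 * \<Lambda> x)\<^sup>2)" using \<Lambda>_sq_M by (simp add: power_mult_distrib power_divide)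
      show "(\<integral>x. h / 2 * \<Lambda> x \<partial>M) = 0" using mean by simp
    qed auto
    have sub: "{x \<in> space (iid n). \<bar>R n x\<bar> > ereal \<epsilon>} \<subseteq> ?E n" for n
    proof (rule subsetI, rule ccontr)
      fix x assume x: "x \<in> {x \<in> space (iid n). \<bar>R n x\<bar> > ereal \<epsilon>}" and "x \<notin> ?E n"
      then have no: "\<not> (\<exists>i<n. L n (x i) = 0)"
        "\<not> \<bar>(\<Sum>i<n. ln (L n (x i))) - 2 / sqrt n * (\<Sum>i<n. h / 2 * \<Lambda> (x i)) + 2 * (\<integral>x. (h / 2 * \<Lambda> x)\<^sup>2 \<partial>M)\<bar> > \<epsilon>"
        by blast+
      have nE: "\<forall>i<n. L n (x i) \<noteq> 0"
        "\<bar>(\<Sum>i<n. ln (L n (x i))) - 2 / sqrt n * (\<Sum>i<n. h / 2 * \<Lambda> (x i)) + 2 * (\<integral>x. (h / 2 * \<Lambda> x)\<^sup>2 \<partial>M)\<bar> \<le> \<epsilon>"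
        using no(1) no(2)[unfolded not_less] by blast+
      have pos: "L n (x i) > 0" if "i < n" for i
        using nE(1) that L0[of n "x i"] by (simp add: less_le)
      have "ln_ext (\<Prod>i<n. ennreal (L n (x i))) = ereal (\<Sum>i<n. ln (L n (x i)))"
        by (rule ln_ext_prod) (use pos in auto)
      then have "R n x = ereal ((\<Sum>i<n. ln (L n (x i))) - (sc n x - C))"
        by (simp add: R_def)
      moreover have "sc n x = 2 / sqrt n * (\<Sum>i<n. h / 2 * \<Lambda> (x i))"
        by (simp add: sc_def sum_distrib_left)
      moreover have "C = 2 * (\<integral>x. (h / 2 * \<Lambda> x)\<^sup>2 \<partial>M)"
        by (simp add: C_def I_def power_mult_distrib power_divide)
      ultimately have "\<bar>R n x\<bar> \<le> ereal \<epsilon>"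
        using nE(2) by (simp add: algebra_simps)
      then show False using x by auto
    qed
    show "(\<lambda>n. measure (scale_model_pow M n 1) {x \<in> space (scale_model_pow M n 1). \<bar>R n x\<bar> > ereal \<epsilon>}) \<longlonglongrightarrow> 0"
      unfolding pow
    proof (rule tendsto_sandwich[OF _ _ tendsto_const lim])
      show "\<forall>\<^sub>F n in sequentially. measure (iid n) {x \<in> space (iid n). \<bar>R n x\<bar> > ereal \<epsilon>} \<le> measure (iid n) (?E n)"
      proof (intro always_eventually allI)
        fix n
        interpret n: prob_space "iid n" by (rule prob_space_iid)
        have "?E n \<in> sets (iid n)"
          by measurable
        then show "measure (iid n) {x \<in> space (iid n). \<bar>R n x\<bar> > ereal \<epsilon>} \<le> measure (iid n) (?E n)"
          by (intro n.finite_measure_mono sub)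
      qed
    qed auto
  qed
qed

end

section \<open>From mean square differentiability to finite information\<close>

text \<open>The sum of the laws of \<open>s X\<close> and \<open>s' X\<close>, realised as an image measure, which makes it a dominating measure
without a separate proof of countable additivity.\<close>

definition pair_sum :: "real measure \<Rightarrow> real \<Rightarrow> real \<Rightarrow> real measure" where
  "pair_sum F s s' = distr (F \<Otimes>\<^sub>M count_space (UNIV :: bool set)) borel (\<lambda>(x, b). if b then s * x else s' * x)"

lemma pair_sum_dominates:
  assumes F: "real_distribution F"
  shows "dominates (pair_sum F s s') (scale_model F s)" "dominates (pair_sum F s s') (scale_model F s')"
proof -
  interpret F: real_distribution F by fact
  let ?B = "count_space (UNIV :: bool set)"
  interpret B: finite_measure ?B by (rule finite_measure_count_space) simp
  interpret P: pair_sigma_finite F ?B by unfold_locales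
  have fm: "finite_measure (F \<Otimes>\<^sub>M ?B)"
    by (rule finite_measure_pair_measure) unfold_locales
  have T[measurable]: "(\<lambda>(x, b). if b then s * x else s' * x) \<in> borel_measurable (F \<Otimes>\<^sub>M ?B)"
    by measurable
  have em: "emeasure (pair_sum F s s') A = emeasure (scale_model F s) A + emeasure (scale_model F s') A"
    if A[measurable]: "A \<in> sets borel" for A
  proof -
    have scale: "(\<integral>\<^sup>+x. indicator A (r * x) \<partial>F) = emeasure (scale_model F r) A" for r
    proof -
      have "emeasure (scale_model F r) A = (\<integral>\<^sup>+x. indicator A x \<partial>scale_model F r)"
        by (rule nn_integral_indicator[symmetric]) (simp add: scale_model_def)
      also have "\<dots> = (\<integral>\<^sup>+x. indicator A (r * x) \<partial>F)"
        unfolding scale_model_def by (rule nn_integral_distr) auto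
      finally show ?thesis by simp
    qed
    have "emeasure (pair_sum F s s') A = (\<integral>\<^sup>+x. indicator A x \<partial>pair_sum F s s')"
      by (rule nn_integral_indicator[symmetric]) (simp add: pair_sum_def)
    also have "\<dots> = (\<integral>\<^sup>+z. indicator A (case z of (x, b) \<Rightarrow> if b then s * x else s' * x) \<partial>(F \<Otimes>\<^sub>M ?B))"
      unfolding pair_sum_def by (rule nn_integral_distr) auto
    also have "\<dots> = (\<integral>\<^sup>+x. \<integral>\<^sup>+b. indicator A (if b then s * x else s' * x) \<partial>?B \<partial>F)"
      by (subst B.nn_integral_fst[symmetric]) auto
    also have "\<dots> = (\<integral>\<^sup>+x. indicator A (s * x) + indicator A (s' * x) \<partial>F)"
      by (simp add: nn_integral_count_space_finite UNIV_bool add.commute)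
    also have "\<dots> = (\<integral>\<^sup>+x. indicator A (s * x) \<partial>F) + (\<integral>\<^sup>+x. indicator A (s' * x) \<partial>F)"
      by (rule nn_integral_add) auto
    also have "\<dots> = emeasure (scale_model F s) A + emeasure (scale_model F s') A"
      by (simp only: scale)
    finally show ?thesis .
  qed
  have "finite_measure (pair_sum F s s')"
    unfolding pair_sum_def by (rule finite_measure.finite_measure_distr[OF fm T])
  then interpret S: finite_measure "pair_sum F s s'" .
  have sf: "sigma_finite_measure (pair_sum F s s')" by unfold_locales
  have sb: "sets (pair_sum F s s') = sets borel" by (simp add: pair_sum_def)
  show "dominates (pair_sum F s s') (scale_model F s)" "dominates (pair_sum F s s') (scale_model F s')"
    unfolding dominates_def absolutely_continuous_def
    using sf sb em by (auto simp: null_sets_def scale_model_def)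
qed

lemma root_density_square:
  assumes \<mu>: "dominates \<mu> P" and P: "real_distribution P"
  shows "root_density \<mu> P \<in> borel_measurable borel" "0 \<le> root_density \<mu> P x"
    "density \<mu> (\<lambda>x. ennreal ((root_density \<mu> P x)\<^sup>2)) = P"
proof -
  interpret P: real_distribution P by fact
  have sb[measurable_cong]: "sets \<mu> = sets borel" using \<mu> by (simp add: dominates_def)
  interpret sigma_finite_measure \<mu> using \<mu> by (simp add: dominates_def)
  have m[measurable]: "RN_deriv \<mu> P \<in> borel_measurable borel"
    using borel_measurable_RN_deriv[of \<mu> P] unfolding measurable_cong_sets[OF sb refl] by auto
  show "root_density \<mu> P \<in> borel_measurable borel"
    unfolding root_density_def by measurable
  show "0 \<le> root_density \<mu> P x" by (simp add: root_density_def)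
  have pf: "AE x in \<mu>. RN_deriv \<mu> P x \<noteq> \<infinity>"
    using \<mu> sb P.sigma_finite_measure_axioms by (intro RN_deriv_finite) (auto simp: dominates_def)
  have "density \<mu> (\<lambda>x. ennreal ((root_density \<mu> P x)\<^sup>2)) = density \<mu> (RN_deriv \<mu> P)"
  proof (rule density_cong)
    show "AE x in \<mu>. ennreal ((root_density \<mu> P x)\<^sup>2) = RN_deriv \<mu> P x"
      using pf by eventually_elim (simp add: root_density_def less_top)
  qed (auto simp: root_density_def)
  also have "\<dots> = P"
    using \<mu> sb by (intro density_RN_deriv) (auto simp: dominates_def)
  finally show "density \<mu> (\<lambda>x. ennreal ((root_density \<mu> P x)\<^sup>2)) = P" .
qed

lemma root_density_integral:
  fixes g :: "real \<Rightarrow> real"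
  assumes \<mu>: "dominates \<mu> P" and P: "real_distribution P" and g[measurable]: "g \<in> borel_measurable borel"
  shows "integrable P g \<longleftrightarrow> integrable \<mu> (\<lambda>x. (root_density \<mu> P x)\<^sup>2 * g x)"
    "(\<integral>x. g x \<partial>P) = (\<integral>x. (root_density \<mu> P x)\<^sup>2 * g x \<partial>\<mu>)"
proof -
  note r = root_density_square[OF \<mu> P]
  have sb[measurable_cong]: "sets \<mu> = sets borel" using \<mu> by (simp add: dominates_def)
  have [measurable]: "root_density \<mu> P \<in> borel_measurable borel" by (rule r)
  have "integrable (density \<mu> (\<lambda>x. ennreal ((root_density \<mu> P x)\<^sup>2))) g \<longleftrightarrow>
      integrable \<mu> (\<lambda>x. (root_density \<mu> P x)\<^sup>2 *\<^sub>R g x)"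
    by (rule integrable_density) auto
  then show "integrable P g \<longleftrightarrow> integrable \<mu> (\<lambda>x. (root_density \<mu> P x)\<^sup>2 * g x)"
    unfolding r(3) by simp
  have "(\<integral>x. g x \<partial>density \<mu> (\<lambda>x. ennreal ((root_density \<mu> P x)\<^sup>2))) = (\<integral>x. (root_density \<mu> P x)\<^sup>2 *\<^sub>R g x \<partial>\<mu>)"
    by (rule integral_density) auto
  then show "(\<integral>x. g x \<partial>P) = (\<integral>x. (root_density \<mu> P x)\<^sup>2 * g x \<partial>\<mu>)"
    unfolding r(3) by simp
qed

text \<open>With root densities \<open>a\<close> and \<open>b\<close>, and \<open>a = b + t b \<Delta> / 2 + \<rho>\<close>, one has
\<open>a\<^sup>2 - b\<^sup>2 - t b\<^sup>2 \<Delta> = 2 b \<rho> + (t b \<Delta> / 2 + \<rho>)\<^sup>2\<close>. The right-hand side is of smaller order than \<open>t\<close>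
when the norm of \<open>\<rho>\<close> is.\<close>

lemma bounded_functional_remainder:
  fixes g \<Delta> :: "real \<Rightarrow> real" and t :: real
  assumes \<mu>: "dominates \<mu> P" "dominates \<mu> Q" and P: "real_distribution P" and Q: "real_distribution Q"
    and g[measurable]: "g \<in> borel_measurable borel" and B: "\<And>x. \<bar>g x\<bar> \<le> B"
    and \<Delta>[measurable]: "\<Delta> \<in> borel_measurable borel" and \<Delta>2: "integrable Q (\<lambda>x. (\<Delta> x)\<^sup>2)"
  defines "\<rho> \<equiv> \<lambda>x. root_density \<mu> P x - root_density \<mu> Q x * (1 + 1 / 2 * t * \<Delta> x)"
  defines "e \<equiv> sqrt (\<integral>x. (\<rho> x)\<^sup>2 \<partial>\<mu>)"
  shows "\<bar>(\<integral>x. g x \<partial>P) - (\<integral>x. g x \<partial>Q) - t * (\<integral>x. g x * \<Delta> x \<partial>Q)\<bar>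
    \<le> B * (2 * e + 1 / 2 * t\<^sup>2 * (\<integral>x. (\<Delta> x)\<^sup>2 \<partial>Q) + 2 * e\<^sup>2)"
proof -
  interpret P: real_distribution P by fact
  interpret Q: real_distribution Q by fact
  have sb[measurable_cong]: "sets \<mu> = sets borel" using \<mu> by (simp add: dominates_def)
  define a b where "a = root_density \<mu> P" and "b = root_density \<mu> Q"
  have [measurable]: "a \<in> borel_measurable borel" "b \<in> borel_measurable borel"
    unfolding a_def b_def using root_density_square(1) \<mu> P Q by auto
  note Pi = root_density_integral[OF \<mu>(1) P, folded a_def] and Qi = root_density_integral[OF \<mu>(2) Q, folded b_def]
  have \<rho>: "\<rho> x = a x - b x * (1 + 1 / 2 * t * \<Delta> x)" for x by (simp add: \<rho>_def a_def b_def)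
  have [measurable]: "\<rho> \<in> borel_measurable borel" unfolding \<rho>[abs_def] by measurable
  have \<Delta>1: "integrable Q \<Delta>" using Q.integrable_of_square[OF _ \<Delta>2] by simp
  have B0: "B \<ge> 0" using order_trans[OF abs_ge_zero B] .
  have gb: "integrable P g" "integrable Q g"
    by (rule P.integrable_const_bound[of _ B], use B in auto, rule Q.integrable_const_bound[of _ B], use B in auto)
  have g\<Delta>: "integrable Q (\<lambda>x. g x * \<Delta> x)"
    by (rule Bochner_Integration.integrable_bound[where f="\<lambda>x. B * \<Delta> x"])
      (use \<Delta>1 B B0 in \<open>auto simp: abs_mult intro!: mult_right_mono AE_I2\<close>)
  have a2: "integrable \<mu> (\<lambda>x. (a x)\<^sup>2)" using Pi(1)[of "\<lambda>_. 1"] by simp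
  have b2: "integrable \<mu> (\<lambda>x. (b x)\<^sup>2)" "(\<integral>x. (b x)\<^sup>2 \<partial>\<mu>) = 1"
    using Qi[of "\<lambda>_. 1"] Q.prob_space by auto
  define u where "u x = b x * \<Delta> x" for x
  have [measurable]: "u \<in> borel_measurable borel" unfolding u_def by measurable
  have u2: "integrable \<mu> (\<lambda>x. (u x)\<^sup>2)" "(\<integral>x. (u x)\<^sup>2 \<partial>\<mu>) = (\<integral>x. (\<Delta> x)\<^sup>2 \<partial>Q)"
    using Qi[of "\<lambda>x. (\<Delta> x)\<^sup>2"] \<Delta>2 by (auto simp: u_def power_mult_distrib)
  have ab: "integrable \<mu> (\<lambda>x. (a x + (- 1) * b x)\<^sup>2)"
    by (rule integrable_square_add_scaled(1)) (use a2 b2 in auto)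
  have \<rho>2: "integrable \<mu> (\<lambda>x. (\<rho> x)\<^sup>2)"
  proof -
    have "integrable \<mu> (\<lambda>x. ((a x + (- 1) * b x) + (- (t / 2)) * u x)\<^sup>2)"
      by (rule integrable_square_add_scaled(1)) (use ab u2 in auto)
    moreover have "(\<lambda>x. ((a x + (- 1) * b x) + (- (t / 2)) * u x)\<^sup>2) = (\<lambda>x. (\<rho> x)\<^sup>2)"
      by (auto simp: \<rho> u_def algebra_simps)
    ultimately show ?thesis by simp
  qed
  have e2: "e\<^sup>2 = (\<integral>x. (\<rho> x)\<^sup>2 \<partial>\<mu>)" by (simp add: e_def)
  have e0: "e \<ge> 0" by (simp add: e_def)
  have b\<rho>: "integrable \<mu> (\<lambda>x. \<bar>b x\<bar> * \<bar>\<rho> x\<bar>)"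
    using integrable_mult_square[of "\<lambda>x. \<bar>b x\<bar>" \<mu> "\<lambda>x. \<bar>\<rho> x\<bar>"] b2 \<rho>2 by simp
  have CS: "(\<integral>x. \<bar>b x\<bar> * \<bar>\<rho> x\<bar> \<partial>\<mu>) \<le> e"
  proof -
    have "(\<integral>x. \<bar>b x\<bar> * \<bar>\<rho> x\<bar> \<partial>\<mu>)\<^sup>2 \<le> (\<integral>x. \<bar>b x\<bar>\<^sup>2 \<partial>\<mu>) * (\<integral>x. \<bar>\<rho> x\<bar>\<^sup>2 \<partial>\<mu>)"
      by (rule integral_Cauchy_Schwarz) (use b2 \<rho>2 in auto)
    then have "(\<integral>x. \<bar>b x\<bar> * \<bar>\<rho> x\<bar> \<partial>\<mu>)\<^sup>2 \<le> e\<^sup>2" using b2 e2 by simp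
    then show ?thesis using e0 by (rule power2_le_imp_le)
  qed
  have pi: "integrable \<mu> (\<lambda>x. (a x)\<^sup>2 * g x)" "integrable \<mu> (\<lambda>x. (b x)\<^sup>2 * g x)" "integrable \<mu> (\<lambda>x. (b x)\<^sup>2 * (g x * \<Delta> x))"
    using Pi(1)[OF g] Qi(1)[OF g] Qi(1)[of "\<lambda>x. g x * \<Delta> x"] gb g\<Delta> by auto
  have eq: "(\<integral>x. g x \<partial>P) - (\<integral>x. g x \<partial>Q) - t * (\<integral>x. g x * \<Delta> x \<partial>Q)
      = (\<integral>x. (a x)\<^sup>2 * g x - (b x)\<^sup>2 * g x - t * ((b x)\<^sup>2 * (g x * \<Delta> x)) \<partial>\<mu>)"
    using Pi(2)[OF g] Qi(2)[OF g] Qi(2)[of "\<lambda>x. g x * \<Delta> x"] pi by simp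
  have "\<bar>(\<integral>x. g x \<partial>P) - (\<integral>x. g x \<partial>Q) - t * (\<integral>x. g x * \<Delta> x \<partial>Q)\<bar> \<le> (\<integral>x. \<bar>(a x)\<^sup>2 * g x - (b x)\<^sup>2 * g x - t * ((b x)\<^sup>2 * (g x * \<Delta> x))\<bar> \<partial>\<mu>)"
    unfolding eq by (rule integral_abs_bound)
  also have "\<dots> \<le> (\<integral>x. B * (2 * (\<bar>b x\<bar> * \<bar>\<rho> x\<bar>) + (1 / 2 * t\<^sup>2 * (u x)\<^sup>2 + 2 * (\<rho> x)\<^sup>2)) \<partial>\<mu>)"
  proof (rule integral_mono)
    fix x
    have split: "A = c + (s * (c * d) + (A - c * (1 + s * d)))" for A c d s :: real
      by (simp add: algebra_simps)
    have ax: "a x = b x + (t / 2 * u x + \<rho> x)"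
      unfolding \<rho> u_def using split[of "a x" "b x" "t / 2" "\<Delta> x"] by simp
    have expand: "(c + (s * (c * d) + r))\<^sup>2 * y - c\<^sup>2 * y - 2 * s * (c\<^sup>2 * (y * d)) = y * (2 * (c * r) + (s * (c * d) + r)\<^sup>2)"
      for c d r s y :: real
      by (simp add: power2_eq_square algebra_simps)
    have "(a x)\<^sup>2 * g x - (b x)\<^sup>2 * g x - t * ((b x)\<^sup>2 * (g x * \<Delta> x)) = g x * (2 * (b x * \<rho> x) + (t / 2 * u x + \<rho> x)\<^sup>2)"
      unfolding ax u_def using expand[of "b x" "t / 2" "\<Delta> x" "\<rho> x" "g x"] by simp
    moreover have "\<bar>2 * (b x * \<rho> x) + (t / 2 * u x + \<rho> x)\<^sup>2\<bar> \<le> 2 * (\<bar>b x\<bar> * \<bar>\<rho> x\<bar>) + (1 / 2 * t\<^sup>2 * (u x)\<^sup>2 + 2 * (\<rho> x)\<^sup>2)"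
    proof -
      have "(t / 2 * u x + \<rho> x)\<^sup>2 \<le> 2 * (t / 2 * u x)\<^sup>2 + 2 * (\<rho> x)\<^sup>2"
        using zero_le_power2[of "t / 2 * u x - \<rho> x"] by (simp add: power2_sum power2_diff)
      also have "2 * (t / 2 * u x)\<^sup>2 = 1 / 2 * t\<^sup>2 * (u x)\<^sup>2" by (simp add: power_mult_distrib power_divide)
      finally have "(t / 2 * u x + \<rho> x)\<^sup>2 \<le> 1 / 2 * t\<^sup>2 * (u x)\<^sup>2 + 2 * (\<rho> x)\<^sup>2" .
      moreover have "\<bar>2 * (b x * \<rho> x)\<bar> = 2 * (\<bar>b x\<bar> * \<bar>\<rho> x\<bar>)" by (simp add: abs_mult)
      moreover have "\<bar>p + q\<bar> \<le> r + s" if "q \<le> s" "\<bar>p\<bar> = r" "0 \<le> q" for p q r s :: real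
        using that by linarith
      ultimately show ?thesis by simp
    qed
    ultimately show "\<bar>(a x)\<^sup>2 * g x - (b x)\<^sup>2 * g x - t * ((b x)\<^sup>2 * (g x * \<Delta> x))\<bar>
        \<le> B * (2 * (\<bar>b x\<bar> * \<bar>\<rho> x\<bar>) + (1 / 2 * t\<^sup>2 * (u x)\<^sup>2 + 2 * (\<rho> x)\<^sup>2))"
      unfolding abs_mult using B[of x] B0 by (simp add: abs_mult mult_mono)
  qed (use pi b\<rho> u2 \<rho>2 in auto)
  also have "\<dots> = B * (2 * (\<integral>x. \<bar>b x\<bar> * \<bar>\<rho> x\<bar> \<partial>\<mu>) + (1 / 2 * t\<^sup>2 * (\<integral>x. (\<Delta> x)\<^sup>2 \<partial>Q) + 2 * e\<^sup>2))"
    using b\<rho> u2 \<rho>2 by (simp add: e2)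
  also have "\<dots> \<le> B * (2 * e + 1 / 2 * t\<^sup>2 * (\<integral>x. (\<Delta> x)\<^sup>2 \<partial>Q) + 2 * e\<^sup>2)"
    using CS B0 by (intro mult_left_mono) auto
  finally show ?thesis .
qed

text \<open>The difference quotients are dominated because \<open>x \<phi>'(s x) = (s x) \<phi>'(s x) / s\<close> and \<open>x \<phi>'(x)\<close> is
bounded.\<close>

lemma test_function_derivative:
  assumes F: "real_distribution F" and \<sigma>: "\<sigma> > 0" and \<phi>: "\<phi> \<in> C_c1"
    and X: "\<And>n. X n > 0" "X \<longlonglongrightarrow> 0"
  shows "(\<lambda>n. ((\<integral>x. \<phi> x \<partial>scale_model F (\<sigma> + X n)) - (\<integral>x. \<phi> x \<partial>scale_model F \<sigma>)) / X n)
    \<longlonglongrightarrow> (\<integral>x. x * deriv \<phi> (\<sigma> * x) \<partial>F)"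
proof -
  interpret F: real_distribution F by fact
  obtain B where B: "\<And>x. \<bar>\<phi> x\<bar> \<le> B" "\<And>x. \<bar>deriv \<phi> x\<bar> \<le> B" "\<And>x. \<bar>x * deriv \<phi> x\<bar> \<le> B"
    using C_c1_bounds[OF \<phi>] by blast
  obtain K where d: "\<And>x. (\<phi> has_real_derivative deriv \<phi> x) (at x)"
    using C_c1E[OF \<phi>] by blast
  note [measurable] = C_c1_measurable[OF \<phi>]
  have int: "integrable F (\<lambda>x. \<phi> (s * x))" for s
    by (rule F.integrable_const_bound[of _ B]) (use B in auto)
  have eq: "((\<integral>x. \<phi> x \<partial>scale_model F (\<sigma> + X n)) - (\<integral>x. \<phi> x \<partial>scale_model F \<sigma>)) / X n
      = (\<integral>x. (\<phi> ((\<sigma> + X n) * x) - \<phi> (\<sigma> * x)) / X n \<partial>F)" for n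
    unfolding scale_model_def using int by (simp add: integral_distr)
  have B0: "B \<ge> 0" using order_trans[OF abs_ge_zero B(1)] .
  show ?thesis
    unfolding eq
  proof (rule integral_dominated_convergence[where w="\<lambda>_. B / \<sigma>"])
    show "AE x in F. (\<lambda>n. (\<phi> ((\<sigma> + X n) * x) - \<phi> (\<sigma> * x)) / X n) \<longlonglongrightarrow> x * deriv \<phi> (\<sigma> * x)"
    proof (intro AE_I2)
      fix x
      have "((\<lambda>t. \<phi> ((\<sigma> + t) * x)) has_real_derivative deriv \<phi> ((\<sigma> + 0) * x) * x) (at 0)"
        by (rule DERIV_chain2[OF d]) (auto intro!: derivative_eq_intros)
      then have "((\<lambda>t. (\<phi> ((\<sigma> + t) * x) - \<phi> (\<sigma> * x)) / t) \<longlongrightarrow> x * deriv \<phi> (\<sigma> * x)) (at 0)"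
        unfolding has_field_derivative_iff by (simp add: mult.commute)
      moreover have "filterlim X (at 0) sequentially"
        unfolding filterlim_at using X by (auto intro!: always_eventually) (metis less_irrefl)
      ultimately show "(\<lambda>n. (\<phi> ((\<sigma> + X n) * x) - \<phi> (\<sigma> * x)) / X n) \<longlonglongrightarrow> x * deriv \<phi> (\<sigma> * x)"
        by (rule filterlim_compose)
    qed
    show "AE x in F. norm ((\<phi> ((\<sigma> + X n) * x) - \<phi> (\<sigma> * x)) / X n) \<le> B / \<sigma>" for n
    proof (intro AE_I2)
      fix x
      have "((\<lambda>s. \<phi> (s * x)) has_real_derivative deriv \<phi> (s * x) * x) (at s)" for s
        by (rule DERIV_chain2[OF d]) (auto intro!: derivative_eq_intros)
      then obtain s where s: "\<sigma> < s" "s < \<sigma> + X n" "\<phi> ((\<sigma> + X n) * x) - \<phi> (\<sigma> * x) = (\<sigma> + X n - \<sigma>) * (deriv \<phi> (s * x) * x)"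
        using MVT2[of \<sigma> "\<sigma> + X n" "\<lambda>s. \<phi> (s * x)" "\<lambda>s. deriv \<phi> (s * x) * x"] X(1)[of n] by auto
      then have "(\<phi> ((\<sigma> + X n) * x) - \<phi> (\<sigma> * x)) / X n = ((s * x) * deriv \<phi> (s * x)) / s"
        using X(1)[of n] \<sigma> by (simp add: field_simps)
      also have "norm \<dots> = \<bar>(s * x) * deriv \<phi> (s * x)\<bar> / s"
        unfolding real_norm_def abs_divide using s \<sigma> by simp
      also have "\<dots> \<le> B / s"
        using s \<sigma> by (intro divide_right_mono B(3)) auto
      also have "\<dots> \<le> B / \<sigma>"
        using s \<sigma> B0 by (intro divide_left_mono) auto
      finally show "norm ((\<phi> ((\<sigma> + X n) * x) - \<phi> (\<sigma> * x)) / X n) \<le> B / \<sigma>" .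
    qed
  qed auto
qed

text \<open>Both expressions for the derivative of \<open>\<integral> \<phi> dF\<^sub>\<sigma>\<close> agree. A given test function \<open>\<psi>\<close> is inserted as
\<open>\<phi>(y) = \<psi>(y / \<sigma>)\<close>, which accounts for the factor \<open>\<sigma>\<^sup>2\<close> in the bound.\<close>

theorem L2_differentiable_imp_fisher_finite:
  assumes F: "real_distribution F" and \<sigma>: "\<sigma> > 0" and diff: "L2_differentiable_at F \<sigma>"
  shows "fisher_scale1 F < \<infinity>"
proof -
  interpret F: real_distribution F by fact
  define Q where "Q = scale_model F \<sigma>"
  have Q: "real_distribution Q" unfolding Q_def by (rule real_distribution_scale_model[OF F])
  interpret Q: real_distribution Q by (rule Q)
  define \<mu> where "\<mu> t = pair_sum F (\<sigma> + t) \<sigma>" for t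
  have dom: "dominates (\<mu> t) (scale_model F (\<sigma> + t))" "dominates (\<mu> t) Q" for t
    unfolding \<mu>_def Q_def by (rule pair_sum_dominates[OF F])+
  obtain \<Delta> where \<Delta>[measurable]: "\<Delta> \<in> borel_measurable borel" and \<Delta>2: "integrable Q (\<lambda>x. (\<Delta> x)\<^sup>2)"
    and small: "(\<lambda>t. L2_remainder (\<mu> t) F \<sigma> t \<Delta>) \<in> o[at 0](\<lambda>t. t)"
    using diff dom unfolding L2_differentiable_at_def Q_def by blast
  define D where "D = (\<integral>x. (\<Delta> x)\<^sup>2 \<partial>Q)"
  define X where "X n = 1 / real (Suc n)" for n
  have X: "\<And>n. X n > 0" "X \<longlonglongrightarrow> 0"
    unfolding X_def by (simp, rule LIMSEQ_Suc[OF lim_1_over_n])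
  have Xat: "filterlim X (at 0) sequentially"
    unfolding filterlim_at using X by (auto intro!: always_eventually) (metis less_irrefl)
  define e where "e n = L2_remainder (\<mu> (X n)) F \<sigma> (X n) \<Delta>" for n
  have eX: "(\<lambda>n. e n / X n) \<longlonglongrightarrow> 0"
    unfolding e_def by (rule filterlim_compose[OF smalloD_tendsto[OF small] Xat])
  have key: "(\<integral>x. x * deriv \<phi> (\<sigma> * x) \<partial>F) = (\<integral>x. \<phi> x * \<Delta> x \<partial>Q)" if \<phi>: "\<phi> \<in> C_c1" for \<phi>
  proof -
    note [measurable] = C_c1_measurable[OF \<phi>]
    obtain B where B: "\<And>x. \<bar>\<phi> x\<bar> \<le> B" "\<And>x. \<bar>deriv \<phi> x\<bar> \<le> B" "\<And>x. \<bar>x * deriv \<phi> x\<bar> \<le> B"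
      using C_c1_bounds[OF \<phi>] by blast
    let ?q = "\<lambda>n. ((\<integral>x. \<phi> x \<partial>scale_model F (\<sigma> + X n)) - (\<integral>x. \<phi> x \<partial>Q)) / X n"
    have lim1: "?q \<longlonglongrightarrow> (\<integral>x. x * deriv \<phi> (\<sigma> * x) \<partial>F)"
      unfolding Q_def by (rule test_function_derivative[OF F \<sigma> \<phi> X])
    have bd: "norm (?q n - (\<integral>x. \<phi> x * \<Delta> x \<partial>Q)) \<le> B * (2 * (e n / X n) + 1 / 2 * X n * D + 2 * (e n / X n)\<^sup>2 * X n)" for n
    proof -
      have "\<bar>(\<integral>x. \<phi> x \<partial>scale_model F (\<sigma> + X n)) - (\<integral>x. \<phi> x \<partial>Q) - X n * (\<integral>x. \<phi> x * \<Delta> x \<partial>Q)\<bar>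
          \<le> B * (2 * e n + 1 / 2 * (X n)\<^sup>2 * D + 2 * (e n)\<^sup>2)"
        unfolding e_def L2_remainder_def Q_def[symmetric] D_def
        by (rule bounded_functional_remainder[OF dom real_distribution_scale_model[OF F] Q _ B(1) \<Delta> \<Delta>2]) simp
      then have "\<bar>(\<integral>x. \<phi> x \<partial>scale_model F (\<sigma> + X n)) - (\<integral>x. \<phi> x \<partial>Q) - X n * (\<integral>x. \<phi> x * \<Delta> x \<partial>Q)\<bar> / X n
          \<le> B * (2 * e n + 1 / 2 * (X n)\<^sup>2 * D + 2 * (e n)\<^sup>2) / X n"
        using X(1)[of n] by (intro divide_right_mono) auto
      also have "\<dots> = B * (2 * (e n / X n) + 1 / 2 * X n * D + 2 * (e n / X n)\<^sup>2 * X n)"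
        using X(1)[of n] by (simp add: add_divide_distrib power_divide power2_eq_square distrib_left)
      also have "\<bar>(\<integral>x. \<phi> x \<partial>scale_model F (\<sigma> + X n)) - (\<integral>x. \<phi> x \<partial>Q) - X n * (\<integral>x. \<phi> x * \<Delta> x \<partial>Q)\<bar> / X n
          = norm (?q n - (\<integral>x. \<phi> x * \<Delta> x \<partial>Q))"
      proof -
        have "?q n - (\<integral>x. \<phi> x * \<Delta> x \<partial>Q) = ((\<integral>x. \<phi> x \<partial>scale_model F (\<sigma> + X n)) - (\<integral>x. \<phi> x \<partial>Q) - X n * (\<integral>x. \<phi> x * \<Delta> x \<partial>Q)) / X n"
          using X(1)[of n] by (simp add: diff_divide_distrib)
        then show ?thesis using X(1)[of n] by (simp add: abs_divide)
      qed
      finally show ?thesis .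
    qed
    have "(\<lambda>n. B * (2 * (e n / X n) + 1 / 2 * X n * D + 2 * (e n / X n)\<^sup>2 * X n)) \<longlonglongrightarrow> B * (2 * 0 + 1 / 2 * 0 * D + 2 * 0\<^sup>2 * 0)"
      by (intro tendsto_intros eX X)
    then have "(\<lambda>n. B * (2 * (e n / X n) + 1 / 2 * X n * D + 2 * (e n / X n)\<^sup>2 * X n)) \<longlonglongrightarrow> 0" by simp
    then have "(\<lambda>n. ?q n - (\<integral>x. \<phi> x * \<Delta> x \<partial>Q)) \<longlonglongrightarrow> 0"
      by (rule Lim_null_comparison[OF always_eventually[OF allI[OF bd]]])
    then have "?q \<longlonglongrightarrow> (\<integral>x. \<phi> x * \<Delta> x \<partial>Q)" by (rule LIM_zero_cancel)
    with lim1 show ?thesis by (rule LIMSEQ_unique)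
  qed
  have "fisher_scale1 F \<le> ennreal (\<sigma>\<^sup>2 * D)"
    unfolding fisher_scale1_def
  proof (rule SUP_least)
    fix \<psi> assume \<psi>: "\<psi> \<in> C_c1"
    define \<phi> where "\<phi> y = \<psi> (y / \<sigma>)" for y
    obtain K where K: "K > 0" "\<And>x. (\<psi> has_real_derivative deriv \<psi> x) (at x)" "continuous_on UNIV (deriv \<psi>)"
      "\<And>x. \<bar>x\<bar> > K \<Longrightarrow> deriv \<psi> x = 0"
      using C_c1E[OF \<psi>] by blast
    have d: "(\<phi> has_real_derivative deriv \<psi> (y / \<sigma>) * (1 / \<sigma>)) (at y)" for y
      unfolding \<phi>_def by (rule DERIV_chain2[OF K(2)]) (use \<sigma> in \<open>auto intro!: derivative_eq_intros\<close>)
    have \<phi>: "\<phi> \<in> C_c1"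
      unfolding C_c1_iff
    proof (intro exI[of _ "\<lambda>y. deriv \<psi> (y / \<sigma>) * (1 / \<sigma>)"] exI[of _ "K * \<sigma>"] conjI allI impI d)
      show "continuous_on UNIV (\<lambda>y. deriv \<psi> (y / \<sigma>) * (1 / \<sigma>))"
        by (intro continuous_intros continuous_on_compose2[OF K(3)]) (use \<sigma> in auto)
      fix y assume "\<bar>y\<bar> > K * \<sigma>"
      then have "\<bar>y / \<sigma>\<bar> > K" using \<sigma> by (simp add: abs_divide pos_less_divide_eq)
      then show "deriv \<psi> (y / \<sigma>) * (1 / \<sigma>) = 0" using K(4) by simp
    qed
    have d\<phi>: "deriv \<phi> = (\<lambda>y. deriv \<psi> (y / \<sigma>) * (1 / \<sigma>))" using d by (intro ext DERIV_imp_deriv)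
    note [measurable] = C_c1_measurable[OF \<phi>] C_c1_measurable[OF \<psi>]
    define N where "N = (\<integral>x. (\<psi> x)\<^sup>2 \<partial>F)"
    have NQ: "(\<integral>x. (\<phi> x)\<^sup>2 \<partial>Q) = N"
      unfolding Q_def scale_model_def N_def \<phi>_def using \<sigma> by (subst integral_distr) auto
    have "(\<integral>x. x * deriv \<psi> x \<partial>F) = \<sigma> * (\<integral>x. x * deriv \<phi> (\<sigma> * x) \<partial>F)"
      using \<sigma> by (simp add: d\<phi>)
    also have "\<dots> = \<sigma> * (\<integral>x. \<phi> x * \<Delta> x \<partial>Q)" by (simp only: key[OF \<phi>])
    finally have L: "(\<integral>x. x * deriv \<psi> x \<partial>F) = \<sigma> * (\<integral>x. \<phi> x * \<Delta> x \<partial>Q)" .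
    have "(\<integral>x. \<phi> x * \<Delta> x \<partial>Q)\<^sup>2 \<le> (\<integral>x. (\<phi> x)\<^sup>2 \<partial>Q) * D"
      unfolding D_def by (rule integral_Cauchy_Schwarz) (use Q.C_c1_integrable(2)[OF \<phi>] \<Delta>2 in auto)
    then have "\<sigma>\<^sup>2 * (\<integral>x. \<phi> x * \<Delta> x \<partial>Q)\<^sup>2 \<le> \<sigma>\<^sup>2 * (N * D)"
      unfolding NQ by (rule mult_left_mono) simp
    then have le: "(\<integral>x. x * deriv \<psi> x \<partial>F)\<^sup>2 \<le> \<sigma>\<^sup>2 * D * N"
      unfolding L by (simp add: power_mult_distrib mult.commute mult.left_commute)
    have N0: "N \<ge> 0" by (simp add: N_def)
    show "ennreal ((\<integral>x. x * deriv \<psi> x \<partial>F)\<^sup>2) / ennreal (\<integral>x. (\<psi> x)\<^sup>2 \<partial>F) \<le> ennreal (\<sigma>\<^sup>2 * D)"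
    proof (cases "N = 0")
      case True
      then show ?thesis using le by (simp add: N_def[symmetric])
    next
      case False
      then have "N > 0" using N0 by simp
      then have "(\<integral>x. x * deriv \<psi> x \<partial>F)\<^sup>2 / N \<le> \<sigma>\<^sup>2 * D"
        using le by (simp add: pos_divide_le_eq)
      then have "ennreal ((\<integral>x. x * deriv \<psi> x \<partial>F)\<^sup>2 / N) \<le> ennreal (\<sigma>\<^sup>2 * D)" by (rule ennreal_leI)
      then show ?thesis using \<open>N > 0\<close> by (simp add: N_def[symmetric] divide_ennreal)
    qed
  qed
  also have "\<dots> < \<infinity>" by simp
  finally show ?thesis .
qed

section \<open>From local asymptotic normality to finite information\<close>

context scale_density
begin

lemma scale_model_density: 
  assumes s: "s > 0"
  shows "scale_density (scale_model M s) (\<lambda>x. f (x / s) / s)"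
proof -
  interpret S: real_distribution "scale_model M s"
    by (rule real_distribution_scale_model) unfold_locales
  show ?thesis
  proof unfold_locales
    show "remove_zero_mass (scale_model M s) = density lborel (\<lambda>x. ennreal (f (x / s) / s))"
    proof (rule measure_eqI)
      fix A assume "A \<in> sets (remove_zero_mass (scale_model M s))"
      then have [measurable]: "A \<in> sets borel" by (simp add: remove_zero_mass_def)
      have "emeasure (remove_zero_mass (scale_model M s)) A = (\<integral>\<^sup>+x. indicator (- {0}) x * indicator A x \<partial>scale_model M s)"
        unfolding remove_zero_mass_def by (subst emeasure_density) auto
      also have "\<dots> = (\<integral>\<^sup>+x. ennreal (f (x / s) / s) * (indicator (- {0}) x * indicator A x) \<partial>lborel)"
        by (subst nn_integral_scale_model[OF s]) auto
      also have "\<dots> = (\<integral>\<^sup>+x. ennreal (f (x / s) / s) * indicator A x \<partial>lborel)"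
        by (intro nn_integral_cong_AE eventually_mono[OF AE_lborel_singleton[of 0]]) (auto simp: indicator_def)
      also have "\<dots> = emeasure (density lborel (\<lambda>x. ennreal (f (x / s) / s))) A"
        by (subst emeasure_density) auto
      finally show "emeasure (remove_zero_mass (scale_model M s)) A = emeasure (density lborel (\<lambda>x. ennreal (f (x / s) / s))) A" .
    qed (simp add: remove_zero_mass_def)
  qed (use s f_nonneg in auto)
qed

text \<open>Either there is an atom at the origin, common to all scales, or \<open>f > 0\<close> on an interval around some
\<open>x\<^sub>0 \<noteq> 0\<close>; a sufficiently small change of scale moves half of that interval by less than half its length.\<close>

lemma scales_overlap:
  assumes cont: "continuous_on UNIV (\<lambda>x. x * f x)"
  obtains s where "s > 1" "emeasure M {x. scale_ratio f s x > 0} \<noteq> 0"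
proof (cases "emeasure M {0} = 0")
  case False
  have "emeasure M {0} \<le> emeasure M {x. scale_ratio f 2 x > 0}"
    by (intro emeasure_mono) (auto simp: scale_ratio_def)
  then have "emeasure M {x. scale_ratio f 2 x > 0} \<noteq> 0" using False by auto
  then show ?thesis by (intro that[of 2]) auto
next
  case True
  have "\<exists>x0. x0 \<noteq> 0 \<and> f x0 > 0"
  proof (rule ccontr)
    assume "\<not> ?thesis"
    then have z: "x \<noteq> 0 \<Longrightarrow> f x = 0" for x using f_nonneg[of x] by (auto simp: less_le)
    have "emeasure M UNIV = (\<integral>\<^sup>+x. 1 \<partial>M)" by simp
    also have "\<dots> = (\<integral>\<^sup>+x. ennreal (f x) * 1 \<partial>lborel) + 1 * emeasure M {0}"
      by (rule nn_integral_zero_split[OF F0 f_meas]) simp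
    also have "(\<integral>\<^sup>+x. ennreal (f x) * 1 \<partial>lborel) = (\<integral>\<^sup>+(x::real). 0 \<partial>lborel)"
      by (intro nn_integral_cong_AE eventually_mono[OF AE_lborel_singleton[of 0]]) (simp add: z)
    finally show False using True emeasure_space_1 by simp
  qed
  then obtain x0 where x0: "x0 \<noteq> 0" "f x0 > 0" by blast
  have "continuous_on (- {0}) (\<lambda>x. x * f x / x)"
    by (intro continuous_on_divide continuous_on_subset[OF cont] continuous_on_id) auto
  then have fc: "continuous_on (- {0}) f"
    by (rule continuous_on_eq) auto
  have "open (- {0::real})" by auto
  then have "open ({y \<in> - {0}. 0 < f y})"
    using continuous_open_preimage[OF fc, of "{0<..}"] by (simp add: vimage_def Int_def)
  moreover have "x0 \<in> {y \<in> - {0}. 0 < f y}" using x0 by simp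
  ultimately obtain d where d: "d > 0" "ball x0 d \<subseteq> {y \<in> - {0}. 0 < f y}"
    by (rule openE)
  \<comment> \<open>Dividing by \<open>1 + \<eta>\<close> moves points of modulus at most \<open>|x\<^sub>0| + d\<close> by at most \<open>d / 4\<close>.\<close>
  define \<eta> where "\<eta> = d / (4 * (\<bar>x0\<bar> + d))"
  define s where "s = 1 + \<eta>"
  have \<eta>: "\<eta> > 0" using d by (simp add: \<eta>_def)
  have s: "s > 1" using \<eta> by (simp add: s_def)
  have cancel: "w * (d / (4 * w)) = d / 4" if "w > 0" for w :: real
    using that by simp
  have \<eta>4: "(\<bar>x0\<bar> + d) * \<eta> = d / 4"
    unfolding \<eta>_def by (rule cancel) (use d(1) in simp)
  have "ball x0 (d / 2) \<subseteq> {x. scale_ratio f s x > 0}"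
  proof
    fix x assume x: "x \<in> ball x0 (d / 2)"
    then have dx: "\<bar>x - x0\<bar> < d / 2" by (simp add: dist_real_def abs_minus_commute)
    have "\<bar>x / s - x\<bar> = \<bar>x\<bar> * (\<eta> / s)"
    proof -
      have "x / s - x = - (x * (\<eta> / s))" using s by (simp add: s_def field_simps)
      then show ?thesis using s \<eta> by (simp add: abs_mult)
    qed
    also have "\<dots> \<le> (\<bar>x0\<bar> + d) * \<eta>"
    proof (rule mult_mono)
      show "\<bar>x\<bar> \<le> \<bar>x0\<bar> + d" using dx d(1) by linarith
      show "\<eta> / s \<le> \<eta>" using s \<eta> by (simp add: divide_le_eq)
    qed (use s \<eta> d in auto)
    also have "\<dots> = d / 4" by (rule \<eta>4)
    finally have "\<bar>x / s - x0\<bar> < d"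
      using dx d(1) abs_triangle_ineq[of "x / s - x" "x - x0"] by simp
    then have "x / s \<in> ball x0 d" "x \<in> ball x0 d"
      using x d(1) by (auto simp: dist_real_def abs_minus_commute)
    then have "x \<noteq> 0" "f x > 0" "f (x / s) > 0" using d(2) by blast+
    then show "x \<in> {x. scale_ratio f s x > 0}" using s by (simp add: scale_ratio_def)
  qed
  then have "emeasure M (ball x0 (d / 2)) \<le> emeasure M {x. scale_ratio f s x > 0}"
    by (intro emeasure_mono) auto
  moreover have "emeasure M (ball x0 (d / 2)) \<noteq> 0"
  proof
    have ball[measurable]: "ball x0 (d / 2) \<in> sets borel" by simp
    assume "emeasure M (ball x0 (d / 2)) = 0"
    then have "(\<integral>\<^sup>+x. indicator (ball x0 (d / 2)) x \<partial>M) = 0" by simp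
    then have "(\<integral>\<^sup>+x. ennreal (f x) * indicator (ball x0 (d / 2)) x \<partial>lborel) = 0"
      by (subst (asm) nn_integral_zero_split[OF F0 f_meas borel_measurable_indicator[OF ball]]) simp
    then have "AE x in lborel. ennreal (f x) * indicator (ball x0 (d / 2)) x = 0"
      by (subst (asm) nn_integral_0_iff_AE) auto
    then have "AE x in lborel. x \<notin> ball x0 (d / 2)"
    proof eventually_elim
      case (elim x)
      show ?case
      proof
        assume x: "x \<in> ball x0 (d / 2)"
        then have "x \<in> ball x0 d" using d(1) by auto
        then have "f x > 0" using d(2) by blast
        then show False using elim x by simp
      qed
    qed
    then have "ball x0 (d / 2) \<in> null_sets lborel"
      by (subst AE_iff_null_sets) auto
    then have "emeasure lborel (ball x0 (d / 2)) = 0" by auto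
    moreover have "ball x0 (d / 2) = {x0 - d / 2<..<x0 + d / 2}" by (rule ball_eq_greaterThanLessThan)
    ultimately show False using d(1) by simp
  qed
  ultimately have "emeasure M {x. scale_ratio f s x > 0} \<noteq> 0"
    by (metis le_zero_eq)
  then show ?thesis by (rule that[OF s])
qed

end

lemma LAN_at_single_observation:
  assumes "LAN_at F \<sigma>"
  obtains f where "has_scale_density F f"
    "\<And>h. \<sigma> + h > 0 \<Longrightarrow> \<exists>r. AE x in scale_model_pow F 1 \<sigma>.
      ln_ext (likelihood_ratio (scale_model_pow F 1 (\<sigma> + h)) (scale_model_pow F 1 \<sigma>) x)
      = ereal (h * scale_score f \<sigma> (x 0)) - ereal (1 / 2 * h\<^sup>2) * enn2ereal (fisher_scale F \<sigma>) + r x"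
  using assms unfolding LAN_at_def
proof (elim exE conjE, goal_cases)
  case (1 f)
  show ?case
  proof (rule that[OF 1(2)])
    fix h assume h: "\<sigma> + h > 0"
    from spec[OF 1(3), of h]
    show "\<exists>r. AE x in scale_model_pow F 1 \<sigma>.
      ln_ext (likelihood_ratio (scale_model_pow F 1 (\<sigma> + h)) (scale_model_pow F 1 \<sigma>) x)
      = ereal (h * scale_score f \<sigma> (x 0)) - ereal (1 / 2 * h\<^sup>2) * enn2ereal (fisher_scale F \<sigma>) + r x"
    proof (elim exE conjE, goal_cases)
      case (1 R)
      show ?case
        using 1(1)[rule_format, of 1] h by (intro exI[of _ "R 1"]) simp
    qed
  qed
qed

text \<open>If the information were infinite, the expansion for a single observation would have the form
\<open>ln L = c - \<infinity> + r\<close>, and this sum of extended reals is \<open>-\<infinity>\<close> or \<open>\<infinity>\<close> for every \<open>r\<close>. As \<open>L\<close> is finite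
almost everywhere, it would vanish almost everywhere, contrary to the overlap of neighbouring scales.\<close>

theorem LAN_imp_fisher_finite:
  assumes F: "real_distribution F" and \<sigma>: "\<sigma> > 0" and LAN: "LAN_at F \<sigma>"
  shows "fisher_scale1 F < \<infinity>"
proof (rule ccontr)
  assume "\<not> fisher_scale1 F < \<infinity>"
  then have inf: "fisher_scale1 F = \<infinity>" by (simp add: not_less top_unique)
  interpret F: real_distribution F by fact
  obtain f where dens: "has_scale_density F f"
    and exp: "\<And>h. \<sigma> + h > 0 \<Longrightarrow> \<exists>r. AE x in scale_model_pow F 1 \<sigma>.
      ln_ext (likelihood_ratio (scale_model_pow F 1 (\<sigma> + h)) (scale_model_pow F 1 \<sigma>) x)
      = ereal (h * scale_score f \<sigma> (x 0)) - ereal (1 / 2 * h\<^sup>2) * enn2ereal (fisher_scale F \<sigma>) + r x"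
    by (rule LAN_at_single_observation[OF LAN]) (rule that)
  interpret D: scale_density F f
    using dens by unfold_locales (auto simp: has_scale_density_def)
  define F' where "F' = scale_model F \<sigma>"
  define g where "g x = f (x / \<sigma>) / \<sigma>" for x
  interpret S: scale_density F' g
    unfolding F'_def g_def using D.scale_model_density[OF \<sigma>] .
  have "continuous_on UNIV (\<lambda>x. x * f x)"
    using dens by (intro absolutely_continuous_fun_imp_continuous) (simp add: has_scale_density_def)
  then have "continuous_on UNIV (\<lambda>x. (x / \<sigma>) * f (x / \<sigma>))"
    by (rule continuous_on_compose2[where f="\<lambda>x. x / \<sigma>"]) (use \<sigma> in \<open>auto intro!: continuous_intros\<close>)
  then have gc: "continuous_on UNIV (\<lambda>x. x * g x)"
    by (simp add: g_def)
  obtain s where s: "s > 1" and pos: "emeasure F' {x. scale_ratio g s x > 0} \<noteq> 0"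
    by (rule S.scales_overlap[OF gc])
  define h where "h = \<sigma> * (s - 1)"
  have h: "h > 0" "\<sigma> + h = s * \<sigma>" using \<sigma> s by (auto simp: h_def algebra_simps)
  have comp: "scale_model F (\<sigma> + h) = scale_model F' s"
  proof -
    have "(\<lambda>x. s * \<sigma> * x) = (\<lambda>x. s * x) \<circ> (\<lambda>x. \<sigma> * x)" by (auto simp: mult.assoc)
    then show ?thesis
      unfolding F'_def scale_model_def h(2) by (simp only:) (rule distr_distr[symmetric], auto)
  qed
  have info: "ereal (1 / 2 * h\<^sup>2) * enn2ereal (fisher_scale F \<sigma>) = \<infinity>"
  proof -
    have "fisher_scale F \<sigma> = \<infinity>"
      unfolding fisher_scale_def inf using \<sigma> by (simp add: ennreal_mult_eq_top_iff)
    then show ?thesis using h by simp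
  qed
  obtain r where r: "AE x in scale_model_pow F 1 \<sigma>.
      ln_ext (likelihood_ratio (scale_model_pow F 1 (\<sigma> + h)) (scale_model_pow F 1 \<sigma>) x)
      = ereal (h * scale_score f \<sigma> (x 0)) - \<infinity> + r x"
    using exp[of h] \<sigma> h unfolding info by auto
  let ?P = "PiM {..<1::nat} (\<lambda>_. F')"
  have pow: "scale_model_pow F 1 \<sigma> = ?P" "scale_model_pow F 1 (\<sigma> + h) = PiM {..<1::nat} (\<lambda>_. scale_model F' s)"
    unfolding scale_model_pow_def F'_def[symmetric] comp by simp_all
  have "AE x in ?P. ln_ext (likelihood_ratio (PiM {..<1::nat} (\<lambda>_. scale_model F' s)) ?P x)
      = ereal (h * scale_score f \<sigma> (x 0)) - \<infinity> + r x"
    using r unfolding pow .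
  moreover have "AE x in ?P. likelihood_ratio (PiM {..<1::nat} (\<lambda>_. scale_model F' s)) ?P x
      = (\<Prod>i\<in>{..<1::nat}. ennreal (scale_ratio g s (x i)))"
  proof (rule likelihood_ratio_PiM(2))
    show "prob_space (scale_model F' s)"
      using real_distribution_scale_model[of F' s] S.real_distribution_axioms by (simp add: real_distribution_def)
    show "density F' (\<lambda>x. ennreal (scale_ratio g s x)) = density (scale_model F' s) (indicator (space F' - singular_part g))"
      using S.density_scale_ratio[of s] s by (simp add: Compl_eq_Diff_UNIV)
  qed (auto simp: S.prob_space_axioms S.singular_part_null scale_model_def)
  ultimately have ae: "AE x in ?P. \<not> scale_ratio g s (x 0) > 0"
  proof eventually_elim
    case (elim x)
    have eq: "ln_ext (ennreal (scale_ratio g s (x 0))) = - \<infinity> + r x"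
      using elim by simp
    show ?case
    proof
      assume "scale_ratio g s (x 0) > 0"
      then have "ln_ext (ennreal (scale_ratio g s (x 0))) = ereal (ln (scale_ratio g s (x 0)))"
        by (simp add: ln_ext_def)
      then show False using eq by (cases "r x") auto
    qed
  qed
  have c: "(\<lambda>x. x 0) \<in> measurable ?P F'"
    by (intro measurable_component_singleton) simp
  have "AE y in distr ?P F' (\<lambda>x. x 0). \<not> scale_ratio g s y > 0"
    by (subst AE_distr_iff[OF c]) (use ae in auto)
  then have "AE y in F'. \<not> scale_ratio g s y > 0"
    by (simp only: S.distr_iid_component[of 0 1] zero_less_one)
  then have "{x. scale_ratio g s x > 0} \<in> null_sets F'"
    by (subst AE_iff_null_sets) auto
  then show False using pos by auto
qed

section \<open>The equivalence\<close>

lemma fisher_scale_finite_iff: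
  assumes "\<sigma> > 0"
  shows "fisher_scale F \<sigma> < \<infinity> \<longleftrightarrow> fisher_scale1 F < \<infinity>"
  unfolding fisher_scale_def using assms by (auto simp: ennreal_mult_less_top)

text \<open>The representing function is redefined as \<open>0\<close> at the origin, which does not change its class in
\<open>L\<^sub>2(F)\<close>.\<close>

theorem fisher_finite_imp_L2_differentiable_and_LAN:
  assumes F: "real_distribution F" and fin: "fisher_scale1 F < \<infinity>"
  shows "L2_differentiable_at F 1" "LAN_at F 1"
proof -
  interpret real_distribution F by fact
  obtain \<Lambda>' where \<Lambda>': "\<Lambda>' \<in> borel_measurable borel" "integrable F (\<lambda>x. (\<Lambda>' x)\<^sup>2)"
    "\<And>\<phi>. \<phi> \<in> C_c1 \<Longrightarrow> (\<integral>x. x * deriv \<phi> x \<partial>F) = (\<integral>x. \<phi> x * \<Lambda>' x \<partial>F)"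
    "fisher_scale1 F = ennreal (\<integral>x. (\<Lambda>' x)\<^sup>2 \<partial>F)"
    using scale_score_representation[OF fin] by blast
  interpret S': scale_score_function F \<Lambda>'
    by unfold_locales (use \<Lambda>' in auto)
  define \<Lambda> where "\<Lambda> x = (if x = 0 then 0 else \<Lambda>' x)" for x
  have \<Lambda>m[measurable]: "\<Lambda> \<in> borel_measurable borel" unfolding \<Lambda>_def by measurable
  have "AE x in F. \<Lambda>' 0 = 0 \<or> x \<noteq> 0"
  proof (cases "\<Lambda>' 0 = 0")
    case False
    then have "emeasure F {0} = 0" using S'.\<Lambda>_zero_atom by (simp add: emeasure_eq_measure)
    then have "AE x in F. x \<notin> {0}" by (intro AE_not_in null_setsI) auto
    then show ?thesis by eventually_elim simp
  qed simp
  then have ae: "AE x in F. \<Lambda> x = \<Lambda>' x" by eventually_elim (auto simp: \<Lambda>_def)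
  have sq: "integrable F (\<lambda>x. (\<Lambda> x)\<^sup>2)" "(\<integral>x. (\<Lambda> x)\<^sup>2 \<partial>F) = (\<integral>x. (\<Lambda>' x)\<^sup>2 \<partial>F)"
  proof -
    have ae2: "AE x in F. (\<Lambda> x)\<^sup>2 = (\<Lambda>' x)\<^sup>2" using ae by eventually_elim simp
    show "integrable F (\<lambda>x. (\<Lambda> x)\<^sup>2)"
      using \<Lambda>'(2) by (subst integrable_cong_AE[OF _ _ ae2]) auto
    show "(\<integral>x. (\<Lambda> x)\<^sup>2 \<partial>F) = (\<integral>x. (\<Lambda>' x)\<^sup>2 \<partial>F)"
      by (rule integral_cong_AE[OF _ _ ae2]) auto
  qed
  interpret S: scale_score_function F \<Lambda>
  proof unfold_locales
    fix \<phi> assume \<phi>: "\<phi> \<in> C_c1"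
    note [measurable] = C_c1_measurable[OF \<phi>]
    have "(\<integral>x. \<phi> x * \<Lambda> x \<partial>F) = (\<integral>x. \<phi> x * \<Lambda>' x \<partial>F)"
      by (rule integral_cong_AE) (use ae in auto)
    then show "(\<integral>x. x * deriv \<phi> x \<partial>F) = (\<integral>x. \<phi> x * \<Lambda> x \<partial>F)"
      using \<Lambda>'(3)[OF \<phi>] by simp
  qed (use sq in auto)
  have \<Lambda>0: "\<Lambda> 0 = 0" by (simp add: \<Lambda>_def)
  note reg = S.density_regularity[OF \<Lambda>0]
  interpret R: scale_regular_density S.tail_density \<Lambda> by (rule reg)
  interpret D0: scale_density F S.tail_density
    by unfold_locales (fact S.tail_density_meas S.tail_density_nonneg S.remove_zero_mass_density)+
  interpret D: scale_dqm F S.tail_density \<Lambda>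
    by unfold_locales (fact \<Lambda>0)
  show "L2_differentiable_at F 1" by (rule D.L2_differentiable)
  show "LAN_at F 1"
    by (rule D.LAN[OF reg(2) _ S.\<Lambda>_mean]) (simp add: \<Lambda>'(4) sq(2))
qed

theorem proposition3p2:
  fixes F :: "real measure"
  assumes "real_distribution F"
  shows "((\<exists>\<sigma>>0. fisher_scale F \<sigma> < \<infinity>) \<longleftrightarrow> (\<exists>\<sigma>>0. L2_differentiable_at F \<sigma>)) \<and>
         ((\<exists>\<sigma>>0. L2_differentiable_at F \<sigma>) \<longleftrightarrow> (\<exists>\<sigma>>0. LAN_at F \<sigma>))"
proof -
  have fisher: "(\<exists>\<sigma>>0. fisher_scale F \<sigma> < \<infinity>) \<longleftrightarrow> fisher_scale1 F < \<infinity>"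
    using fisher_scale_finite_iff zero_less_one by blast
  have "(\<exists>\<sigma>>0. L2_differentiable_at F \<sigma>) \<longleftrightarrow> fisher_scale1 F < \<infinity>"
    using L2_differentiable_imp_fisher_finite[OF assms] fisher_finite_imp_L2_differentiable_and_LAN(1)[OF assms]
      zero_less_one by blast
  moreover have "(\<exists>\<sigma>>0. LAN_at F \<sigma>) \<longleftrightarrow> fisher_scale1 F < \<infinity>"
    using LAN_imp_fisher_finite[OF assms] fisher_finite_imp_L2_differentiable_and_LAN(2)[OF assms]
      zero_less_one by blast
  ultimately show ?thesis using fisher by blast
qed

end
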